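(* Let $P$ be a finite $(3+1)$-free poset and $\Gamma$ a $P$-Knuth equivalence graph. Then $F_\Gamma(\mathbf{x})=\sum_{w\in V(\Gamma)}Q_{\mathrm{Des}_P(w)}(\mathbf{x})$ is a Schur positive symmetric function, and for every partition $\lambda$ the coefficient of $s_\lambda(\mathbf{x})$ in $F_\Gamma(\mathbf{x})$ equals the number of $P$-tableaux $T$ of shape $\lambda$ such that $\mathrm{colword}(T)$ is a vertex of $\Gamma$.
   Context: A poset is $(3+1)$-free if it has no induced subposet isomorphic to the disjoint union of a 3-element chain and a 1-element chain. Write $a<_P b$ for strict order, $a\sim_P b$ for incomparable or equal. For a word $w=w_1\cdots w_n$ in the alphabet $P$, $\mathrm{Des}_P(w)=\{i\in[n-1]: w_{i+1}<_P w_i\}$, and for $D\subseteq[n-1]$, $Q_D(\mathbf{x})=\sum x_{i_1}\cdots x_{i_n}$ over $1\le i_1\le\cdots\le i_n$ with $i_j<i_{j+1}$ whenever $j\in D$ (Gessel's fundamental quasisymmetric function). Two words $w,w'$ of length $n$ are related by a $P$-Knuth transformation in position $i$ ($1<i<n$) if $w_j=w'_j$ for $j\notin\{i-1,i,i+1\}$ and $\{w_{i-1}w_iw_{i+1},w'_{i-1}w'_iw'_{i+1}\}$ is one of: (1) $\{bac,bca\}$ with $a<_Pb$, $c\not<_Pb$, $a<_Pc$; (2) $\{cab,acb\}$ with $b\not<_Pa$, $b<_Pc$, $a<_Pc$; (3) $\{cab,bca\}$ with $a\sim_Pb$, $b\sim_Pc$, $a<_Pc$. Let $\Gamma^n$ be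 the graph on all words of length $n$ in $P$ whose edges are $P$-Knuth transformations; a $P$-Knuth equivalence graph is a union of connected components of some $\Gamma^n$. A $P$-tableau of shape $\lambda$ is a filling $T$ of the Young diagram of $\lambda$ (English notation) by elements of $P$ with $T(1,c)<_PT(2,c)<_P\cdots$ down each column and $T(r,c+1)\not<_PT(r,c)$ along each row; $\mathrm{colword}(T)$ reads each column bottom to top, columns left to right. *)

theory Defs
  imports "HOL-Library.FuncSet"
begin

definition incomp :: "'a::order \<Rightarrow> 'a \<Rightarrow> bool" where
  "incomp x y \<longleftrightarrow> \<not> x < y \<and> \<not> y < x"   (* incomparable or equal *)

definition three_one_free :: "'a::order set \<Rightarrow> bool" where
  "three_one_free P \<longleftrightarrow>
     \<not> (\<exists>a\<in>P. \<exists>b\<in>P. \<exists>c\<in>P. \<exists>d\<in>P.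
          a < b \<and> b < c \<and> incomp d a \<and> incomp d b \<and> incomp d c)"

text \<open>A formal power series in the variables x_0, x_1, x_2, ... is represented by its
  coefficient function on exponent vectors (nat => nat).\<close>

definition Des :: "'a::order list \<Rightarrow> nat set" where
  "Des w = {i. 1 \<le> i \<and> i < length w \<and> w ! i < w ! (i - 1)}"

definition gessel :: "nat \<Rightarrow> nat set \<Rightarrow> (nat \<Rightarrow> nat) \<Rightarrow> int" where
  "gessel n D \<alpha> = int (card {s :: nat list. length s = n \<and> sorted s \<and>
        (\<forall>j\<in>D. s ! (j - 1) < s ! j) \<and> (\<forall>k. count_list s k = \<alpha> k)})"

definition symmetric_fn :: "((nat \<Rightarrow> nat) \<Rightarrow> int) \<Rightarrow> bool" where
  "symmetric_fn F \<longleftrightarrow> (\<forall>\<pi> \<alpha>. bij \<pi> \<longrightarrow> F (\<alpha> \<circ> \<pi>) = F \<alpha>)"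

definition knuth_triple :: "'a::order list \<Rightarrow> 'a list \<Rightarrow> bool" where
  "knuth_triple t t' \<longleftrightarrow> (\<exists>a b c.
     (a < b \<and> \<not> c < b \<and> a < c \<and> {t, t'} = {[b,a,c], [b,c,a]}) \<or>
     (\<not> b < a \<and> b < c \<and> a < c \<and> {t, t'} = {[c,a,b], [a,c,b]}) \<or>
     (incomp a b \<and> incomp b c \<and> a < c \<and> {t, t'} = {[c,a,b], [b,c,a]}))"

definition knuth_move :: "'a::order list \<Rightarrow> 'a list \<Rightarrow> bool" where
  "knuth_move w w' \<longleftrightarrow> (\<exists>u v t t'. length t = 3 \<and> w = u @ t @ v \<and> w' = u @ t' @ v
                                   \<and> knuth_triple t t')"

text \<open>The vertex set of a P-Knuth equivalence graph: a union of connected components of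
  Gamma^n, i.e. a set of length-n words closed under P-Knuth transformations.\<close>

definition knuth_equiv_graph :: "nat \<Rightarrow> 'a::order list set \<Rightarrow> bool" where
  "knuth_equiv_graph n V \<longleftrightarrow> V \<subseteq> {w. length w = n} \<and>
     (\<forall>w w'. w \<in> V \<longrightarrow> knuth_move w w' \<longrightarrow> w' \<in> V)"

definition F_Gamma :: "nat \<Rightarrow> 'a::order list set \<Rightarrow> (nat \<Rightarrow> nat) \<Rightarrow> int" where
  "F_Gamma n V \<alpha> = (\<Sum>w\<in>V. gessel n (Des w) \<alpha>)"

definition is_partition :: "nat list \<Rightarrow> bool" where
  "is_partition la \<longleftrightarrow> sorted (rev la) \<and> 0 \<notin> set la"

(* cells (row, column), 0-indexed, English notation *)
definition young :: "nat list \<Rightarrow> (nat \<times> nat) set" where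
  "young la = {(r, c). r < length la \<and> c < la ! r}"

definition ssyt :: "nat list \<Rightarrow> (nat \<times> nat \<Rightarrow> nat) \<Rightarrow> bool" where
  "ssyt la T \<longleftrightarrow> T \<in> extensional (young la) \<and>
     (\<forall>r c. (r, Suc c) \<in> young la \<longrightarrow> T (r, c) \<le> T (r, Suc c)) \<and>
     (\<forall>r c. (Suc r, c) \<in> young la \<longrightarrow> T (r, c) < T (Suc r, c))"

definition schur :: "nat list \<Rightarrow> (nat \<Rightarrow> nat) \<Rightarrow> int" where
  "schur la \<alpha> = int (card {T. ssyt la T \<and> (\<forall>k. card {x \<in> young la. T x = k} = \<alpha> k)})"

definition ptableau :: "nat list \<Rightarrow> (nat \<times> nat \<Rightarrow> 'a::order) \<Rightarrow> bool" where
  "ptableau la T \<longleftrightarrow> T \<in> extensional (young la) \<and>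
     (\<forall>r c. (Suc r, c) \<in> young la \<longrightarrow> T (r, c) < T (Suc r, c)) \<and>
     (\<forall>r c. (r, Suc c) \<in> young la \<longrightarrow> \<not> T (r, Suc c) < T (r, c))"

definition ncols :: "nat list \<Rightarrow> nat" where
  "ncols la = (case la of [] \<Rightarrow> 0 | a # _ \<Rightarrow> a)"

definition col_height :: "nat list \<Rightarrow> nat \<Rightarrow> nat" where
  "col_height la c = length (filter (\<lambda>x. c < x) la)"

definition colword :: "nat list \<Rightarrow> (nat \<times> nat \<Rightarrow> 'a) \<Rightarrow> 'a list" where
  "colword la T = concat (map (\<lambda>c. rev (map (\<lambda>r. T (r, c)) [0..<col_height la c])) [0..<ncols la])"

end

theory Submission
  imports Defs "Jordan_Normal_Form.Determinant" "HOL-Library.Poly_Mapping"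
begin

text \<open>
  The words of \<open>V\<close> are paired with noncommutative elementary and complete functions: \<open>e\<^sub>k\<close> sums the
  strictly decreasing words of length \<open>k\<close> and \<open>h\<^sub>k\<close> the words without descents. The coefficient of
  \<open>x\<^sup>\<alpha>\<close> in \<open>F\<close> is the pairing of \<open>V\<close> with a product of \<open>h\<close>'s. Three facts are needed.

  First, the \<open>e\<^sub>k\<close> commute modulo Knuth moves. For a pair of chains, the components of the
  incomparability graph are paths and 4-cycles; the odd components behave like the letters plus and
  minus in the bracketing rule for crystals, and moving the first unmatched odd component from one
  chain to the other preserves the Knuth class.

  Second, Gasharov's sign cancellation for the Jacobi-Trudi determinant in the \<open>e\<^sub>k\<close> respects Knuth
  classes. Cut two adjacent columns at their first flaw; the two tails are then arbitrary chains in
  one and the same upper set, the words of the heads can be moved out of the way, and exchanging the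
  lengths of the tails is an instance of commutation. Hence the determinant of a shape pairs with
  \<open>V\<close> to the number of tableaux of this shape.

  Third, the Pieri rule for these determinants holds in the commutative polynomial ring in the
  \<open>e\<^sub>k\<close>; iterated, it expands products of \<open>h\<close>'s with semistandard tableau numbers as coefficients.
\<close>

section \<open>Knuth classes and pairs of chains\<close>

text \<open>The (3+1)-free hypothesis enters only through \<open>below_third\<close> and its
  contrapositive. Commutation of the \<open>e\<close>'s and the exchange of tails depend on each
  other: exchanging tails is commutation for shorter chains, while proving commutation for two
  columns needs such an exchange. Induction on the total length breaks the circle, and commutation
  has to be stated for chains in an arbitrary set \<open>S\<close> because the tails range over an
  upper set. The exchange of tails is an equality of sums over all pairs of tails, not a
  correspondence term by term. Therefore the sign cancellation is not carried out by an involution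
  on arrays; arrays are grouped by a key, and the cancellation takes place between the sums over the
  groups. Only the \<open>e\<close>'s are shown to commute on words. The \<open>h\<close>'s are
  polynomials in the \<open>e\<close>'s that turn out to pair with the words without descents, so
  symmetry of \<open>F\<close> comes from commutativity of the polynomial ring. The coefficients of
  the Schur functions are cardinalities, hence positivity needs no further argument.\<close>

locale free31_order =
  fixes lt :: "'a \<Rightarrow> 'a \<Rightarrow> bool" (infix "\<prec>" 50)
  assumes irr: "\<not> x \<prec> x"
    and trans: "x \<prec> y \<Longrightarrow> y \<prec> z \<Longrightarrow> x \<prec> z"
    and free: "a \<prec> b \<Longrightarrow> b \<prec> c \<Longrightarrow>
      a \<prec> d \<or> d \<prec> a \<or> b \<prec> d \<or> d \<prec> b \<or> c \<prec> d \<or> d \<prec> c"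
    and fin: "finite (UNIV :: 'a set)"
begin

text \<open>The order is a locale parameter so that it can be reversed: mirrored statements about
  columns and decompositions are obtained by interpreting the locale for the reversed order.\<close>

lemma dual: "free31_order (\<lambda>x y. y \<prec> x)"
  by unfold_locales (use irr trans free fin in blast)+

lemma asym: "x \<prec> y \<Longrightarrow> \<not> y \<prec> x"
  using irr trans by blast

text \<open>The form in which (3+1)-freeness is used: \<open>d\<close> is comparable to one of the
  three elements, and every comparison that does not put \<open>d\<close> above \<open>a\<close>
  puts it below \<open>c\<close>.\<close>

lemma below_third: "a \<prec> b \<Longrightarrow> b \<prec> c \<Longrightarrow> \<not> a \<prec> d \<Longrightarrow> d \<prec> c"
  using free[of a b c d] trans[of a b d] trans[of d a b] trans[of d b c] trans[of a b c] trans[of a c d]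
  by argo

lemma above_first: "a \<prec> b \<Longrightarrow> b \<prec> c \<Longrightarrow> \<not> d \<prec> c \<Longrightarrow> a \<prec> d"
  using below_third[of a b c d] by blast

inductive keq :: "'a list \<Rightarrow> 'a list \<Rightarrow> bool" where
  k1: "a \<prec> b \<Longrightarrow> \<not> c \<prec> b \<Longrightarrow> a \<prec> c \<Longrightarrow> keq (u @ [b,a,c] @ v) (u @ [b,c,a] @ v)"
| k2: "\<not> b \<prec> a \<Longrightarrow> b \<prec> c \<Longrightarrow> a \<prec> c \<Longrightarrow> keq (u @ [c,a,b] @ v) (u @ [a,c,b] @ v)"
| k3: "\<not> a \<prec> b \<Longrightarrow> \<not> b \<prec> a \<Longrightarrow> \<not> b \<prec> c \<Longrightarrow> \<not> c \<prec> b \<Longrightarrow> a \<prec> c \<Longrightarrow>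
    keq (u @ [c,a,b] @ v) (u @ [b,c,a] @ v)"
| krefl: "keq w w"
| ksym: "keq w w' \<Longrightarrow> keq w' w"
| ktrans [trans]: "keq w w' \<Longrightarrow> keq w' w'' \<Longrightarrow> keq w w''"

lemma keq_context: "keq w w' \<Longrightarrow> keq (p @ w @ s) (p @ w' @ s)"
proof (induction rule: keq.induct)
  case (k1 a b c u v)
  then show ?case using keq.k1[of a b c "p @ u" "v @ s"] by simp
next
  case (k2 b a c u v)
  then show ?case using keq.k2[of b a c "p @ u" "v @ s"] by simp
next
  case (k3 a b c u v)
  then show ?case using keq.k3[of a b c "p @ u" "v @ s"] by simp
next
  case krefl show ?case by (rule keq.krefl)
next
  case ksym from ksym.IH show ?case by (rule keq.ksym)
next
  case ktrans from ktrans.IH show ?case by (rule keq.ktrans)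
qed

lemma keq_append_left: "keq w w' \<Longrightarrow> keq (p @ w) (p @ w')"
  using keq_context[of w w' p "[]"] by simp

lemma keq_append_right: "keq w w' \<Longrightarrow> keq (w @ s) (w' @ s)"
  using keq_context[of w w' "[]" s] by simp

text \<open>Reversing words and order together exchanges \<open>k1\<close> and \<open>k2\<close> and
  preserves \<open>k3\<close>.\<close>

lemma keq_rev_dual:
  assumes "keq w w'"
  shows "free31_order.keq (\<lambda>x y. y \<prec> x) (rev w) (rev w')"
proof -
  interpret d: free31_order "\<lambda>x y. y \<prec> x" by (rule dual)
  show ?thesis
    using assms
  proof (induction rule: keq.induct)
    case (k1 a b c u v)
    then show ?case
      using d.ksym[OF d.k2[where b=b and a=c and c=a and u="rev v" and v="rev u"]] by simp
  next
    case (k2 b a c u v)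
    then show ?case
      using d.ksym[OF d.k1[where a=c and b=b and c=a and u="rev v" and v="rev u"]] by simp
  next
    case (k3 a b c u v)
    then show ?case
      using d.ksym[OF d.k3[where a=c and b=b and c=a and u="rev v" and v="rev u"]] by simp
  next
    case krefl show ?case by (rule d.krefl)
  next
    case ksym from ksym.IH show ?case by (rule d.ksym)
  next
    case ktrans from ktrans.IH show ?case by (rule d.ktrans)
  qed
qed

section \<open>Moving columns past one another by Knuth moves\<close>

abbreviation decr :: "'a list \<Rightarrow> bool" where
  "decr \<equiv> sorted_wrt (\<lambda>x y. y \<prec> x)"

abbreviation incr :: "'a list \<Rightarrow> bool" where
  "incr \<equiv> sorted_wrt (\<prec>)"

text \<open>Each step is one \<open>k2\<close>, applied to a letter \<open>x\<close> of
  \<open>X\<close>, to \<open>a\<close>, and to the letter after \<open>x\<close> in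
  \<open>X @ [b]\<close>. The letter \<open>b\<close> is there to be this third letter for the end
  of \<open>X\<close>.\<close>

lemma pass:
  assumes "decr (X @ [b])" "\<And>x. x \<in> set X \<Longrightarrow> a \<prec> x" "\<not> b \<prec> a"
  shows "keq (a # X @ b # s) (X @ a # b # s)"
  using assms
proof (induction X)
  case Nil
  then show ?case by (simp add: krefl)
next
  case (Cons x X)
  obtain y t where y: "X @ b # s = y # t" "y \<in> set (X @ [b])"
    by (cases X) auto
  have "\<not> y \<prec> a" "y \<prec> x" "a \<prec> x"
    using y Cons.prems by (auto dest: asym)
  then have "keq (x # a # X @ b # s) (a # x # X @ b # s)"
    using k2[of y a x "[]" t] y by simp
  moreover have "keq (x # a # X @ b # s) (x # X @ a # b # s)"
    using keq_append_left[of "a # X @ b # s" "X @ a # b # s" "[x]"] Cons by simp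
  ultimately show ?case
    by (metis append_Cons ksym ktrans)
qed

text \<open>The letter \<open>y\<close> on top of \<open>Y\<close> may be incomparable to the top letter of \<open>W\<close>. The remainder \<open>Z\<close>
  does not depend on \<open>D\<close>, so taking \<open>D\<close> empty identifies it up to equivalence.\<close>

lemma slide_column_aux:
  assumes "decr W" "decr (y # Y)" "length W \<le> length Y" "\<And>s. s < length W \<Longrightarrow> \<not> Y ! s \<prec> W ! s"
  shows "\<exists>Z. \<forall>D. decr D \<longrightarrow> (\<forall>x\<in>set D. \<forall>z\<in>set (W @ y # Y). z \<prec> x) \<longrightarrow>
    keq (W @ D @ y # Y) (D @ y # Z)"
  using assms
proof (induction W arbitrary: y Y)
  case Nil
  show ?case by (auto intro: krefl)
next
  case (Cons w W)
  then obtain y' Y' where Y: "Y = y' # Y'" by (cases Y) auto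
  have al: "\<not> Y' ! s \<prec> W ! s" if "s < length W" for s
    using Cons.prems(4)[of "Suc s"] that Y by simp
  have "decr (y' # Y')" using Cons.prems Y by simp
  then obtain Z where Z: "\<And>D. decr D \<Longrightarrow> \<forall>x\<in>set D. \<forall>z\<in>set (W @ y' # Y'). z \<prec> x \<Longrightarrow>
      keq (W @ D @ y' # Y') (D @ y' # Z)"
    using Cons.IH[of y' Y'] Cons.prems al Y by auto
  have n: "\<not> y' \<prec> w" using Cons.prems(4)[of 0] Y by simp
  have yy: "y' \<prec> y" using Cons.prems Y by simp
  have n': "\<not> y \<prec> w" using n yy trans by blast
  have Wy: "z \<prec> y" if zW: "z \<in> set W" for z
  proof -
    obtain s where s: "s < length W" "z = W ! s" using zW by (auto simp: in_set_conv_nth)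
    have "Y' ! s \<in> set Y'" using s Cons.prems Y by auto
    then have "Y' ! s \<prec> y'" using Cons.prems Y by auto
    then show ?thesis using below_third[of "Y' ! s" y' y z] yy al[of s] s by auto
  qed
  \<comment> \<open>\<open>w\<close> is above neither \<open>y\<close> nor \<open>y'\<close>. If it
    is below \<open>y\<close>, then \<open>k2\<close> exchanges the two; otherwise it is
    incomparable to both and \<open>k3\<close> carries it behind \<open>y'\<close>.\<close>
  define Z' where "Z' = (if w \<prec> y then w # y' # Z else y' # w # Z)"
  have last: "keq (w # y # y' # Z) (y # Z')"
  proof (cases "w \<prec> y")
    case True
    then show ?thesis using ksym[OF k2[of y' w y "[]" Z]] n yy by (simp add: Z'_def)
  next
    case False
    moreover have "\<not> w \<prec> y'" using False yy trans by blast
    ultimately show ?thesis using ksym[OF k3[of y' w y "[]" Z]] n n' yy by (simp add: Z'_def)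
  qed
  show ?case
  proof (intro exI[of _ Z'] allI impI)
    fix D assume D: "decr D" "\<forall>x\<in>set D. \<forall>z\<in>set ((w # W) @ y # Y). z \<prec> x"
    \<comment> \<open>The sliding chain absorbs \<open>y\<close> in the induction hypothesis, which
      is why \<open>D\<close> is quantified inside; \<open>Wy\<close> makes \<open>D @ [y]\<close>
      admissible.\<close>
    have "keq (W @ (D @ [y]) @ y' # Y') ((D @ [y]) @ y' # Z)"
      by (rule Z) (use D Wy Cons.prems Y in \<open>auto simp: sorted_wrt_append\<close>)
    then have "keq ((w # W) @ D @ y # Y) (w # D @ y # y' # Z)"
      using keq_append_left[of _ _ "[w]"] Y by simp
    also have "keq (w # D @ y # y' # Z) (D @ w # y # y' # Z)"
      by (rule pass) (use D n' in \<open>auto simp: sorted_wrt_append\<close>)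
    also have "keq (D @ w # y # y' # Z) (D @ y # Z')"
      by (rule keq_append_left[OF last])
    finally show "keq ((w # W) @ D @ y # Y) (D @ y # Z')" .
  qed
qed

text \<open>\<open>W\<close> and \<open>Y\<close> are adjacent columns read upwards and aligned at
  their largest entries, with the row condition of a tableau. A chain above both can cross
  \<open>W\<close> as long as \<open>Y\<close> follows. Only the first entries of the two columns
  are new compared to the auxiliary lemma; one use of \<open>pass\<close> handles them.\<close>

lemma slide_column:
  assumes "decr W" "decr Y" "length W \<le> length Y" "\<And>s. s < length W \<Longrightarrow> \<not> Y ! s \<prec> W ! s"
    and "decr D" "\<And>x z. x \<in> set D \<Longrightarrow> z \<in> set (W @ Y) \<Longrightarrow> z \<prec> x"
  shows "keq (W @ D @ Y) (D @ W @ Y)"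
proof -
  have "\<exists>Z. \<forall>D. decr D \<longrightarrow> (\<forall>x\<in>set D. \<forall>z\<in>set (W @ Y). z \<prec> x) \<longrightarrow> keq (W @ D @ Y) (D @ Z)"
  proof (cases W)
    case Nil
    then show ?thesis by (auto intro: krefl)
  next
    case (Cons w W')
    then obtain y Y' where Y: "Y = y # Y'" using assms(3) by (cases Y) auto
    have "\<not> Y' ! s \<prec> W' ! s" if "s < length W'" for s
      using assms(4)[of "Suc s"] that Y Cons by simp
    then obtain Z where Z: "\<And>D. decr D \<Longrightarrow> \<forall>x\<in>set D. \<forall>z\<in>set (W' @ y # Y'). z \<prec> x \<Longrightarrow>
        keq (W' @ D @ y # Y') (D @ y # Z)"
      using slide_column_aux[of W' y Y'] assms Y Cons by auto
    have n: "\<not> y \<prec> w" using assms(4)[of 0] Y Cons by simp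
    show ?thesis
    proof (intro exI[of _ "w # y # Z"] allI impI)
      fix D assume D: "decr D" "\<forall>x\<in>set D. \<forall>z\<in>set (W @ Y). z \<prec> x"
      have "keq (w # W' @ D @ y # Y') (w # D @ y # Z)"
        using keq_append_left[OF Z[of D], of "[w]"] D Y Cons by auto
      also have "keq (w # D @ y # Z) (D @ w # y # Z)"
        by (rule pass) (use D n Y Cons in \<open>auto simp: sorted_wrt_append\<close>)
      finally show "keq (W @ D @ Y) (D @ w # y # Z)" using Y Cons by simp
    qed
  qed
  then obtain Z where Z: "\<And>D. decr D \<Longrightarrow> \<forall>x\<in>set D. \<forall>z\<in>set (W @ Y). z \<prec> x \<Longrightarrow>
      keq (W @ D @ Y) (D @ Z)" by blast
  have "keq (W @ Y) Z" using Z[of "[]"] by simp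
  then show ?thesis using Z[of D] assms(5,6) by (meson keq_append_left ksym ktrans)
qed

lemma slide_column_dual:
  assumes "decr C" "decr D" "length D \<le> length C"
    "\<And>s. s < length D \<Longrightarrow> \<not> rev D ! s \<prec> rev C ! s"
    and "decr X" "\<And>x z. x \<in> set X \<Longrightarrow> z \<in> set (C @ D) \<Longrightarrow> x \<prec> z"
  shows "keq (C @ X @ D) (C @ D @ X)"
proof -
  interpret d: free31_order "\<lambda>x y. y \<prec> x" by (rule dual)
  have "d.keq (rev D @ rev X @ rev C) (rev X @ rev D @ rev C)"
    by (rule d.slide_column) (use assms in \<open>auto simp: sorted_wrt_rev\<close>)
  then show ?thesis using d.keq_rev_dual by fastforce
qed

text \<open>Induction splits off the smallest elements \<open>c\<close> and \<open>d\<close>: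
  \<open>c\<close> passes the rest of \<open>ds\<close>, the induction hypothesis flips the
  remaining path, one \<open>k3\<close> turns \<open>c' c d\<close> into \<open>d c' c\<close>, and
  \<open>d\<close> passes the rest of \<open>cs\<close>.\<close>

lemma flip_path:
  assumes "incr cs" "incr ds" "length cs = Suc (length ds)"
    "\<And>s. s < length ds \<Longrightarrow> \<not> cs ! s \<prec> ds ! s \<and> \<not> ds ! s \<prec> cs ! s
        \<and> \<not> ds ! s \<prec> cs ! Suc s \<and> \<not> cs ! Suc s \<prec> ds ! s"
  shows "keq (rev cs @ rev ds) (rev ds @ rev cs)"
  using assms
proof (induction ds arbitrary: cs)
  case Nil
  show ?case by (simp add: krefl)
next
  case (Cons d ds)
  then obtain c c' cs' where cs: "cs = c # c' # cs'"
    by (cases cs; cases "tl cs") auto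
  have IH: "keq (rev (c' # cs') @ rev ds) (rev ds @ rev (c' # cs'))"
    by (rule Cons.IH) (use Cons.prems(1-3) Cons.prems(4)[of "Suc _"] cs in auto)
  have i0: "\<not> c \<prec> d" "\<not> d \<prec> c" "\<not> d \<prec> c'" "\<not> c' \<prec> d"
    using Cons.prems(4)[of 0] cs by auto
  have cds: "c \<prec> x" if xds: "x \<in> set ds" for x
  proof -
    obtain d' ds' where ds: "ds = d' # ds'" using xds by (cases ds) auto
    then obtain c'' cs'' where cs': "cs' = c'' # cs''" using Cons.prems cs by (cases cs') auto
    have "\<not> d' \<prec> c''" using Cons.prems(4)[of 1] ds cs cs' by simp
    then have "c \<prec> d'" using above_first[of c c' c'' d'] Cons.prems cs cs' by auto
    moreover have "x = d' \<or> d' \<prec> x" using xds ds Cons.prems(2) by auto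
    ultimately show ?thesis using trans by blast
  qed
  have dcs: "d \<prec> x" if "x \<in> set cs'" for x
    using that below_third[of c c' x d] Cons.prems(1) cs i0 by auto
  have "keq (rev (c' # cs') @ c # rev ds @ d # []) (rev (c' # cs') @ rev ds @ c # d # [])"
    by (rule keq_append_left, rule pass) (use cds Cons.prems(2) i0 in \<open>auto simp: sorted_wrt_append sorted_wrt_rev\<close>)
  also have "keq (rev (c' # cs') @ rev ds @ c # d # []) (rev ds @ rev (c' # cs') @ c # d # [])"
    using keq_append_right[OF IH, of "[c,d]"] by simp
  also have "keq (rev ds @ rev (c' # cs') @ c # d # []) (rev ds @ rev cs' @ d # c' # c # [])"
    using k3[of c d c' "rev ds @ rev cs'" "[]"] i0 Cons.prems(1) cs by simp
  also have "keq (rev ds @ rev cs' @ d # c' # c # []) (rev ds @ d # rev cs' @ c' # c # [])"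
    by (rule keq_append_left, rule ksym, rule pass)
      (use dcs Cons.prems(1) cs i0 in \<open>auto simp: sorted_wrt_append sorted_wrt_rev\<close>)
  finally show ?case using cs by simp
qed

section \<open>The first unmatched odd component of two chains\<close>

lemma incr_nth_le: "incr xs \<Longrightarrow> i \<le> j \<Longrightarrow> j < length xs \<Longrightarrow> xs ! i = xs ! j \<or> xs ! i \<prec> xs ! j"
  by (metis le_neq_implies_less sorted_wrt_nth_less)

lemma lt_between: "x = x' \<or> x \<prec> x' \<Longrightarrow> x' \<prec> y' \<Longrightarrow> y' = y \<or> y' \<prec> y \<Longrightarrow> x \<prec> y"
  using trans[of x x' y'] trans[of x y' y] by auto

text \<open>The chains \<open>cb @ ck @ cu\<close> and \<open>db @ dk @ du\<close> are cut around the component \<open>ck \<union> dk\<close> of their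
  incomparability graph, a path with both ends in the first chain. Below it every surplus of the
  first chain is matched further up by one of the second, above it every surplus of the second
  chain is matched further down by one of the first, so this is the first unmatched component. The
  condition is unchanged when \<open>ck\<close> and \<open>dk\<close> trade places and the order is reversed.\<close>

definition splits :: "'a list \<Rightarrow> 'a list \<Rightarrow> 'a list \<Rightarrow> 'a list \<Rightarrow> 'a list \<Rightarrow> 'a list \<Rightarrow> bool" where
  "splits cb ck cu db dk du \<longleftrightarrow>
     incr cb \<and> incr ck \<and> incr cu \<and> incr db \<and> incr dk \<and> incr du \<and>
     (\<forall>x\<in>set cb \<union> set db. \<forall>y\<in>set ck \<union> set dk. x \<prec> y) \<and>
     (\<forall>y\<in>set ck \<union> set dk. \<forall>z\<in>set cu \<union> set du. y \<prec> z) \<and>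
     length ck = Suc (length dk) \<and>
     (\<forall>s<length dk. \<not> ck ! s \<prec> dk ! s \<and> \<not> dk ! s \<prec> ck ! s
        \<and> \<not> dk ! s \<prec> ck ! Suc s \<and> \<not> ck ! Suc s \<prec> dk ! s) \<and>
     length cb \<le> length db \<and> (\<forall>s<length cb. \<not> rev db ! s \<prec> rev cb ! s) \<and>
     length du \<le> length cu \<and> (\<forall>s<length du. \<not> du ! s \<prec> cu ! s)"

text \<open>Failure of the tableau condition for two columns, \<open>cs\<close> on the left, aligned
  at their smallest entries. \<open>dflawed\<close> below is the same notion for the reversed order
  with the chains exchanged, so the alignment is at the largest entries. A longer right chain is
  always \<open>flawed\<close>, a longer left chain always \<open>dflawed\<close>.\<close>

definition flawed :: "'a list \<Rightarrow> 'a list \<Rightarrow> bool" where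
  "flawed cs ds \<longleftrightarrow> (\<exists>s<length ds. length cs \<le> s \<or> ds ! s \<prec> cs ! s)"

definition dflawed :: "'a list \<Rightarrow> 'a list \<Rightarrow> bool" where
  "dflawed cs ds \<longleftrightarrow> (\<exists>s<length cs. length ds \<le> s \<or> rev ds ! s \<prec> rev cs ! s)"

lemma splits_bottom_less_top:
  assumes "splits cb ck cu db dk du" "x \<in> set cb \<union> set db" "z \<in> set cu \<union> set du"
  shows "x \<prec> z"
proof -
  obtain y where "y \<in> set ck" using assms(1) by (cases ck) (auto simp: splits_def)
  then have "x \<prec> y" "y \<prec> z" using assms unfolding splits_def by blast+
  then show ?thesis by (rule trans)
qed

lemma splits_incr:
  assumes "splits cb ck cu db dk du"
  shows "incr (cb @ ck @ cu)" "incr (db @ dk @ du)" "incr (cb @ dk @ cu)" "incr (db @ ck @ du)"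
proof -
  have "\<forall>x\<in>set cb \<union> set db. \<forall>z\<in>set cu \<union> set du. x \<prec> z"
    using splits_bottom_less_top[OF assms] by blast
  then show "incr (cb @ ck @ cu)" "incr (db @ dk @ du)" "incr (cb @ dk @ cu)" "incr (db @ ck @ du)"
    using assms unfolding splits_def by (simp_all add: sorted_wrt_append ball_Un)
qed

text \<open>Both words are brought into the form top parts, component, bottom parts:
  \<open>slide_column\<close> lifts the upper part of the second chain over \<open>cb\<close>, and
  its dual lifts \<open>du\<close> over the component. In this form \<open>flip_path\<close>
  exchanges \<open>ck\<close> and \<open>dk\<close> in isolation.\<close>

lemma splits_keq:
  assumes "splits cb ck cu db dk du"
  shows "keq (rev (cb @ ck @ cu) @ rev (db @ dk @ du)) (rev (cb @ dk @ cu) @ rev (db @ ck @ du))"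
proof -
  have n: "keq (rev (cb @ xs @ cu) @ rev (db @ ys @ du))
               (rev cu @ rev du @ (rev xs @ rev ys) @ rev cb @ rev db)"
    if xy: "set xs \<subseteq> set ck \<union> set dk" "set ys \<subseteq> set ck \<union> set dk" "incr xs" "incr ys" for xs ys
  proof -
    have sep: "\<And>x y. x \<in> set cb \<union> set db \<Longrightarrow> y \<in> set ck \<union> set dk \<Longrightarrow> x \<prec> y"
      "\<And>y z. y \<in> set ck \<union> set dk \<Longrightarrow> z \<in> set cu \<union> set du \<Longrightarrow> y \<prec> z"
      using assms unfolding splits_def by blast+
    have d: "decr (rev du @ rev ys)"
      using xy sep(2) assms by (auto simp: sorted_wrt_append sorted_wrt_rev splits_def)
    have "keq (rev cb @ (rev du @ rev ys) @ rev db) ((rev du @ rev ys) @ rev cb @ rev db)"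
      by (rule slide_column)
        (use assms d xy sep splits_bottom_less_top[OF assms] in \<open>auto simp: sorted_wrt_rev splits_def\<close>)
    then have "keq (rev (cb @ xs @ cu) @ rev (db @ ys @ du))
       ((rev cu @ rev xs) @ (rev du @ rev ys) @ rev cb @ rev db)"
      using keq_append_left[of _ _ "rev cu @ rev xs"] by simp
    moreover have "keq (rev cu @ rev xs @ rev du) (rev cu @ rev du @ rev xs)"
      by (rule slide_column_dual)
        (use assms xy sep in \<open>auto simp: sorted_wrt_rev splits_def\<close>)
    then have "keq ((rev cu @ rev xs) @ (rev du @ rev ys) @ rev cb @ rev db)
        (rev cu @ rev du @ (rev xs @ rev ys) @ rev cb @ rev db)"
      using keq_append_right[of "rev cu @ rev xs @ rev du" "rev cu @ rev du @ rev xs"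
          "rev ys @ rev cb @ rev db"] by simp
    ultimately show ?thesis by (rule ktrans)
  qed
  have "keq (rev ck @ rev dk) (rev dk @ rev ck)"
    by (rule flip_path) (use assms in \<open>auto simp: splits_def\<close>)
  then have m: "keq (rev cu @ rev du @ (rev ck @ rev dk) @ rev cb @ rev db)
      (rev cu @ rev du @ (rev dk @ rev ck) @ rev cb @ rev db)"
    using keq_context[of "rev ck @ rev dk" "rev dk @ rev ck" "rev cu @ rev du" "rev cb @ rev db"] by simp
  have "incr ck" "incr dk" using assms by (auto simp: splits_def)
  then show ?thesis
    using ktrans[OF n[of ck dk] ktrans[OF m ksym[OF n[of dk ck]]]] by simp
qed

lemma splits_dual:
  assumes "splits cb ck cu db dk du"
  shows "free31_order.splits (\<lambda>x y. y \<prec> x) (rev du) (rev ck) (rev db) (rev cu) (rev dk) (rev cb)"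
proof -
  interpret d: free31_order "\<lambda>x y. y \<prec> x" by (rule dual)
  have l: "length ck = Suc (length dk)" using assms by (simp add: splits_def)
  have "\<not> rev dk ! s \<prec> rev ck ! s \<and> \<not> rev ck ! s \<prec> rev dk ! s
        \<and> \<not> rev ck ! Suc s \<prec> rev dk ! s \<and> \<not> rev dk ! s \<prec> rev ck ! Suc s" if s: "s < length dk" for s
  proof -
    define t where "t = length dk - Suc s"
    have "rev dk ! s = dk ! t" "rev ck ! s = ck ! Suc t" "rev ck ! Suc s = ck ! t" "t < length dk"
      using s l by (auto simp: rev_nth t_def Suc_diff_Suc)
    then show ?thesis using assms unfolding splits_def by simp
  qed
  then show ?thesis
    using assms unfolding splits_def d.splits_def by (auto simp: sorted_wrt_rev)
qed

text \<open>With \<open>k = |cb|\<close> and \<open>m = |db|\<close>, the shift \<open>m - k\<close> is the least one at which the two columns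
  form a tableau, and \<open>k\<close> is the last row at which the next smaller shift fails.\<close>

lemma splits_index:
  assumes sp: "splits cb ck cu db dk du"
    and cs: "cs = cb @ ck @ cu" and ds: "ds = db @ dk @ du"
    and k: "k = length cb" and m: "m = length db" and q: "q = length dk"
  shows "\<And>t. t < length cs \<Longrightarrow> t + (m - k) < length ds \<Longrightarrow> \<not> ds ! (t + (m - k)) \<prec> cs ! t"
    and "m > 0 \<Longrightarrow> ds ! (m - 1) \<prec> cs ! k"
    and "\<And>t. k < t \<Longrightarrow> t < length cs \<Longrightarrow> t + (m - k) - 1 < length ds \<Longrightarrow>
      \<not> ds ! (t + (m - k) - 1) \<prec> cs ! t"
    and "\<And>s. s < q \<Longrightarrow> \<not> cs ! (k + s) \<prec> ds ! (m + s)"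
    and "m + q < length ds \<Longrightarrow> cs ! (k + q) \<prec> ds ! (m + q)"
proof -
  have l: "length ck = Suc q" "k \<le> m" "length du \<le> length cu" using sp k m q by (auto simp: splits_def)
  have K: "\<not> ck ! s \<prec> dk ! s" "\<not> dk ! s \<prec> ck ! s"  "\<not> dk ! s \<prec> ck ! Suc s" if "s < q" for s
    using sp that q by (auto simp: splits_def)
  have U: "\<not> du ! s \<prec> cu ! s" if "s < length du" for s
    using sp that by (auto simp: splits_def)
  have B: "\<not> db ! (t + (m - k)) \<prec> cb ! t" if "t < k" for t
  proof -
    have "\<not> rev db ! (k - Suc t) \<prec> rev cb ! (k - Suc t)" using sp that k by (auto simp: splits_def)
    moreover have "rev db ! (k - Suc t) = db ! (t + (m - k))"
    proof -
      have "m - Suc (k - Suc t) = t + (m - k)" using that l(2) by simp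
      then show ?thesis using that l(2) k m by (simp add: rev_nth)
    qed
    moreover have "rev cb ! (k - Suc t) = cb ! t"
      using that k by (simp add: rev_nth)
    ultimately show ?thesis by simp
  qed
  have inc: "incr ds" "incr du" using splits_incr[OF sp] sp ds by (auto simp: splits_def)
  have KU: "x \<prec> z" if "x \<in> set ck \<union> set dk" "z \<in> set cu \<union> set du" for x z
    using sp that unfolding splits_def by blast
  have BK: "x \<prec> z" if "x \<in> set cb \<union> set db" "z \<in> set ck \<union> set dk" for x z
    using sp that unfolding splits_def by blast
  show "\<not> ds ! (t + (m - k)) \<prec> cs ! t" if t: "t < length cs" "t + (m - k) < length ds" for t
  proof (cases "t < k")
    case True
    moreover have "t + (m - k) < m" using True l by simp
    ultimately show ?thesis using B[of t] k m by (simp add: cs ds nth_append)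
  next
    case False
    then obtain s where s: "t = k + s" by (metis le_Suc_ex not_less)
    consider "s < q" | "s = q" | r where "s = q + Suc r"
      by (metis add_Suc_right less_iff_Suc_add linorder_neqE_nat)
    then show ?thesis
    proof cases
      case 1
      then show ?thesis using K s l k m q by (simp add: cs ds nth_append)
    next
      case 2
      then have e: "ds ! (t + (m - k)) = du ! 0" "cs ! t = ck ! q" "0 < length du"
        using s l k m q t by (auto simp: cs ds nth_append)
      then have "ck ! q \<prec> du ! 0" using KU[of "ck ! q" "du ! 0"] l by simp
      then show ?thesis using asym e by simp
    next
      case 3
      then have e: "ds ! (t + (m - k)) = du ! Suc r" "cs ! t = cu ! r" "Suc r < length du"
        using s l k m q t by (auto simp: cs ds nth_append)
      then have "du ! r \<prec> du ! Suc r" "\<not> du ! r \<prec> cu ! r"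
        using sorted_wrt_nth_less[OF inc(2)] U[of r] by auto
      then show ?thesis using e trans[of "du ! r" "du ! Suc r" "cu ! r"] by auto
    qed
  qed
  show "ds ! (m - 1) \<prec> cs ! k" if "m > 0"
    using that BK[of "db ! (m - 1)" "ck ! 0"] l k m by (simp add: cs ds nth_append)
  show "\<not> ds ! (t + (m - k) - 1) \<prec> cs ! t"
    if t: "k < t" "t < length cs" "t + (m - k) - 1 < length ds" for t
  proof -
    obtain s where s: "t = k + Suc s" using t(1) by (metis less_imp_Suc_add add_Suc_right)
    show ?thesis
    proof (cases "s < q")
      case True
      then show ?thesis using K[of s] s l k m q by (simp add: cs ds nth_append)
    next
      case False
      then obtain r where r: "s = q + r" by (metis le_Suc_ex not_less)
      then have e: "ds ! (t + (m - k) - 1) = du ! r" "cs ! t = cu ! r" "r < length du"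
        using s l k m q t by (auto simp: cs ds nth_append)
      then show ?thesis using U[of r] by simp
    qed
  qed
  show "\<not> cs ! (k + s) \<prec> ds ! (m + s)" if "s < q" for s
    using that K[of s] l k m q by (simp add: cs ds nth_append)
  show "cs ! (k + q) \<prec> ds ! (m + q)" if "m + q < length ds"
    using that KU[of "ck ! q" "du ! 0"] l k m q by (simp add: cs ds nth_append)
qed

text \<open>\<open>splits_index\<close> recovers from the two chains the shift \<open>m - k\<close>,
  then the row \<open>k\<close>, then the length \<open>q\<close> of \<open>dk\<close>, as the first
  place where the path stops. Each of the three is compared by excluding a strict inequality, which
  is then used in both directions.\<close>

lemma splits_unique:
  assumes sp: "splits cb ck cu db dk du" and sp': "splits cb' ck' cu' db' dk' du'"
    and eq: "cb @ ck @ cu = cb' @ ck' @ cu'" "db @ dk @ du = db' @ dk' @ du'"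
  shows "cb = cb' \<and> ck = ck' \<and> cu = cu' \<and> db = db' \<and> dk = dk' \<and> du = du'"
proof -
  have shift: "\<not> length db - length cb < length db' - length cb'"
    if sp: "splits cb ck cu db dk du" and sp': "splits cb' ck' cu' db' dk' du'"
      and eq: "cb @ ck @ cu = cb' @ ck' @ cu'" "db @ dk @ du = db' @ dk' @ du'"
    for cb ck cu db dk du cb' ck' cu' db' dk' du'
  proof
    let ?a = "length db - length cb" and ?k' = "length cb'" and ?m' = "length db'"
    let ?cs = "cb' @ ck' @ cu'" and ?ds = "db' @ dk' @ du'"
    assume less: "?a < ?m' - ?k'"
    have lc: "?k' < length ?cs" using sp' by (simp add: splits_def)
    have 1: "?ds ! (?m' - 1) \<prec> ?cs ! ?k'"
      by (rule splits_index(2)[OF sp' refl refl refl refl refl]) (use less in arith)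
    have i: "?k' + ?a \<le> ?m' - 1" "?m' - 1 < length ?ds" using less by auto
    have 2: "\<not> ?ds ! (?k' + ?a) \<prec> ?cs ! ?k'"
      by (rule splits_index(1)[OF sp eq[symmetric] refl refl refl, of ?k']) (use i lc in simp_all)
    have "?ds ! (?k' + ?a) = ?ds ! (?m' - 1) \<or> ?ds ! (?k' + ?a) \<prec> ?ds ! (?m' - 1)"
      by (rule incr_nth_le) (use i splits_incr[OF sp'] in auto)
    then show False using lt_between[OF _ 1 disjI1[OF refl]] 2 by blast
  qed
  have a: "length db - length cb = length db' - length cb'"
    using shift[OF sp sp' eq] shift[OF sp' sp eq[symmetric]] by simp
  have row: "\<not> length cb < length cb'"
    if sp: "splits cb ck cu db dk du" and sp': "splits cb' ck' cu' db' dk' du'"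
      and eq: "cb @ ck @ cu = cb' @ ck' @ cu'" "db @ dk @ du = db' @ dk' @ du'"
      and a: "length db - length cb = length db' - length cb'"
    for cb ck cu db dk du cb' ck' cu' db' dk' du'
  proof
    assume less: "length cb < length cb'"
    let ?cs = "cb' @ ck' @ cu'" and ?ds = "db' @ dk' @ du'"
    have l: "length cb' \<le> length db'" "length cb' < length ?cs" using sp' by (auto simp: splits_def)
    have i: "length cb' + (length db - length cb) - 1 = length db' - 1" using a l by simp
    have "\<not> ?ds ! (length cb' + (length db - length cb) - 1) \<prec> ?cs ! length cb'"
      by (rule splits_index(3)[OF sp eq[symmetric] refl refl refl]) (use less l i in auto)
    moreover have "?ds ! (length db' - 1) \<prec> ?cs ! length cb'"
      by (rule splits_index(2)[OF sp' refl refl refl refl refl]) (use less l in auto)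
    ultimately show False using i by simp
  qed
  have k: "length cb = length cb'"
    using row[OF sp sp' eq a] row[OF sp' sp eq[symmetric] a[symmetric]] by simp
  then have m: "length db = length db'"
    using a sp sp' by (auto simp: splits_def)
  have flip: "\<not> length dk < length dk'"
    if sp: "splits cb ck cu db dk du" and sp': "splits cb' ck' cu' db' dk' du'"
      and eq: "cb @ ck @ cu = cb' @ ck' @ cu'" "db @ dk @ du = db' @ dk' @ du'"
      and k: "length cb = length cb'" and m: "length db = length db'"
    for cb ck cu db dk du cb' ck' cu' db' dk' du'
  proof
    assume less: "length dk < length dk'"
    let ?cs = "cb' @ ck' @ cu'" and ?ds = "db' @ dk' @ du'"
    have "?cs ! (length cb' + length dk) \<prec> ?ds ! (length db' + length dk)"
      by (rule splits_index(5)[OF sp eq[symmetric] k[symmetric] m[symmetric] refl]) (use less in auto)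
    moreover have "\<not> ?cs ! (length cb' + length dk) \<prec> ?ds ! (length db' + length dk)"
      by (rule splits_index(4)[OF sp' refl refl refl refl refl less])
    ultimately show False by simp
  qed
  have q: "length dk = length dk'"
    using flip[OF sp sp' eq k m] flip[OF sp' sp eq[symmetric] k[symmetric] m[symmetric]] by simp
  then have "length ck = length ck'" using sp sp' by (simp add: splits_def)
  then show ?thesis using eq k m q by simp
qed

lemma splits_dflawed:
  assumes sp: "splits cb ck cu db dk du"
  shows "dflawed (cb @ ck @ cu) (db @ dk @ du)"
proof -
  \<comment> \<open>The position of \<open>ck ! 0\<close> counted from the end of the first chain.
    Since \<open>length du \<le> length cu\<close>, the same position in the second chain lies in
    \<open>db\<close> or beyond its end.\<close>
  define s where "s = length cu + length dk"
  have l: "length ck = Suc (length dk)" "length du \<le> length cu" using sp by (auto simp: splits_def)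
  have c: "rev (cb @ ck @ cu) ! s = ck ! 0"
    using l by (simp add: rev_nth s_def nth_append)
  have "rev (db @ dk @ du) ! s \<prec> ck ! 0" if "s < length (db @ dk @ du)"
  proof -
    have "rev (db @ dk @ du) ! s \<in> set db"
      using that l by (auto simp: s_def nth_append rev_nth)
    moreover have "ck ! 0 \<in> set ck" using l by simp
    ultimately show ?thesis using sp unfolding splits_def by blast
  qed
  moreover have "s < length (cb @ ck @ cu)" using l by (simp add: s_def)
  ultimately show ?thesis unfolding dflawed_def c[symmetric] by (metis not_less)
qed

text \<open>Turns the description behind \<open>splits_index\<close> into a construction:
  \<open>a\<close> is the least admissible shift, \<open>k\<close> the last row at which the shift
  \<open>a - 1\<close> fails, and \<open>q\<close> the first step at which the path started at row
  \<open>k\<close> stops.\<close>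

lemma splits_exists:
  assumes ic: "incr cs" and id: "incr ds" and fl: "dflawed cs ds"
  shows "\<exists>cb ck cu db dk du. cs = cb @ ck @ cu \<and> ds = db @ dk @ du \<and> splits cb ck cu db dk du"
proof -
  define ok where "ok a \<longleftrightarrow> (\<forall>t<length cs. t + a < length ds \<longrightarrow> \<not> ds ! (t + a) \<prec> cs ! t)" for a
  define a where "a = (LEAST a. ok a)"
  have "ok (length ds)" by (simp add: ok_def)
  then have oka: "ok a" unfolding a_def by (rule LeastI)
  have least: "\<not> ok b" if "b < a" for b using that not_less_Least unfolding a_def by blast
  have pos: "0 < length cs" using fl by (auto simp: dflawed_def)
  \<comment> \<open>Here \<open>fl\<close> excludes the alignment at the largest entries. The first
    chain therefore reaches beyond the shifted second one, which leaves room for the last element of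
    the path and yields \<open>length du \<le> length cu\<close>.\<close>
  have len: "length ds < length cs + a"
  proof (rule ccontr)
    assume "\<not> ?thesis"
    then have n: "length cs + a \<le> length ds" by simp
    obtain s where s: "s < length cs" "rev ds ! s \<prec> rev cs ! s"
      using fl n by (auto simp: dflawed_def)
    define t where "t = length cs - Suc s"
    have t: "rev cs ! s = cs ! t" "t < length cs" using s by (auto simp: rev_nth t_def)
    have "ds ! (t + a) = rev ds ! s \<or> ds ! (t + a) \<prec> rev ds ! s"
      using incr_nth_le[OF id, of "t + a" "length ds - Suc s"] s n by (simp add: rev_nth t_def)
    then have "ds ! (t + a) \<prec> cs ! t" using lt_between[OF _ s(2) disjI1[OF t(1)]] by blast
    moreover have "t + a < length ds" using n s t_def by simp
    ultimately show False using oka t(2) by (simp add: ok_def)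
  qed
  \<comment> \<open>For \<open>a = 0\<close> the next smaller shift would be negative; by convention
    it fails at row 0, where the partner is missing.\<close>
  define R where "R = {t. t < length cs \<and> (t + a = 0 \<or> t + a - 1 < length ds \<and> ds ! (t + a - 1) \<prec> cs ! t)}"
  have "R \<noteq> {}"
  proof (cases a)
    case 0
    then have "0 \<in> R" using pos by (simp add: R_def)
    then show ?thesis by blast
  next
    case (Suc b)
    then have "\<not> ok b" using least by simp
    then show ?thesis using Suc by (auto simp: ok_def R_def)
  qed
  have finR: "finite R" by (simp add: R_def)
  define k where "k = Max R"
  have kR: "k \<in> R" unfolding k_def using finR \<open>R \<noteq> {}\<close> by (rule Max_in)
  have kmax: "t \<notin> R" if "k < t" for t using that finR Max_ge k_def by (metis not_less)
  define m where "m = k + a"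
  have kl: "k < length cs" using kR by (simp add: R_def)
  have F1: "ds ! (m - 1) \<prec> cs ! k" if "0 < m" using kR that by (auto simp: R_def m_def)
  have ml: "m \<le> length ds" using kR by (auto simp: R_def m_def)
  have last: "\<not> ds ! (m + s) \<prec> cs ! (k + Suc s)" if "m + s < length ds" "k + Suc s < length cs" for s
    using kmax[of "k + Suc s"] that by (auto simp: R_def m_def ac_simps)
  have okm: "\<not> ds ! (m + s) \<prec> cs ! (k + s)" if "m + s < length ds" "k + s < length cs" for s
    using oka that by (auto simp: ok_def m_def ac_simps)
  define stop where "stop q \<longleftrightarrow> length ds \<le> m + q \<or> cs ! (k + q) \<prec> ds ! (m + q)" for q
  define q where "q = (LEAST q. stop q)"
  have ex: "stop (length ds - m)" using ml by (simp add: stop_def)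
  have qprop: "length ds \<le> m + q \<or> cs ! (k + q) \<prec> ds ! (m + q)"
    using LeastI[of stop, OF ex] unfolding q_def stop_def .
  have qle: "m + q \<le> length ds"
    using Least_le[of stop, OF ex] ml unfolding q_def by simp
  have qless: "m + s < length ds \<and> \<not> cs ! (k + s) \<prec> ds ! (m + s)" if "s < q" for s
    using not_less_Least[of s stop] that unfolding q_def stop_def by simp
  have kq: "k + q < length cs" using qle len by (simp add: m_def)
  have F2: "cs ! (k + q) \<prec> ds ! (m + q)" if "m + q < length ds" using that qprop by simp
  \<comment> \<open>\<open>F1\<close> and \<open>F2\<close> hold by the choice of \<open>k\<close>
    and \<open>q\<close>. The two remaining comparisons between the chains at the ends of the
    component, \<open>F3\<close> and \<open>F4\<close>, are where (3+1)-freeness is used.\<close>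
  have F3: "cs ! (k - 1) \<prec> ds ! m" if "0 < k" "m < length ds"
  proof -
    have k1: "k + 1 < length cs" using that len by (simp add: m_def)
    then have "\<not> ds ! m \<prec> cs ! (k + 1)" using last[of 0] that by simp
    moreover have "cs ! (k - 1) \<prec> cs ! k" "cs ! k \<prec> cs ! (k + 1)"
      using sorted_wrt_nth_less[OF ic] that k1 by auto
    ultimately show ?thesis using above_first[of "cs ! (k - 1)" "cs ! k" "cs ! (k + 1)" "ds ! m"] by blast
  qed
  have F4: "ds ! (m + q - 1) \<prec> cs ! (k + q + 1)" if "0 < q" "k + q + 1 < length cs"
  proof -
    have "\<not> cs ! (k + q - 1) \<prec> ds ! (m + q - 1)" using qless[of "q - 1"] that by simp
    moreover have "cs ! (k + q - 1) \<prec> cs ! (k + q)" "cs ! (k + q) \<prec> cs ! (k + q + 1)"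
      using sorted_wrt_nth_less[OF ic] that by auto
    ultimately show ?thesis using below_third[of "cs ! (k + q - 1)" "cs ! (k + q)" "cs ! (k + q + 1)" "ds ! (m + q - 1)"]
      by blast
  qed
  define cb where "cb = take k cs"
  define ck where "ck = take (Suc q) (drop k cs)"
  define cu where "cu = drop (k + Suc q) cs"
  define db where "db = take m ds"
  define dk where "dk = take q (drop m ds)"
  define du where "du = drop (m + q) ds"
  have cs: "cs = cb @ ck @ cu"
    unfolding cb_def ck_def cu_def by (metis append_take_drop_id drop_drop add.commute)
  have ds: "ds = db @ dk @ du"
    unfolding db_def dk_def du_def by (metis append_take_drop_id drop_drop add.commute)
  have lens: "length cb = k" "length ck = Suc q" "length cu = length cs - (k + Suc q)"
    "length db = m" "length dk = q" "length du = length ds - (m + q)"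
    using kq qle ml by (auto simp: cb_def ck_def cu_def db_def dk_def du_def)
  have nths: "\<And>i. i < k \<Longrightarrow> cb ! i = cs ! i" "\<And>i. i < Suc q \<Longrightarrow> ck ! i = cs ! (k + i)"
    "\<And>i. i < length cu \<Longrightarrow> cu ! i = cs ! (k + q + 1 + i)"
    "\<And>i. i < m \<Longrightarrow> db ! i = ds ! i" "\<And>i. i < q \<Longrightarrow> dk ! i = ds ! (m + i)"
    "\<And>i. i < length du \<Longrightarrow> du ! i = ds ! (m + q + i)"
    using kq qle ml by (auto simp: cb_def ck_def cu_def db_def dk_def du_def)
  have pieces: "incr cb" "incr ck" "incr cu" "incr db" "incr dk" "incr du"
    using ic id unfolding cs ds by (auto simp: sorted_wrt_append)
  have cc: "x \<prec> y" if "x \<in> set cb \<and> y \<in> set ck \<or> x \<in> set ck \<and> y \<in> set cu" for x y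
    using ic that unfolding cs by (auto simp: sorted_wrt_append)
  have dd: "x \<prec> y" if "x \<in> set db \<and> y \<in> set dk \<or> x \<in> set dk \<and> y \<in> set du" for x y
    using id that unfolding ds by (auto simp: sorted_wrt_append)
  have cbdk: "x \<prec> y" if x: "x \<in> set cb" and y: "y \<in> set dk" for x y
  proof -
    obtain i j where i: "i < k" "x = cs ! i" and j: "j < q" "y = ds ! (m + j)"
      using x y lens nths by (metis in_set_conv_nth)
    show ?thesis
      unfolding i(2) j(2)
      by (rule lt_between[OF incr_nth_le[OF ic, of i "k - 1"] F3 incr_nth_le[OF id, of m "m + j"]])
        (use i(1) j(1) qle kl in simp_all)
  qed
  have dbck: "x \<prec> y" if x: "x \<in> set db" and y: "y \<in> set ck" for x y
  proof -
    obtain i j where i: "i < m" "x = ds ! i" and j: "j < Suc q" "y = cs ! (k + j)"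
      using x y lens nths by (metis in_set_conv_nth)
    show ?thesis
      unfolding i(2) j(2)
      by (rule lt_between[OF incr_nth_le[OF id, of i "m - 1"] F1 incr_nth_le[OF ic, of k "k + j"]])
        (use i(1) j(1) kq ml in simp_all)
  qed
  have ckdu: "x \<prec> y" if x: "x \<in> set ck" and y: "y \<in> set du" for x y
  proof -
    obtain i j where i: "i < Suc q" "x = cs ! (k + i)" and j: "j < length du" "y = ds ! (m + q + j)"
      using x y lens nths by (metis in_set_conv_nth)
    show ?thesis
      unfolding i(2) j(2)
      by (rule lt_between[OF incr_nth_le[OF ic, of "k + i" "k + q"] F2
          incr_nth_le[OF id, of "m + q" "m + q + j"]])
        (use i(1) j(1) kq lens(6) in simp_all)
  qed
  have dkcu: "x \<prec> y" if x: "x \<in> set dk" and y: "y \<in> set cu" for x y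
  proof -
    obtain i j where i: "i < q" "x = ds ! (m + i)" and j: "j < length cu" "y = cs ! (k + q + 1 + j)"
      using x y lens nths by (metis in_set_conv_nth)
    show ?thesis
      unfolding i(2) j(2)
      by (rule lt_between[OF incr_nth_le[OF id, of "m + i" "m + q - 1"] F4
          incr_nth_le[OF ic, of "k + q + 1" "k + q + 1 + j"]])
        (use i(1) j(1) qle lens(3) in simp_all)
  qed
  have path: "\<not> ck ! s \<prec> dk ! s \<and> \<not> dk ! s \<prec> ck ! s
        \<and> \<not> dk ! s \<prec> ck ! Suc s \<and> \<not> ck ! Suc s \<prec> dk ! s" if s: "s < q" for s
  proof -
    have "\<not> cs ! (k + s) \<prec> ds ! (m + s)" "m + s < length ds" using qless s by auto
    moreover have "cs ! (k + s) \<prec> cs ! (k + Suc s)"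
      using sorted_wrt_nth_less[OF ic, of "k + s" "k + Suc s"] s kq by simp
    ultimately show ?thesis
      using okm[of s] last[of s] s kq nths trans[of "cs ! (k + s)" "cs ! (k + Suc s)" "ds ! (m + s)"] by auto
  qed
  have B: "\<not> rev db ! s \<prec> rev cb ! s" if s: "s < k" for s
  proof -
    have "rev cb ! s = cs ! (k - Suc s)" using s lens nths by (simp add: rev_nth)
    moreover have "rev db ! s = ds ! (k - Suc s + a)"
      using s lens nths by (simp add: rev_nth m_def)
    moreover have "\<not> ds ! (k - Suc s + a) \<prec> cs ! (k - Suc s)"
    proof -
      have "k - Suc s < length cs" "k - Suc s + a < length ds" using s kl ml by (auto simp: m_def)
      then show ?thesis using oka by (auto simp: ok_def)
    qed
    ultimately show ?thesis by simp
  qed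
  have U: "\<not> du ! s \<prec> cu ! s" if s: "s < length du" for s
    using last[of "q + s"] s lens nths len by (simp add: ac_simps m_def)
  have "length du \<le> length cu" "k \<le> m" using lens len by (auto simp: m_def)
  then have "splits cb ck cu db dk du"
    using pieces cc dd cbdk dbck ckdu dkcu path B U lens unfolding splits_def by blast
  then show ?thesis using cs ds by blast
qed

section \<open>Functions constant on Knuth classes, and the flip as an identity of sums\<close>

definition chains :: "'a set \<Rightarrow> nat \<Rightarrow> 'a list set" where
  "chains S k = {cs. incr cs \<and> set cs \<subseteq> S \<and> length cs = k}"

text \<open>Identities modulo Knuth moves are expressed by testing against all integer functions
  that are constant on Knuth classes, instead of in a quotient of the word algebra.\<close>

definition invariant :: "('a list \<Rightarrow> int) \<Rightarrow> bool" where
  "invariant g \<longleftrightarrow> (\<forall>w w'. keq w w' \<longrightarrow> g w = g w')"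

lemma invariant_context: "invariant g \<Longrightarrow> invariant (\<lambda>w. g (p @ w @ s))"
  unfolding invariant_def by (blast intro: keq_context)

lemma splits_flawed:
  assumes "splits cb ck cu db dk du"
  shows "flawed (cb @ dk @ cu) (db @ ck @ du)"
proof -
  interpret d: free31_order "\<lambda>x y. y \<prec> x" by (rule dual)
  show ?thesis
    using d.splits_dflawed[OF splits_dual[OF assms]] unfolding d.dflawed_def flawed_def by (simp add: ac_simps)
qed

lemma splits_unique':
  assumes sp: "splits cb ck cu db dk du" and sp': "splits cb' ck' cu' db' dk' du'"
    and eq: "cb @ dk @ cu = cb' @ dk' @ cu'" "db @ ck @ du = db' @ ck' @ du'"
  shows "cb = cb' \<and> ck = ck' \<and> cu = cu' \<and> db = db' \<and> dk = dk' \<and> du = du'"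
proof -
  interpret d: free31_order "\<lambda>x y. y \<prec> x" by (rule dual)
  have "rev du @ rev ck @ rev db = rev du' @ rev ck' @ rev db'"
    "rev cu @ rev dk @ rev cb = rev cu' @ rev dk' @ rev cb'"
    using eq by (metis append.assoc rev_append)+
  then show ?thesis
    using d.splits_unique[OF splits_dual[OF sp] splits_dual[OF sp']] by simp
qed

lemma splits_exists':
  assumes "incr cs" "incr ds" "flawed cs ds"
  shows "\<exists>cb ck cu db dk du. cs = cb @ dk @ cu \<and> ds = db @ ck @ du \<and> splits cb ck cu db dk du"
proof -
  interpret d: free31_order "\<lambda>x y. y \<prec> x" by (rule dual)
  have "d.dflawed (rev ds) (rev cs)"
    using assms unfolding d.dflawed_def flawed_def by simp
  then obtain cb ck cu db dk du where *: "rev ds = cb @ ck @ cu" "rev cs = db @ dk @ du"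
    "d.splits cb ck cu db dk du"
    using d.splits_exists[of "rev ds" "rev cs"] assms by (auto simp: sorted_wrt_rev)
  have "splits (rev du) (rev ck) (rev db) (rev cu) (rev dk) (rev cb)"
    using d.splits_dual[OF *(3)] by simp
  moreover have "cs = rev du @ rev dk @ rev db" "ds = rev cu @ rev ck @ rev cb"
    using *(1,2) by (metis append.assoc rev_append rev_rev_ident)+
  ultimately show ?thesis by blast
qed

text \<open>Both index sets are parametrized by the same decompositions \<open>Q\<close>, read
  before and after the flip; \<open>splits_keq\<close> makes the summands agree.\<close>

lemma sum_dflawed_eq_sum_flawed:
  assumes g: "invariant g"
  shows "(\<Sum>(cs, ds)\<in>{(cs, ds). cs \<in> chains S (Suc i) \<and> ds \<in> chains S j \<and> dflawed cs ds}. g (rev cs @ rev ds))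
    = (\<Sum>(cs, ds)\<in>{(cs, ds). cs \<in> chains S i \<and> ds \<in> chains S (Suc j) \<and> flawed cs ds}. g (rev cs @ rev ds))"
    (is "sum ?h ?A = sum ?h ?B")
proof -
  define Q where "Q = {(cb, ck, cu, db, dk, du). splits cb ck cu db dk du \<and>
    set (cb @ ck @ cu) \<subseteq> S \<and> set (db @ dk @ du) \<subseteq> S \<and>
    length (cb @ ck @ cu) = Suc i \<and> length (db @ dk @ du) = j}"
  define \<phi> :: "'a list \<times> 'a list \<times> 'a list \<times> 'a list \<times> 'a list \<times> 'a list \<Rightarrow> 'a list \<times> 'a list"
    where "\<phi> = (\<lambda>(cb, ck, cu, db, dk, du). (cb @ ck @ cu, db @ dk @ du))"
  define \<psi> :: "'a list \<times> 'a list \<times> 'a list \<times> 'a list \<times> 'a list \<times> 'a list \<Rightarrow> 'a list \<times> 'a list"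
    where "\<psi> = (\<lambda>(cb, ck, cu, db, dk, du). (cb @ dk @ cu, db @ ck @ du))"
  have len: "length ck = Suc (length dk)" if "splits cb ck cu db dk du" for cb ck cu db dk du
    using that by (simp add: splits_def)
  have "bij_betw \<phi> Q ?A"
  proof (rule bij_betwI')
    show "(\<phi> x = \<phi> y) = (x = y)" if "x \<in> Q" "y \<in> Q" for x y
      using that splits_unique by (auto simp: Q_def \<phi>_def)
    show "\<phi> x \<in> ?A" if "x \<in> Q" for x
      using that splits_incr splits_dflawed by (auto simp: Q_def \<phi>_def chains_def)
    show "\<exists>x\<in>Q. y = \<phi> x" if y: "y \<in> ?A" for y
    proof -
      obtain cs ds where cd: "y = (cs, ds)" "incr cs" "incr ds" "dflawed cs ds" "set cs \<subseteq> S" "set ds \<subseteq> S"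
        "length cs = Suc i" "length ds = j"
        using y by (auto simp: chains_def)
      obtain cb ck cu db dk du where "cs = cb @ ck @ cu" "ds = db @ dk @ du" "splits cb ck cu db dk du"
        using splits_exists cd by metis
      then show ?thesis
        using cd by (intro bexI[of _ "(cb, ck, cu, db, dk, du)"]) (auto simp: Q_def \<phi>_def)
    qed
  qed
  then have A: "sum ?h ?A = (\<Sum>x\<in>Q. ?h (\<phi> x))" by (simp add: sum.reindex_bij_betw)
  have "bij_betw \<psi> Q ?B"
  proof (rule bij_betwI')
    show "(\<psi> x = \<psi> y) = (x = y)" if "x \<in> Q" "y \<in> Q" for x y
      using that splits_unique' by (auto simp: Q_def \<psi>_def)
    show "\<psi> x \<in> ?B" if x: "x \<in> Q" for x
      using x splits_incr splits_flawed len by (auto simp: Q_def \<psi>_def chains_def)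
    show "\<exists>x\<in>Q. y = \<psi> x" if y: "y \<in> ?B" for y
    proof -
      obtain cs ds where cd: "y = (cs, ds)" "incr cs" "incr ds" "flawed cs ds" "set cs \<subseteq> S" "set ds \<subseteq> S"
        "length cs = i" "length ds = Suc j"
        using y by (auto simp: chains_def)
      obtain cb ck cu db dk du where "cs = cb @ dk @ cu" "ds = db @ ck @ du" "splits cb ck cu db dk du"
        using splits_exists' cd by metis
      then show ?thesis
        using cd len by (intro bexI[of _ "(cb, ck, cu, db, dk, du)"]) (auto simp: Q_def \<psi>_def)
    qed
  qed
  then have B: "sum ?h ?B = (\<Sum>x\<in>Q. ?h (\<psi> x))" by (simp add: sum.reindex_bij_betw)
  have "?h (\<phi> x) = ?h (\<psi> x)" if x: "x \<in> Q" for x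
  proof -
    obtain cb ck cu db dk du where *: "x = (cb, ck, cu, db, dk, du)" by (cases x) auto
    have "keq (rev (cb @ ck @ cu) @ rev (db @ dk @ du)) (rev (cb @ dk @ cu) @ rev (db @ ck @ du))"
      by (rule splits_keq) (use x in \<open>simp add: Q_def *\<close>)
    then show ?thesis
      using g unfolding * \<phi>_def \<psi>_def invariant_def by (simp del: rev_append)
  qed
  then show ?thesis unfolding A B by (rule sum.cong[OF refl])
qed

section \<open>The elementary functions commute\<close>

text \<open>The bound on the lengths makes an induction possible: the tails at a flaw are shorter than the
  columns.\<close>

definition commuting :: "nat \<Rightarrow> bool" where
  "commuting N \<longleftrightarrow> (\<forall>g S i j. invariant g \<longrightarrow> i + j < N \<longrightarrow>
     (\<Sum>x\<in>chains S i. \<Sum>y\<in>chains S j. g (rev x @ rev y)) =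
     (\<Sum>x\<in>chains S j. \<Sum>y\<in>chains S i. g (rev x @ rev y)))"

text \<open>What is kept of two adjacent columns at a flaw in row \<open>length t\<close>: the right
  entry of that row, \<open>last t'\<close>, belongs to the head, the left entry does not.\<close>

definition colhead :: "'a list \<Rightarrow> 'a list \<Rightarrow> bool" where
  "colhead t t' \<longleftrightarrow> incr t \<and> incr t' \<and> length t' = Suc (length t) \<and> (\<forall>s<length t. \<not> t' ! s \<prec> t ! s)"

text \<open>The reason why the tails are unconstrained: whatever lies above \<open>last t'\<close>
  lies above both heads. For \<open>t\<close> this is \<open>below_third\<close> applied to the last
  two entries of \<open>t'\<close> and \<open>z\<close>.\<close>

lemma colhead_less:
  assumes h: "colhead t t'" and z: "last t' \<prec> z" and x: "x \<in> set t \<union> set t'"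
  shows "x \<prec> z"
proof -
  obtain r where r: "length t = r" "length t' = Suc r" using h by (auto simp: colhead_def)
  have l: "last t' = t' ! r" using r by (metis last_conv_nth diff_Suc_1 length_0_conv nat.distinct(1))
  show ?thesis
  proof (cases "x \<in> set t'")
    case True
    then obtain i where "i < Suc r" "x = t' ! i" using r by (auto simp: in_set_conv_nth)
    moreover from this have "t' ! i = t' ! r \<or> t' ! i \<prec> t' ! r"
      by (intro incr_nth_le) (use h r in \<open>auto simp: colhead_def\<close>)
    ultimately show ?thesis using lt_between[OF _ z[unfolded l] disjI1[OF refl]] by blast
  next
    case False
    then obtain i where i: "i < r" "x = t ! i" using x r by (auto simp: in_set_conv_nth)
    have "t' ! (r - 1) \<prec> t' ! r"
      using h r i sorted_wrt_nth_less[of "(\<prec>)" t' "r - 1" r] by (auto simp: colhead_def)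
    moreover have "\<not> t' ! (r - 1) \<prec> t ! (r - 1)" using h r i by (auto simp: colhead_def)
    ultimately have "t ! (r - 1) \<prec> z" using below_third z[unfolded l] by blast
    moreover have "t ! i = t ! (r - 1) \<or> t ! i \<prec> t ! (r - 1)"
      by (rule incr_nth_le) (use h r i in \<open>auto simp: colhead_def\<close>)
    ultimately show ?thesis using lt_between[OF _ _ disjI1[OF refl]] i by metis
  qed
qed

text \<open>The tail \<open>y\<close> slides over the head \<open>t\<close>, with \<open>t'\<close>
  behind it. The two tails are then adjacent and commutation applies to chains in
  \<open>S'\<close>.\<close>

lemma swap_tails:
  fixes S :: "'a set"
  assumes c: "commuting N" and ab: "a + b < N" and g: "invariant g" and h: "colhead t t'"
  defines "S' \<equiv> {z\<in>S. last t' \<prec> z}"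
  shows "(\<Sum>x\<in>chains S' a. \<Sum>y\<in>chains S' b. g (p @ rev (t @ x) @ rev (t' @ y) @ s)) =
    (\<Sum>x\<in>chains S' b. \<Sum>y\<in>chains S' a. g (p @ rev (t @ x) @ rev (t' @ y) @ s))"
proof -
  have eq: "g (p @ rev (t @ x) @ rev (t' @ y) @ s) = g (p @ (rev x @ rev y) @ rev t @ rev t' @ s)"
    if y: "y \<in> chains S' k" for x y k
  proof -
    have "keq (rev t @ rev y @ rev t') (rev y @ rev t @ rev t')"
    proof (rule slide_column)
      \<comment> \<open>\<open>t'\<close> is longer by one, so alignment at the largest entries
        compares \<open>t ! k\<close> with \<open>t' ! Suc k\<close>, one row below the comparison
        provided by \<open>colhead\<close>.\<close>
      show "\<not> rev t' ! i \<prec> rev t ! i" if i: "i < length (rev t)" for i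
      proof -
        define k where "k = length t - Suc i"
        have e: "rev t ! i = t ! k" "rev t' ! i = t' ! Suc k" "k < length t"
          using i h by (auto simp: rev_nth k_def colhead_def Suc_diff_Suc)
        have "t' ! k \<prec> t' ! Suc k" "\<not> t' ! k \<prec> t ! k"
          using h e sorted_wrt_nth_less[of "(\<prec>)" t' k "Suc k"] by (auto simp: colhead_def)
        then show ?thesis using e trans[of "t' ! k" "t' ! Suc k" "t ! k"] by auto
      qed
      show "z \<prec> x" if "x \<in> set (rev y)" "z \<in> set (rev t @ rev t')" for x z
        using that y colhead_less[OF h] by (auto simp: chains_def S'_def)
    qed (use h y in \<open>auto simp: colhead_def chains_def sorted_wrt_rev\<close>)
    then have "keq ((p @ rev x) @ (rev t @ rev y @ rev t') @ s) ((p @ rev x) @ (rev y @ rev t @ rev t') @ s)"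
      by (rule keq_context)
    then show ?thesis using g unfolding invariant_def by simp
  qed
  let ?g = "\<lambda>w. g (p @ w @ rev t @ rev t' @ s)"
  have "invariant ?g" by (rule invariant_context[OF g])
  then have "(\<Sum>x\<in>chains S' a. \<Sum>y\<in>chains S' b. ?g (rev x @ rev y)) =
      (\<Sum>x\<in>chains S' b. \<Sum>y\<in>chains S' a. ?g (rev x @ rev y))"
    using c ab unfolding commuting_def by blast
  then show ?thesis using eq by (simp cong: sum.cong)
qed

text \<open>Rows and columns are counted from 0. The key of an array consists of everything except the two
  tails at the flaw in the first flawed row that lies furthest to the right.\<close>

definition flaw_at :: "'a list list \<Rightarrow> nat \<Rightarrow> nat \<Rightarrow> bool" where
  "flaw_at As s j \<longleftrightarrow> Suc j < length As \<and> s < length (As ! Suc j) \<and>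
     (length (As ! j) \<le> s \<or> As ! Suc j ! s \<prec> As ! j ! s)"

definition flaw_row :: "'a list list \<Rightarrow> nat" where
  "flaw_row As = (LEAST s. \<exists>j. flaw_at As s j)"

definition flaw_col :: "'a list list \<Rightarrow> nat" where
  "flaw_col As = Max {j. flaw_at As (flaw_row As) j}"

definition flaw_key :: "'a list list \<Rightarrow> 'a list list \<times> 'a list \<times> 'a list \<times> 'a list list" where
  "flaw_key As = (let j = flaw_col As; r = flaw_row As in
     (take j As, take r (As ! j), take (Suc r) (As ! Suc j), drop (Suc (Suc j)) As))"

definition columns :: "nat \<Rightarrow> 'a set \<Rightarrow> 'a list list set" where
  "columns M S = {As. length As = M \<and> (\<forall>A\<in>set As. incr A \<and> set A \<subseteq> S)}"

text \<open>The third claim makes the fiber of a key equal to all pairs of chains in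
  \<open>S'\<close>. Changing tails leaves the rows before \<open>r\<close> alone, and in row
  \<open>r\<close> it changes only the column \<open>j\<close>. This can create or destroy a flaw of
  row \<open>r\<close> at \<open>j - 1\<close>, but none to the right of \<open>j\<close>, which is
  why the rightmost flaw is chosen.\<close>

lemma flaw_key_props:
  assumes As: "As \<in> columns M S" and fl: "flaw_at As s0 j0" and key: "flaw_key As = (pre, t, t', post)"
  defines "S' \<equiv> {z\<in>S. last t' \<prec> z}"
  shows "colhead t t'"
    and "\<exists>x y. As = pre @ [t @ x, t' @ y] @ post \<and> x \<in> chains S' (length x) \<and> y \<in> chains S' (length y)"
    and "\<And>x y. incr x \<Longrightarrow> incr y \<Longrightarrow> set x \<subseteq> S' \<Longrightarrow> set y \<subseteq> S' \<Longrightarrow>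
       pre @ [t @ x, t' @ y] @ post \<in> columns M S \<and>
       (\<exists>s j. flaw_at (pre @ [t @ x, t' @ y] @ post) s j) \<and>
       flaw_key (pre @ [t @ x, t' @ y] @ post) = (pre, t, t', post)"
proof -
  define r where "r = flaw_row As"
  define j where "j = flaw_col As"
  have "\<exists>j. flaw_at As r j" unfolding r_def flaw_row_def by (rule LeastI_ex) (use fl in blast)
  moreover have fin: "finite {j. flaw_at As r j}"
    by (rule finite_subset[of _ "{..<length As}"]) (auto simp: flaw_at_def)
  ultimately have rj: "flaw_at As r j" and jmax: "\<And>j'. flaw_at As r j' \<Longrightarrow> j' \<le> j"
    using Max_in[OF fin] Max_ge[OF fin] unfolding j_def flaw_col_def r_def[symmetric] by auto
  have rmin: "\<not> flaw_at As s j'" if "s < r" for s j'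
    using that not_less_Least unfolding r_def flaw_row_def by blast
  have k: "pre = take j As" "t = take r (As ! j)" "t' = take (Suc r) (As ! Suc j)" "post = drop (Suc (Suc j)) As"
    using key unfolding flaw_key_def Let_def r_def j_def by auto
  have jM: "Suc j < length As" and r': "r < length (As ! Suc j)" using rj by (auto simp: flaw_at_def)
  have row: "s < length (As ! j) \<and> \<not> As ! Suc j ! s \<prec> As ! j ! s" if "s < r" for s
    using rmin[OF that, of j] that jM r' by (auto simp: flaw_at_def)
  have rl: "r \<le> length (As ! j)" using row by (metis not_less less_irrefl)
  have inc: "incr (As ! i)" "set (As ! i) \<subseteq> S" if "i < length As" for i
    using As that by (auto simp: columns_def)
  have lt: "length t = r" "length t' = Suc r" "length pre = j" using rl r' jM by (auto simp: k)
  define x0 where "x0 = drop r (As ! j)"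
  define y0 where "y0 = drop (Suc r) (As ! Suc j)"
  have colj: "As ! j = t @ x0" "As ! Suc j = t' @ y0" by (auto simp: k x0_def y0_def)
  have Aseq: "As = pre @ [t @ x0, t' @ y0] @ post"
  proof -
    have "As = take j As @ [As ! j, As ! Suc j] @ drop (Suc (Suc j)) As"
      using jM by (simp add: Cons_nth_drop_Suc)
    from this[folded k(1,4), unfolded colj] show ?thesis .
  qed
  have inct: "incr t" "incr t'" "incr x0" "incr y0" "set t \<subseteq> S" "set t' \<subseteq> S" "set x0 \<subseteq> S" "set y0 \<subseteq> S"
    using inc[of j] inc[of "Suc j"] jM unfolding colj by (auto simp: sorted_wrt_append)
  show h: "colhead t t'"
    unfolding colhead_def using inct lt row by (auto simp: k)
  have last: "last t' = t' ! r" using lt by (metis last_conv_nth diff_Suc_1 length_0_conv nat.distinct(1))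
  have lastin: "last t' \<in> set t'" using lt by (metis last_in_set length_0_conv nat.distinct(1))
  have y0: "set y0 \<subseteq> S'"
    using inc(1)[of "Suc j"] jM inct lastin unfolding colj S'_def by (auto simp: sorted_wrt_append)
  have x0: "last t' \<prec> z" if z: "z \<in> set x0" for z
  proof -
    obtain i where i: "i < length x0" "z = x0 ! i" using z by (auto simp: in_set_conv_nth)
    have "t' ! r \<prec> x0 ! 0"
      using rj i lt unfolding flaw_at_def colj by (auto simp: nth_append)
    moreover have "x0 ! 0 = x0 ! i \<or> x0 ! 0 \<prec> x0 ! i"
      by (rule incr_nth_le) (use inct i in auto)
    ultimately show ?thesis using lt_between[OF disjI1[OF refl]] i last by metis
  qed
  show "\<exists>x y. As = pre @ [t @ x, t' @ y] @ post \<and> x \<in> chains S' (length x) \<and> y \<in> chains S' (length y)"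
    using Aseq inct x0 y0 by (intro exI[of _ x0] exI[of _ y0]) (auto simp: chains_def S'_def)
  fix x y assume xy: "incr x" "incr y" "set x \<subseteq> S'" "set y \<subseteq> S'"
  define B where "B = pre @ [t @ x, t' @ y] @ post"
  have ix: "incr (t @ x)" "incr (t' @ y)"
    using inct xy colhead_less[OF h] by (auto simp: sorted_wrt_append S'_def)
  have "B \<in> columns M S"
    using As ix xy inct unfolding B_def columns_def Aseq S'_def by auto
  have lB: "length B = length As" unfolding B_def by (subst Aseq) simp
  have Bn: "B ! j = t @ x" "B ! Suc j = t' @ y" using lt by (auto simp: B_def nth_append)
  have Bo: "B ! i = As ! i" if "i \<noteq> j" "i \<noteq> Suc j" for i
  proof (cases "i < j")
    case True
    then show ?thesis using lt unfolding B_def by (subst Aseq) (simp add: nth_append)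
  next
    case False
    then have "Suc (Suc j) \<le> i" using that by simp
    then obtain e where "i = Suc (Suc j) + e" using le_Suc_ex by blast
    then show ?thesis using lt unfolding B_def by (subst Aseq) (simp add: nth_append)
  qed
  have cell: "(s < length (B ! i) \<longleftrightarrow> s < length (As ! i)) \<and> (s < length (B ! i) \<longrightarrow> B ! i ! s = As ! i ! s)"
    if "s < r \<or> s = r \<and> i \<noteq> j" for s i
    using that Bn colj Bo lt by (cases "i = j"; cases "i = Suc j") (auto simp: nth_append)
  have agree: "flaw_at B s j' = flaw_at As s j'" if "s < r \<or> s = r \<and> j < j'" for s j'
    using cell[of s j'] cell[of s "Suc j'"] that lB unfolding flaw_at_def
    by (metis Suc_n_not_le_n less_or_eq_imp_le not_less not_less_eq)
  have Brj: "flaw_at B r j"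
  proof -
    have "t' ! r \<prec> x ! 0" if "x \<noteq> []"
    proof -
      have "x ! 0 \<in> S'" using that xy(3) by (simp add: subsetD)
      then show ?thesis by (simp add: S'_def last)
    qed
    then show ?thesis using jM lB lt unfolding flaw_at_def Bn by (auto simp: nth_append)
  qed
  have Br: "flaw_row B = r"
    unfolding flaw_row_def
  proof (rule Least_equality)
    show "\<exists>j. flaw_at B r j" using Brj by blast
    show "r \<le> s" if "\<exists>j. flaw_at B s j" for s
      using that agree[of s] rmin[of s] by (metis not_less)
  qed
  have Bj: "flaw_col B = j"
    unfolding flaw_col_def Br
  proof (rule Max_eqI)
    show "finite {j. flaw_at B r j}"
      by (rule finite_subset[of _ "{..<length B}"]) (auto simp: flaw_at_def)
    show "j' \<le> j" if "j' \<in> {j. flaw_at B r j}" for j'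
      using that agree[of r j'] jmax[of j'] by (metis mem_Collect_eq not_le)
  qed (use Brj in simp)
  have "flaw_key B = (pre, t, t', post)"
    unfolding flaw_key_def Br Bj Let_def Bn using lt by (simp add: B_def)
  then show "pre @ [t @ x, t' @ y] @ post \<in> columns M S \<and>
       (\<exists>s j. flaw_at (pre @ [t @ x, t' @ y] @ post) s j) \<and>
       flaw_key (pre @ [t @ x, t' @ y] @ post) = (pre, t, t', post)"
    using \<open>B \<in> columns M S\<close> Brj unfolding B_def[symmetric] by blast
qed

section \<open>Sums over the arrays with a given key\<close>

definition col_word :: "'a list list \<Rightarrow> 'a list" where
  "col_word As = concat (map rev As)"

text \<open>The lengths are integers because the index of a determinant entry may be negative; no
  array has such a length, in agreement with \<open>esym_int\<close> being zero there.\<close>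

definition has_lengths :: "nat \<Rightarrow> (nat \<Rightarrow> int) \<Rightarrow> 'a list list \<Rightarrow> bool" where
  "has_lengths M v As \<longleftrightarrow> (\<forall>i<M. int (length (As ! i)) = v i)"

definition has_flaw :: "'a list list \<Rightarrow> bool" where
  "has_flaw As \<longleftrightarrow> (\<exists>s j. flaw_at As s j)"

definition fiber_sum ::
  "('a list \<Rightarrow> int) \<Rightarrow> nat \<Rightarrow> 'a set \<Rightarrow> 'a list list \<times> 'a list \<times> 'a list \<times> 'a list list \<Rightarrow> (nat \<Rightarrow> int) \<Rightarrow> int"
  where "fiber_sum g M S \<kappa> v =
    (\<Sum>As\<in>{As\<in>columns M S. has_flaw As \<and> has_lengths M v As \<and> flaw_key As = \<kappa>}. g (col_word As))"

text \<open>The heads have lengths \<open>r\<close> and \<open>r + 1\<close>. Exchanging tail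
  lengths \<open>a\<close> and \<open>b\<close> thus turns the column lengths \<open>r + a\<close>,
  \<open>r + 1 + b\<close> into \<open>r + b\<close>, \<open>r + 1 + a\<close>, whence the shifts by
  one.\<close>

lemma fiber_sum_swap:
  assumes c: "commuting N" and g: "invariant g"
    and N: "v (length pre) + v (Suc (length pre)) \<le> int N"
  shows "fiber_sum g M S (pre, t, t', post)
      (v(length pre := v (Suc (length pre)) - 1, Suc (length pre) := v (length pre) + 1)) =
    fiber_sum g M S (pre, t, t', post) v"
proof (cases "\<exists>As\<in>columns M S. has_flaw As \<and> flaw_key As = (pre, t, t', post)")
  case False
  then show ?thesis unfolding fiber_sum_def by (intro arg_cong2[of _ _ _ _ sum]) auto
next
  case True
  define j where "j = length pre"
  define r where "r = length t"
  define S' where "S' = {z\<in>S. last t' \<prec> z}"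
  define arr where "arr = (\<lambda>(x, y). pre @ [t @ x, t' @ y] @ post)"
  from True obtain A0 s0 j0 where A0: "A0 \<in> columns M S" "flaw_at A0 s0 j0" "flaw_key A0 = (pre, t, t', post)"
    unfolding has_flaw_def by blast
  have h: "colhead t t'" by (rule flaw_key_props(1)[OF A0])
  then have lt': "length t' = Suc r" by (simp add: colhead_def r_def)
  have M: "M = Suc (Suc j) + length post"
    using flaw_key_props(2)[OF A0] A0(1) by (auto simp: columns_def j_def)
  define ok where "ok u \<longleftrightarrow> (\<forall>i<M. i \<noteq> j \<longrightarrow> i \<noteq> Suc j \<longrightarrow>
      int (length ((pre @ [[], []] @ post) ! i)) = u i) \<and> int r \<le> u j \<and> int r + 1 \<le> u (Suc j)" for u
  have lens: "has_lengths M u (arr (x, y)) \<longleftrightarrow>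
      (\<forall>i<M. i \<noteq> j \<longrightarrow> i \<noteq> Suc j \<longrightarrow> int (length ((pre @ [[], []] @ post) ! i)) = u i) \<and>
      int r + int (length x) = u j \<and> int r + 1 + int (length y) = u (Suc j)" (is "?L \<longleftrightarrow> ?R") for u x y
  proof -
    have n: "arr (x, y) ! i = (if i = j then t @ x else if i = Suc j then t' @ y else (pre @ [[], []] @ post) ! i)"
      for i
      by (auto simp: arr_def j_def nth_append nth_Cons split: nat.splits)
    have all: "(\<forall>i<M. Q i) \<longleftrightarrow> (\<forall>i<M. i \<noteq> j \<longrightarrow> i \<noteq> Suc j \<longrightarrow> Q i) \<and> Q j \<and> Q (Suc j)" for Q
      using M by (metis Suc_lessD less_add_Suc1 plus_nat.simps(2))
    show ?thesis
      unfolding has_lengths_def all[of "\<lambda>i. int (length (arr (x, y) ! i)) = u i"]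
      using lt' by (simp add: n r_def ac_simps)
  qed
  have mem: "arr (x, y) \<in> columns M S \<and> has_flaw (arr (x, y)) \<and> flaw_key (arr (x, y)) = (pre, t, t', post)"
    if "x \<in> chains S' a" "y \<in> chains S' b" for x y a b
    using flaw_key_props(3)[OF A0, of x y] that unfolding chains_def S'_def has_flaw_def arr_def by auto
  have set_eq: "{As\<in>columns M S. has_flaw As \<and> has_lengths M u As \<and> flaw_key As = (pre, t, t', post)} =
      (if ok u then arr ` (chains S' (nat (u j - int r)) \<times> chains S' (nat (u (Suc j) - int r - 1))) else {})"
    (is "?A = ?B") for u
  proof (intro equalityI subsetI)
    fix As assume "As \<in> ?A"
    then obtain s1 j1 where A: "As \<in> columns M S" "flaw_at As s1 j1" "flaw_key As = (pre, t, t', post)"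
      "has_lengths M u As"
      unfolding has_flaw_def by blast
    from flaw_key_props(2)[OF A(1-3)] A(4)
    obtain x y where As: "As = arr (x, y)" "x \<in> chains S' (length x)" "y \<in> chains S' (length y)"
      "has_lengths M u As"
      unfolding arr_def S'_def by auto
    then have "ok u" "length x = nat (u j - int r)" "length y = nat (u (Suc j) - int r - 1)"
      using lens[of u x y] by (auto simp: ok_def)
    then show "As \<in> ?B" using As by auto
  next
    fix As assume B: "As \<in> ?B"
    then have ok: "ok u" by (auto split: if_splits)
    then obtain x y where As: "As = arr (x, y)" "x \<in> chains S' (nat (u j - int r))"
      "y \<in> chains S' (nat (u (Suc j) - int r - 1))"
      using B by auto
    have "has_lengths M u As"
      unfolding As(1) lens using As(2,3) ok by (auto simp: ok_def chains_def)
    then show "As \<in> ?A" using mem[OF As(2,3)] As(1) by simp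
  qed
  have inj: "inj_on arr X" for X by (auto simp: inj_on_def arr_def)
  let ?p = "col_word pre" and ?s = "col_word post"
  have fs: "fiber_sum g M S (pre, t, t', post) u = (if ok u then
      \<Sum>x\<in>chains S' (nat (u j - int r)). \<Sum>y\<in>chains S' (nat (u (Suc j) - int r - 1)).
        g (?p @ rev (t @ x) @ rev (t' @ y) @ ?s) else 0)" for u
  proof (cases "ok u")
    case True
    then show ?thesis
      unfolding fiber_sum_def set_eq
      by (simp only: if_True sum.reindex[OF inj] sum.cartesian_product)
        (auto simp: arr_def col_word_def intro!: sum.cong)
  next
    case False
    then show ?thesis unfolding fiber_sum_def set_eq by simp
  qed
  define u where "u = v(j := v (Suc j) - 1, Suc j := v j + 1)"
  have u: "u j = v (Suc j) - 1" "u (Suc j) = v j + 1" by (auto simp: u_def)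
  have ok: "ok u \<longleftrightarrow> ok v" by (auto simp: ok_def u_def)
  have "(\<Sum>x\<in>chains S' (nat (v (Suc j) - 1 - int r)). \<Sum>y\<in>chains S' (nat (v j + 1 - int r - 1)).
        g (?p @ rev (t @ x) @ rev (t' @ y) @ ?s)) =
     (\<Sum>x\<in>chains S' (nat (v j - int r)). \<Sum>y\<in>chains S' (nat (v (Suc j) - int r - 1)).
        g (?p @ rev (t @ x) @ rev (t' @ y) @ ?s))" if ok: "ok v"
  proof -
    define a where "a = nat (v j - int r)"
    define b where "b = nat (v (Suc j) - int r - 1)"
    have e: "nat (v (Suc j) - 1 - int r) = b" "nat (v j + 1 - int r - 1) = a"
      by (auto simp: a_def b_def algebra_simps)
    \<comment> \<open>The tails have total length \<open>v j + v (Suc j) - 2 * r - 1\<close>. The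
      one lost to the flawed entry is what advances the induction in
      \<open>commuting_Suc\<close>.\<close>
    have ba: "b + a < N" using ok N by (auto simp: ok_def a_def b_def j_def)
    show ?thesis
      unfolding e a_def[symmetric] b_def[symmetric] S'_def by (rule swap_tails[OF c ba g h])
  qed
  then have "fiber_sum g M S (pre, t, t', post) u = fiber_sum g M S (pre, t, t', post) v"
    unfolding fs ok u by simp
  then show ?thesis by (simp add: u_def j_def)
qed

lemma finite_columns_lengths: "finite {As\<in>columns M S. has_lengths M v As}"
proof (rule finite_subset)
  define L where "L = Max (insert 0 ((\<lambda>i. nat (v i)) ` {..<M}))"
  show "finite {As. set As \<subseteq> {cs :: 'a list. set cs \<subseteq> UNIV \<and> length cs \<le> L} \<and> length As = M}"
    by (rule finite_lists_length_eq, rule finite_lists_length_le, rule fin)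
  have "length A \<le> L" if As: "As \<in> columns M S" "has_lengths M v As" "A \<in> set As" for As A
  proof -
    obtain i where i: "i < M" "A = As ! i" using As by (auto simp: in_set_conv_nth columns_def)
    then have "length A = nat (v i)" using As(2) by (auto simp: has_lengths_def)
    then show ?thesis using i(1) by (auto simp: L_def intro!: Max_ge)
  qed
  then show "{As\<in>columns M S. has_lengths M v As} \<subseteq>
      {As. set As \<subseteq> {cs. set cs \<subseteq> UNIV \<and> length cs \<le> L} \<and> length As = M}"
    by (auto simp: columns_def)
qed

lemma flaw_sum_fibers:
  assumes "finite K" "\<And>As. As \<in> columns M S \<Longrightarrow> has_flaw As \<Longrightarrow> has_lengths M v As \<Longrightarrow> flaw_key As \<in> K"
  shows "(\<Sum>As\<in>{As\<in>columns M S. has_flaw As \<and> has_lengths M v As}. g (col_word As)) =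
    (\<Sum>\<kappa>\<in>K. fiber_sum g M S \<kappa> v)"
proof -
  have "finite {As\<in>columns M S. has_flaw As \<and> has_lengths M v As}"
    by (rule finite_subset[OF _ finite_columns_lengths[of M S v]]) auto
  from sum.group[OF this assms(1), of flaw_key "\<lambda>As. g (col_word As)", symmetric] assms(2)
  show ?thesis by (auto simp: fiber_sum_def conj_ac)
qed

lemma flaw_key_pre_length:
  assumes "As \<in> columns M S" "has_flaw As" "flaw_key As = (pre, t, t', post)"
  shows "Suc (length pre) < M"
proof -
  obtain s j where "flaw_at As s j" using assms(2) by (auto simp: has_flaw_def)
  from flaw_key_props(2)[OF assms(1) this assms(3)] assms(1) show ?thesis by (auto simp: columns_def)
qed

text \<open>Let \<open>j < i\<close>. Every pair of chains of lengths \<open>i\<close>,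
  \<open>j\<close> is \<open>dflawed\<close>. The flip leads to the \<open>flawed\<close> pairs of
  lengths \<open>i - 1\<close>, \<open>j + 1\<close>, and the exchange of tails leads from these to
  the \<open>flawed\<close> pairs of lengths \<open>j\<close>, \<open>i\<close>, which are again all
  pairs.\<close>

lemma commuting_Suc:
  assumes c: "commuting N"
  shows "commuting (Suc N)"
proof -
  have main: "(\<Sum>x\<in>chains S i. \<Sum>y\<in>chains S j. g (rev x @ rev y)) =
     (\<Sum>x\<in>chains S j. \<Sum>y\<in>chains S i. g (rev x @ rev y))"
    if g: "invariant g" and ij: "i + j \<le> N" and less: "j < i" for g S i j
  proof -
    obtain i' where i: "i = Suc i'" using less by (cases i) auto
    define two where "two l m = (\<lambda>k::nat. if k = 0 then int l else int m)" for l m :: nat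
    have pairs: "(\<Sum>(cs, ds)\<in>{(cs, ds). cs \<in> chains S l \<and> ds \<in> chains S m \<and> flawed cs ds}. g (rev cs @ rev ds)) =
      (\<Sum>As\<in>{As\<in>columns 2 S. has_flaw As \<and> has_lengths 2 (two l m) As}. g (col_word As))" for l m
    proof (rule sum.reindex_bij_witness[of _ "\<lambda>As. (As ! 0, As ! 1)" "\<lambda>(cs, ds). [cs, ds]"])
      have fl: "has_flaw [cs, ds] \<longleftrightarrow> flawed cs ds" for cs ds
        by (auto simp: has_flaw_def flaw_at_def flawed_def less_Suc_eq)
      have len: "has_lengths 2 (two l m) [cs, ds] \<longleftrightarrow> length cs = l \<and> length ds = m" for cs ds
        by (auto simp: has_lengths_def two_def numeral_2_eq_2 less_Suc_eq)
      have ex: "\<exists>cs ds. As = [cs, ds]" if "As \<in> columns 2 S" for As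
        using that by (auto simp: columns_def numeral_2_eq_2 length_Suc_conv)
      fix As assume A: "As \<in> {As\<in>columns 2 S. has_flaw As \<and> has_lengths 2 (two l m) As}"
      then obtain cs ds where As: "As = [cs, ds]" using ex[of As] by blast
      show "(case (As ! 0, As ! 1) of (cs, ds) \<Rightarrow> [cs, ds]) = As" by (simp add: As)
      show "(As ! 0, As ! 1) \<in> {(cs, ds). cs \<in> chains S l \<and> ds \<in> chains S m \<and> flawed cs ds}"
        using A unfolding As by (auto simp: fl len columns_def chains_def)
    next
      have fl: "has_flaw [cs, ds] \<longleftrightarrow> flawed cs ds" for cs ds
        by (auto simp: has_flaw_def flaw_at_def flawed_def less_Suc_eq)
      have len: "has_lengths 2 (two l m) [cs, ds] \<longleftrightarrow> length cs = l \<and> length ds = m" for cs ds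
        by (auto simp: has_lengths_def two_def numeral_2_eq_2 less_Suc_eq)
      fix p assume p: "p \<in> {(cs, ds). cs \<in> chains S l \<and> ds \<in> chains S m \<and> flawed cs ds}"
      then obtain cs ds where pe: "p = (cs, ds)" by auto
      show "(case p of (cs, ds) \<Rightarrow> [cs, ds]) \<in> {As\<in>columns 2 S. has_flaw As \<and> has_lengths 2 (two l m) As}"
        using p unfolding pe by (auto simp: fl len columns_def chains_def)
      show "((case p of (cs, ds) \<Rightarrow> [cs, ds]) ! 0, (case p of (cs, ds) \<Rightarrow> [cs, ds]) ! 1) = p"
        by (simp add: pe)
      show "g (col_word (case p of (cs, ds) \<Rightarrow> [cs, ds])) = (case p of (cs, ds) \<Rightarrow> g (rev cs @ rev ds))"
        by (simp add: pe col_word_def)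
    qed
    define K where "K = flaw_key ` ({As\<in>columns 2 S. has_flaw As \<and> has_lengths 2 (two i' (Suc j)) As} \<union>
        {As\<in>columns 2 S. has_flaw As \<and> has_lengths 2 (two j i) As})"
    have finK: "finite K" unfolding K_def
      by (intro finite_imageI finite_UnI)
        (rule finite_subset[OF _ finite_columns_lengths[of 2 S]], auto)+
    have fs: "fiber_sum g 2 S \<kappa> (two i' (Suc j)) = fiber_sum g 2 S \<kappa> (two j i)" if "\<kappa> \<in> K" for \<kappa>
    proof -
      obtain pre t t' post where k: "\<kappa> = (pre, t, t', post)" by (cases \<kappa>) auto
      have "pre = []"
        using that flaw_key_pre_length[of _ 2 S pre t t' post] unfolding K_def k by fastforce
      moreover have "((two i' (Suc j))(0 := two i' (Suc j) (Suc 0) - 1, Suc 0 := two i' (Suc j) 0 + 1)) k = two j i k"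
        if "k < 2" for k
        using that by (auto simp: two_def i)
      then have "fiber_sum g 2 S \<kappa> ((two i' (Suc j))(0 := two i' (Suc j) (Suc 0) - 1, Suc 0 := two i' (Suc j) 0 + 1)) =
          fiber_sum g 2 S \<kappa> (two j i)"
        unfolding fiber_sum_def has_lengths_def by (intro arg_cong2[of _ _ _ _ sum]) auto
      ultimately show ?thesis
        using fiber_sum_swap[OF c g, of "two i' (Suc j)" pre 2 S t t' post] ij k
        by (simp add: two_def i)
    qed
    have "(\<Sum>x\<in>chains S i. \<Sum>y\<in>chains S j. g (rev x @ rev y)) =
       (\<Sum>(cs, ds)\<in>{(cs, ds). cs \<in> chains S (Suc i') \<and> ds \<in> chains S j \<and> dflawed cs ds}. g (rev cs @ rev ds))"
      unfolding sum.cartesian_product i[symmetric]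
      by (rule sum.cong) (use less in \<open>auto simp: chains_def dflawed_def\<close>)
    also have "\<dots> = (\<Sum>(cs, ds)\<in>{(cs, ds). cs \<in> chains S i' \<and> ds \<in> chains S (Suc j) \<and> flawed cs ds}. g (rev cs @ rev ds))"
      by (rule sum_dflawed_eq_sum_flawed[OF g])
    also have "\<dots> = (\<Sum>\<kappa>\<in>K. fiber_sum g 2 S \<kappa> (two i' (Suc j)))"
      unfolding pairs by (rule flaw_sum_fibers[OF finK]) (auto simp: K_def)
    also have "\<dots> = (\<Sum>\<kappa>\<in>K. fiber_sum g 2 S \<kappa> (two j i))"
      by (rule sum.cong[OF refl fs])
    also have "\<dots> = (\<Sum>As\<in>{As\<in>columns 2 S. has_flaw As \<and> has_lengths 2 (two j i) As}. g (col_word As))"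
      by (rule flaw_sum_fibers[OF finK, symmetric]) (auto simp: K_def)
    also have "\<dots> = (\<Sum>(cs, ds)\<in>{(cs, ds). cs \<in> chains S j \<and> ds \<in> chains S i \<and> flawed cs ds}. g (rev cs @ rev ds))"
      by (rule pairs[symmetric])
    also have "\<dots> = (\<Sum>x\<in>chains S j. \<Sum>y\<in>chains S i. g (rev x @ rev y))"
      unfolding sum.cartesian_product
      by (rule sum.cong) (use less in \<open>auto simp: chains_def flawed_def\<close>)
    finally show ?thesis .
  qed
  show ?thesis
    unfolding commuting_def
  proof (intro allI impI)
    fix g :: "'a list \<Rightarrow> int" and S i j
    assume "invariant g" "i + j < Suc N"
    then show "(\<Sum>x\<in>chains S i. \<Sum>y\<in>chains S j. g (rev x @ rev y)) =
     (\<Sum>x\<in>chains S j. \<Sum>y\<in>chains S i. g (rev x @ rev y))"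
      using main[of g i j S] main[of g j i S] by (cases i j rule: linorder_cases) auto
  qed
qed

lemma commuting: "commuting N"
proof (induction N)
  case 0
  show ?case by (simp add: commuting_def)
qed (rule commuting_Suc)

section \<open>Signed sums of column arrays\<close>

lemma sum_sign_cancel:
  fixes f :: "(nat \<Rightarrow> nat) \<Rightarrow> int"
  assumes j: "Suc j < M" and f: "\<And>p. p permutes {0..<M} \<Longrightarrow> f (p \<circ> Transposition.transpose j (Suc j)) = f p"
  shows "(\<Sum>p | p permutes {0..<M}. sign p * f p) = 0"
proof -
  let ?q = "Transposition.transpose j (Suc j)"
  have q: "?q permutes {0..<M}" by (rule permutes_swap_id) (use j in auto)
  have "(\<Sum>p | p permutes {0..<M}. sign p * f p) = (\<Sum>p | p permutes {0..<M}. sign (p \<circ> ?q) * f (p \<circ> ?q))"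
    by (rule sum_permutations_compose_right[OF q])
  also have "\<dots> = (\<Sum>p | p permutes {0..<M}. - (sign p * f p))"
  proof (rule sum.cong[OF refl])
    fix p assume "p \<in> {p. p permutes {0..<M}}"
    then have p: "p permutes {0..<M}" by simp
    have "permutation p" using p permutation_permutes by blast
    then have "sign (p \<circ> ?q) = - sign p"
      by (simp add: sign_compose permutation_swap_id sign_swap_id)
    then show "sign (p \<circ> ?q) * f (p \<circ> ?q) = - (sign p * f p)" using f[OF p] by simp
  qed
  finally show ?thesis by (simp add: sum_negf)
qed

text \<open>The term of \<open>p\<close> in the Jacobi-Trudi determinant, with its factors listed by the matrix column
  they come from: this makes the flaw move between positions \<open>j\<close> and \<open>j + 1\<close> a right
  multiplication of \<open>p\<close> by a transposition.\<close>

definition dotted :: "(nat \<Rightarrow> nat) \<Rightarrow> (nat \<Rightarrow> nat) \<Rightarrow> nat \<Rightarrow> int" where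
  "dotted c p i = int (c (p i)) - int (p i) + int i"

text \<open>Arrays with a flaw cancel within each key by \<open>fiber_sum_swap\<close>, as the
  transposition at \<open>length pre\<close> changes the sign. Without a flaw the column lengths
  decrease weakly, which leaves only the identity permutation.\<close>

lemma alternating_sum_columns:
  assumes g: "invariant g" and c: "\<And>i. Suc i < M \<Longrightarrow> c (Suc i) \<le> c i"
  shows "(\<Sum>p | p permutes {0..<M}. sign p *
      (\<Sum>As\<in>{As\<in>columns M UNIV. has_lengths M (dotted c p) As}. g (col_word As))) =
    (\<Sum>As\<in>{As\<in>columns M UNIV. \<not> has_flaw As \<and> (\<forall>i<M. length (As ! i) = c i)}. g (col_word As))"
proof -
  let ?P = "{p. p permutes {0..<M}}"
  let ?F = "\<lambda>p. {As\<in>columns M UNIV. has_flaw As \<and> has_lengths M (dotted c p) As}"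
  let ?G = "\<lambda>p. {As\<in>columns M UNIV. \<not> has_flaw As \<and> has_lengths M (dotted c p) As}"
  have finP: "finite ?P" by (rule finite_permutations) simp
  have split: "(\<Sum>As\<in>{As\<in>columns M UNIV. has_lengths M (dotted c p) As}. g (col_word As)) =
      (\<Sum>As\<in>?F p. g (col_word As)) + (\<Sum>As\<in>?G p. g (col_word As))" for p
    by (subst sum.union_disjoint[symmetric])
      (auto intro: finite_subset[OF _ finite_columns_lengths[of M UNIV "dotted c p"]] intro!: sum.cong)
  define K where "K = flaw_key ` (\<Union>p\<in>?P. ?F p)"
  have finK: "finite K" unfolding K_def
    by (intro finite_imageI finite_UN_I finP)
      (rule finite_subset[OF _ finite_columns_lengths[of M UNIV]], auto)
  have "(\<Sum>p\<in>?P. sign p * (\<Sum>As\<in>?F p. g (col_word As))) =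
      (\<Sum>p\<in>?P. sign p * (\<Sum>\<kappa>\<in>K. fiber_sum g M UNIV \<kappa> (dotted c p)))"
  proof (rule sum.cong[OF refl])
    fix p assume "p \<in> ?P"
    then show "sign p * (\<Sum>As\<in>?F p. g (col_word As)) =
        sign p * (\<Sum>\<kappa>\<in>K. fiber_sum g M UNIV \<kappa> (dotted c p))"
      by (subst flaw_sum_fibers[OF finK]) (auto simp: K_def)
  qed
  also have "\<dots> = (\<Sum>\<kappa>\<in>K. \<Sum>p\<in>?P. sign p * fiber_sum g M UNIV \<kappa> (dotted c p))"
    unfolding sum_distrib_left by (rule sum.swap)
  also have "\<dots> = 0"
  proof (rule sum.neutral, rule ballI)
    fix \<kappa> assume k: "\<kappa> \<in> K"
    obtain pre t t' post where ke: "\<kappa> = (pre, t, t', post)" by (cases \<kappa>) auto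
    have j: "Suc (length pre) < M"
      using k flaw_key_pre_length[of _ M UNIV pre t t' post] unfolding K_def ke by fastforce
    show "(\<Sum>p\<in>?P. sign p * fiber_sum g M UNIV \<kappa> (dotted c p)) = 0"
    proof (rule sum_sign_cancel[OF j])
      fix p
      let ?j = "length pre"
      have "dotted c (p \<circ> Transposition.transpose ?j (Suc ?j)) =
          (dotted c p)(?j := dotted c p (Suc ?j) - 1, Suc ?j := dotted c p ?j + 1)"
        by (auto simp: dotted_def fun_eq_iff Transposition.transpose_def)
      then show "fiber_sum g M UNIV \<kappa> (dotted c (p \<circ> Transposition.transpose ?j (Suc ?j))) =
          fiber_sum g M UNIV \<kappa> (dotted c p)"
        unfolding ke
        by (simp only:)
          (rule fiber_sum_swap[OF commuting[of "nat (dotted c p ?j + dotted c p (Suc ?j))"] g], simp)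
    qed
  qed
  finally have F0: "(\<Sum>p\<in>?P. sign p * (\<Sum>As\<in>?F p. g (col_word As))) = 0" .
  have G0: "?G p = {}" if p: "p permutes {0..<M}" "p \<noteq> id" for p
  proof (rule ccontr)
    assume "?G p \<noteq> {}"
    then obtain As where As: "As \<in> columns M UNIV" "\<not> has_flaw As" "has_lengths M (dotted c p) As" by blast
    have lA: "length As = M" using As(1) by (simp add: columns_def)
    have cdec: "c j \<le> c i" if "i \<le> j" "j < M" for i j
      using that
    proof (induction j)
      case (Suc j)
      then show ?case using c[of j] by (cases "i = Suc j") (auto intro: order_trans)
    qed simp
    \<comment> \<open>A descent of \<open>p\<close> at \<open>i\<close> makes column
      \<open>i + 1\<close> longer than column \<open>i\<close>, so there is a flaw just below the
      end of column \<open>i\<close>.\<close>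
    have step: "p i < p (Suc i)" if i: "Suc i < M" for i
    proof (rule ccontr)
      assume n: "\<not> p i < p (Suc i)"
      have "p i \<noteq> p (Suc i)" using permutes_inj[OF p(1)] by (metis injD n_not_Suc_n)
      then have pl: "p (Suc i) < p i" using n by simp
      have "p i < M" using permutes_in_image[OF p(1), of i] i by simp
      then have "c (p i) \<le> c (p (Suc i))" using cdec pl by simp
      then have "dotted c p i < dotted c p (Suc i)" using pl by (simp add: dotted_def)
      moreover have "int (length (As ! i)) = dotted c p i" "int (length (As ! Suc i)) = dotted c p (Suc i)"
        using As(3) i by (auto simp: has_lengths_def)
      ultimately have "length (As ! i) < length (As ! Suc i)" by simp
      then have "flaw_at As (length (As ! i)) i" using i lA by (simp add: flaw_at_def)
      then show False using As(2) by (auto simp: has_flaw_def)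
    qed
    have "i \<le> p i" if "i < M" for i
      using that
    proof (induction i)
      case (Suc i)
      then show ?case using step[of i] by simp
    qed simp
    then have "p = id" by (intro permutes_natset_ge[OF p(1)]) auto
    then show False using p(2) by simp
  qed
  have "(\<Sum>p\<in>?P. sign p * (\<Sum>As\<in>?G p. g (col_word As))) =
      (\<Sum>p\<in>{id}. sign p * (\<Sum>As\<in>?G p. g (col_word As)))"
  proof (rule sum.mono_neutral_right[OF finP])
    show "{id} \<subseteq> ?P" by (auto simp: permutes_id)
    show "\<forall>p\<in>?P - {id}. sign p * (\<Sum>As\<in>?G p. g (col_word As)) = 0"
      using G0 by (metis (no_types, lifting) DiffE mem_Collect_eq mult_zero_right singletonI sum.empty)
  qed
  also have "\<dots> = (\<Sum>As\<in>{As\<in>columns M UNIV. \<not> has_flaw As \<and> (\<forall>i<M. length (As ! i) = c i)}. g (col_word As))"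
    by (simp add: sign_id has_lengths_def dotted_def)
  finally show ?thesis
    using F0 unfolding split by (simp add: distrib_left sum.distrib)
qed

end

section \<open>Pairing words with polynomials in the elementary functions\<close>

text \<open>A multiset of indices is a monomial in the \<open>e\<close>'s, and addition of multisets
  is multiplication of monomials. The index 0 does not occur in monomials built by
  \<open>esym\<close>, since \<open>e_0 = 1\<close>.\<close>

type_synonym epoly = "nat multiset \<Rightarrow>\<^sub>0 int"

definition esym :: "nat \<Rightarrow> epoly" where
  "esym k = (if k = 0 then 1 else Poly_Mapping.single {#k#} 1)"

definition esym_int :: "int \<Rightarrow> epoly" where
  "esym_int z = (if z < 0 then 0 else esym (nat z))"

text \<open>Solves the relation that the alternating sum of \<open>e_i h_(n-i)\<close> vanishes for
  positive \<open>n\<close>.\<close>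

fun hsym :: "nat \<Rightarrow> epoly" where
  "hsym 0 = 1"
| "hsym (Suc n) = (\<Sum>i\<le>n. (-1) ^ i * esym (Suc i) * hsym (n - i))"

text \<open>The dual Jacobi-Trudi determinant of the shape with column heights
  \<open>c\<close>.\<close>

definition ejt :: "nat \<Rightarrow> (nat \<Rightarrow> nat) \<Rightarrow> epoly" where
  "ejt M c = det (mat M M (\<lambda>(i, j). esym_int (int (c i) - int i + int j)))"

lemma prod_list_esym:
  "prod_list (map esym vs) = Poly_Mapping.single (mset (filter (\<lambda>v. v \<noteq> 0) vs)) 1"
  by (induction vs) (auto simp: esym_def mult_single)

section \<open>Products of elementary and complete functions on words\<close>

context free31_order
begin

abbreviation nodesc :: "'a list \<Rightarrow> bool" where
  "nodesc \<equiv> successively (\<lambda>x y. \<not> y \<prec> x)"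

text \<open>\<open>True\<close> marks a factor \<open>e\<^sub>k\<close>, \<open>False\<close> a factor \<open>h\<^sub>k\<close>.\<close>

definition block :: "bool \<times> nat \<Rightarrow> 'a list set" where
  "block b = {w. length w = snd b \<and> (if fst b then decr w else nodesc w)}"

primrec blocks_sum :: "(bool \<times> nat) list \<Rightarrow> ('a list \<Rightarrow> int) \<Rightarrow> int" where
  "blocks_sum [] g = g []"
| "blocks_sum (b # bs) g = (\<Sum>u\<in>block b. blocks_sum bs (\<lambda>w. g (u @ w)))"

lemma finite_words [simp]: "finite {w :: 'a list. length w = k}"
  using finite_lists_length_eq[OF fin, of k] by simp

lemma block_zero [simp]: "block (t, 0) = {[]}"
  by (auto simp: block_def)

lemma blocks_sum_append:
  "blocks_sum (as @ bs) g = blocks_sum as (\<lambda>u. blocks_sum bs (\<lambda>w. g (u @ w)))"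
  by (induction as arbitrary: g) auto

lemma invariant_blocks_sum:
  assumes "invariant g"
  shows "invariant (\<lambda>u. blocks_sum bs (\<lambda>w. g (u @ w)))"
proof -
  have "(\<lambda>w. g (u @ w)) = (\<lambda>w. g (u' @ w))" if "keq u u'" for u u'
    using assms keq_append_right[OF that] unfolding invariant_def by blast
  then show ?thesis unfolding invariant_def by metis
qed

lemma block_True: "block (True, k) = rev ` chains UNIV k"
proof -
  have "w \<in> rev ` chains UNIV k" if "w \<in> block (True, k)" for w
    using that by (intro image_eqI[of _ _ "rev w"]) (auto simp: block_def chains_def sorted_wrt_rev)
  then show ?thesis by (auto simp: block_def chains_def sorted_wrt_rev)
qed

lemma sum_block_True: "(\<Sum>u\<in>block (True, k). f u) = (\<Sum>x\<in>chains UNIV k. f (rev x))"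
  unfolding block_True by (simp add: sum.reindex)

lemma blocks_sum_swap:
  assumes "invariant g"
  shows "blocks_sum (pre @ (True, i) # (True, j) # bs) g = blocks_sum (pre @ (True, j) # (True, i) # bs) g"
  using assms
proof (induction pre arbitrary: g)
  case Nil
  have "(\<Sum>x\<in>chains UNIV i. \<Sum>y\<in>chains UNIV j. blocks_sum bs (\<lambda>w. g ((rev x @ rev y) @ w))) =
    (\<Sum>x\<in>chains UNIV j. \<Sum>y\<in>chains UNIV i. blocks_sum bs (\<lambda>w. g ((rev x @ rev y) @ w)))"
    using commuting[of "Suc (i + j)", unfolded commuting_def, rule_format,
        OF invariant_blocks_sum[OF Nil, of bs], of i j UNIV] by blast
  then show ?case by (simp add: sum_block_True)
next
  case (Cons b pre)
  have "invariant (\<lambda>w. g (u @ w))" for u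
    using invariant_context[OF Cons.prems, of u "[]"] by simp
  then show ?case using Cons.IH by simp
qed

lemma blocks_sum_move:
  "invariant g \<Longrightarrow> blocks_sum (pre @ (True, i) # map (Pair True) vs @ bs) g
    = blocks_sum (pre @ map (Pair True) vs @ (True, i) # bs) g"
proof (induction vs arbitrary: pre)
  case (Cons v vs)
  then show ?case
    using blocks_sum_swap[OF Cons.prems, of pre i v "map (Pair True) vs @ bs"]
      Cons.IH[OF Cons.prems, of "pre @ [(True, v)]"] by simp
qed simp

lemma blocks_sum_perm:
  assumes "invariant g" "mset vs = mset vs'"
  shows "blocks_sum (map (Pair True) vs @ bs) g = blocks_sum (map (Pair True) vs' @ bs) g"
  using assms
proof (induction vs arbitrary: vs' g)
  case (Cons v vs)
  have "v \<in> set vs'" using Cons.prems(2) by (metis list.set_intros(1) mset_eq_setD)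
  then obtain a b where vs': "vs' = a @ v # b" by (meson split_list)
  have inv: "invariant (\<lambda>w. g (u @ w))" for u
    using invariant_context[OF Cons.prems(1), of u "[]"] by simp
  have "blocks_sum (map (Pair True) (v # vs) @ bs) g = blocks_sum (map (Pair True) (v # a @ b) @ bs) g"
    using Cons.IH[OF inv, of "a @ b"] Cons.prems(2) vs' by simp
  also have "\<dots> = blocks_sum (map (Pair True) vs' @ bs) g"
    using blocks_sum_move[OF Cons.prems(1), of "[]" v a "map (Pair True) b @ bs"] vs' by simp
  finally show ?case .
qed simp

lemma blocks_sum_filter:
  "blocks_sum (map (Pair True) (filter (\<lambda>v. v \<noteq> 0) vs)) g = blocks_sum (map (Pair True) vs) g"
  by (induction vs arbitrary: g) auto

definition split_sign :: "'a list \<Rightarrow> nat \<Rightarrow> int" where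
  "split_sign u i = (if decr (take i u) \<and> nodesc (drop i u) then (-1) ^ i else 0)"

text \<open>A nonempty word has no admissible cut or two consecutive ones: the last letter of its
  decreasing initial run may go to either side.\<close>

lemma alternating_split:
  assumes "u \<noteq> []"
  shows "(\<Sum>i\<le>length u. split_sign u i) = 0"
  using assms
proof (induction u rule: induct_list012)
  case (2 x)
  then show ?case by (simp add: split_sign_def)
next
  case (3 x y v)
  have s: "(\<Sum>i\<le>length (x # y # v). split_sign (x # y # v) i) =
      split_sign (x # y # v) 0 + (\<Sum>i\<le>length (y # v). split_sign (x # y # v) (Suc i))"
    using sum.atMost_Suc_shift[of "split_sign (x # y # v)" "length (y # v)"] by (simp del: sum.atMost_Suc)
  show ?case
  proof (cases "y \<prec> x")
    case True
    have "split_sign (x # y # v) (Suc i) = - split_sign (y # v) i" for i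
    proof -
      have "decr (x # take i (y # v)) \<longleftrightarrow> decr (take i (y # v))"
        using True trans[of _ y x] by (cases i) (auto dest: in_set_takeD)
      then show ?thesis by (simp add: split_sign_def)
    qed
    then have "(\<Sum>i\<le>length (y # v). split_sign (x # y # v) (Suc i)) = 0"
      using 3 by (simp add: sum_negf del: sum.atMost_Suc)
    moreover have "split_sign (x # y # v) 0 = 0" using True by (simp add: split_sign_def)
    ultimately show ?thesis using s by simp
  next
    case False
    have z: "split_sign (x # y # v) (Suc (Suc i)) = 0" for i using False by (simp add: split_sign_def)
    have "(\<Sum>i\<le>length (y # v). split_sign (x # y # v) (Suc i)) = split_sign (x # y # v) (Suc 0)"
      using sum.atMost_Suc_shift[of "\<lambda>i. split_sign (x # y # v) (Suc i)" "length v"] z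
      by (simp del: sum.atMost_Suc)
    then show ?thesis using s False by (simp add: split_sign_def)
  qed
qed simp

text \<open>Collecting the terms by the concatenated word reduces this to
  \<open>alternating_split\<close>; a positive \<open>k\<close> excludes the empty word.\<close>

lemma blocks_sum_e_h:
  assumes "0 < k"
  shows "(\<Sum>i\<le>k. (-1) ^ i * blocks_sum (pre @ (True, i) # (False, k - i) # bs) g) = 0"
proof (induction pre arbitrary: g)
  case Nil
  let ?f = "\<lambda>u. blocks_sum bs (\<lambda>w. g (u @ w))"
  let ?W = "{w :: 'a list. length w = k}"
  have "(\<Sum>x\<in>block (True, i). \<Sum>y\<in>block (False, k - i). ?f (x @ y)) =
      (\<Sum>u\<in>?W. (-1) ^ i * split_sign u i * ?f u)" if i: "i \<le> k" for i
  proof -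
    have "(\<Sum>x\<in>block (True, i). \<Sum>y\<in>block (False, k - i). ?f (x @ y)) =
        (\<Sum>(x, y)\<in>block (True, i) \<times> block (False, k - i). ?f (x @ y))"
      by (simp add: sum.cartesian_product)
    also have "\<dots> = (\<Sum>u\<in>{u\<in>?W. decr (take i u) \<and> nodesc (drop i u)}. ?f u)"
      by (rule sum.reindex_bij_witness[of _ "\<lambda>u. (take i u, drop i u)" "\<lambda>(x, y). x @ y"])
        (use i in \<open>auto simp: block_def\<close>)
    also have "\<dots> = (\<Sum>u\<in>?W. (-1) ^ i * split_sign u i * ?f u)"
      by (rule sum.mono_neutral_cong_left) (auto simp: split_sign_def simp flip: power_add mult_2)
    finally show ?thesis .
  qed
  then have "(\<Sum>i\<le>k. (-1) ^ i * blocks_sum ((True, i) # (False, k - i) # bs) g) =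
      (\<Sum>i\<le>k. \<Sum>u\<in>?W. split_sign u i * ?f u)"
    by (intro sum.cong) (auto simp: sum_distrib_left mult.assoc[symmetric] simp flip: power_add mult_2)
  also have "\<dots> = (\<Sum>u\<in>?W. (\<Sum>i\<le>k. split_sign u i) * ?f u)"
    by (subst sum.swap) (simp add: sum_distrib_right)
  also have "\<dots> = 0"
  proof (rule sum.neutral, rule ballI)
    fix u :: "'a list" assume "u \<in> ?W"
    then have "(\<Sum>i\<le>k. split_sign u i) = 0"
      using alternating_split[of u] assms by auto
    then show "(\<Sum>i\<le>k. split_sign u i) * ?f u = 0" by simp
  qed
  finally show ?case by simp
next
  case (Cons b pre)
  have "(\<Sum>i\<le>k. (-1) ^ i * blocks_sum ((b # pre) @ (True, i) # (False, k - i) # bs) g) =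
      (\<Sum>u\<in>block b. \<Sum>i\<le>k. (-1) ^ i * blocks_sum (pre @ (True, i) # (False, k - i) # bs) (\<lambda>w. g (u @ w)))"
    by (subst sum.swap) (simp add: sum_distrib_left)
  then show ?case using Cons.IH by simp
qed

text \<open>Linear extension of the pairing from monomials to polynomials. Sorting fixes an order of
  the factors; it is immaterial for invariant \<open>g\<close> by
  \<open>blocks_sum_perm\<close>.\<close>

definition ev :: "('a list \<Rightarrow> int) \<Rightarrow> epoly \<Rightarrow> int" where
  "ev g p = (\<Sum>\<mu>\<in>Poly_Mapping.keys p.
     Poly_Mapping.lookup p \<mu> * blocks_sum (map (Pair True) (sorted_list_of_multiset \<mu>)) g)"

lemma ev_superset:
  assumes "finite A" "Poly_Mapping.keys p \<subseteq> A"
  shows "ev g p = (\<Sum>\<mu>\<in>A. Poly_Mapping.lookup p \<mu> * blocks_sum (map (Pair True) (sorted_list_of_multiset \<mu>)) g)"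
  unfolding ev_def by (rule sum.mono_neutral_left) (use assms in \<open>auto simp: in_keys_iff\<close>)

lemma ev_add: "ev g (p + q) = ev g p + ev g q"
proof -
  let ?A = "Poly_Mapping.keys p \<union> Poly_Mapping.keys q"
  have "Poly_Mapping.keys (p + q) \<subseteq> ?A" by (rule Poly_Mapping.keys_add)
  then show ?thesis
    using ev_superset[of ?A "p + q"] ev_superset[of ?A p] ev_superset[of ?A q]
    by (simp add: lookup_add distrib_right sum.distrib)
qed

lemma ev_0 [simp]: "ev g 0 = 0"
  by (simp add: ev_def)

lemma ev_uminus: "ev g (- p) = - ev g p"
  using ev_add[of g p "- p"] by simp

lemma ev_sum: "ev g (\<Sum>x\<in>A. f x) = (\<Sum>x\<in>A. ev g (f x))"
  by (induction A rule: infinite_finite_induct) (auto simp: ev_add)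

lemma ev_power_minus1: "ev g ((-1) ^ i * p) = (-1) ^ i * ev g p"
  by (induction i) (auto simp: ev_uminus)

lemma ev_prod_esym:
  assumes "invariant g"
  shows "ev g (prod_list (map esym vs)) = blocks_sum (map (Pair True) vs) g"
proof -
  let ?l = "filter (\<lambda>v. v \<noteq> 0) vs"
  have "ev g (prod_list (map esym vs)) = blocks_sum (map (Pair True) (sorted_list_of_multiset (mset ?l))) g"
    unfolding prod_list_esym by (simp add: ev_def)
  also have "\<dots> = blocks_sum (map (Pair True) ?l) g"
    using blocks_sum_perm[OF assms, of "sorted_list_of_multiset (mset ?l)" ?l "[]"] by simp
  finally show ?thesis unfolding blocks_sum_filter .
qed

text \<open>The leading complete factor satisfies the same recursion on both sides, by definition of
  \<open>hsym\<close> and by \<open>blocks_sum_e_h\<close>. Each expansion adds an elementary factor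
  directly before it, so \<open>vs\<close> varies in the induction.\<close>

lemma ev_prod_esym_hsym:
  assumes "invariant g"
  shows "ev g (prod_list (map esym vs) * prod_list (map hsym ks)) =
    blocks_sum (map (Pair True) vs @ map (Pair False) ks) g"
proof (induction ks arbitrary: vs)
  case Nil
  then show ?case by (simp add: ev_prod_esym[OF assms])
next
  case (Cons k ks)
  show ?case
  proof (induction k arbitrary: vs rule: less_induct)
    case (less k)
    show ?case
    proof (cases k)
      case 0
      then show ?thesis using Cons.IH by (simp add: blocks_sum_append)
    next
      case (Suc n)
      let ?pre = "map (Pair True) vs" and ?post = "map (Pair False) ks"
      have "prod_list (map esym vs) * prod_list (map hsym (k # ks)) =
          (\<Sum>i\<le>n. (-1) ^ i * (prod_list (map esym (vs @ [Suc i])) * prod_list (map hsym ((n - i) # ks))))"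
        unfolding Suc by (simp add: sum_distrib_left sum_distrib_right mult_ac)
      then have "ev g (prod_list (map esym vs) * prod_list (map hsym (k # ks))) =
          (\<Sum>i\<le>n. (-1) ^ i * ev g (prod_list (map esym (vs @ [Suc i])) * prod_list (map hsym ((n - i) # ks))))"
        by (simp only: ev_sum ev_power_minus1)
      also have "\<dots> = (\<Sum>i\<le>n. (-1) ^ i * blocks_sum (?pre @ (True, Suc i) # (False, n - i) # ?post) g)"
      proof (rule sum.cong[OF refl])
        fix i
        have "n - i < k" using Suc by simp
        from less.IH[OF this, of "vs @ [Suc i]"]
        show "(-1) ^ i * ev g (prod_list (map esym (vs @ [Suc i])) * prod_list (map hsym ((n - i) # ks))) =
            (-1) ^ i * blocks_sum (?pre @ (True, Suc i) # (False, n - i) # ?post) g" by simp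
      qed
      also have "\<dots> = blocks_sum (?pre @ (False, k) # ?post) g"
      proof -
        have "blocks_sum (?pre @ (True, 0) # (False, k) # ?post) g +
            (\<Sum>i\<le>n. (-1) ^ Suc i * blocks_sum (?pre @ (True, Suc i) # (False, n - i) # ?post) g) = 0"
          using blocks_sum_e_h[of k ?pre ?post g] unfolding Suc sum.atMost_Suc_shift by simp
        moreover have "blocks_sum (?pre @ (True, 0) # (False, k) # ?post) g = blocks_sum (?pre @ (False, k) # ?post) g"
          by (simp add: blocks_sum_append)
        ultimately show ?thesis by (simp add: sum_negf)
      qed
      finally show ?thesis by simp
    qed
  qed
qed

lemma blocks_sum_columns:
  "blocks_sum (map (Pair True) ls) g =
    (\<Sum>As\<in>{As\<in>columns (length ls) UNIV. \<forall>i<length ls. length (As ! i) = ls ! i}. g (col_word As))"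
proof (induction ls arbitrary: g)
  case Nil
  have "{As\<in>columns 0 UNIV. \<forall>i<0. length (As ! i) = [] ! i} = {[]}"
    by (auto simp: columns_def)
  then show ?case by (simp add: col_word_def)
next
  case (Cons l ls)
  let ?C = "\<lambda>ls. {As\<in>columns (length ls) UNIV. \<forall>i<length ls. length (As ! i) = ls ! i}"
  have "blocks_sum (map (Pair True) (l # ls)) g =
      (\<Sum>x\<in>chains UNIV l. \<Sum>As\<in>?C ls. g (rev x @ col_word As))"
    by (simp add: sum_block_True Cons.IH)
  also have "\<dots> = (\<Sum>(x, As)\<in>chains UNIV l \<times> ?C ls. g (rev x @ col_word As))"
    by (simp add: sum.cartesian_product)
  also have "\<dots> = (\<Sum>As\<in>?C (l # ls). g (col_word As))"
  proof (rule sum.reindex_bij_witness[of _ "\<lambda>As. (hd As, tl As)" "\<lambda>(x, As). x # As"])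
    fix As assume A: "As \<in> ?C (l # ls)"
    then obtain x As' where As: "As = x # As'" by (cases As) (auto simp: columns_def)
    have "length x = l" "\<forall>i<length ls. length (As' ! i) = ls ! i"
      using A unfolding As by (auto dest: spec[of _ "Suc _"])
    then show "(hd As, tl As) \<in> chains UNIV l \<times> ?C ls"
      using A unfolding As by (auto simp: columns_def chains_def)
    show "(case (hd As, tl As) of (x, As) \<Rightarrow> x # As) = As" by (simp add: As)
  qed (auto simp: columns_def chains_def col_word_def nth_Cons split: nat.splits)
  finally show ?case .
qed

text \<open>Expanding the determinant and pairing each product with \<open>g\<close> gives a signed
  sum over column arrays, to which \<open>alternating_sum_columns\<close> applies. A product with a
  negative index is zero, and no array has its lengths.\<close>

lemma ev_ejt:
  assumes g: "invariant g" and c: "\<And>i. Suc i < M \<Longrightarrow> c (Suc i) \<le> c i"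
  shows "ev g (ejt M c) =
    (\<Sum>As\<in>{As\<in>columns M UNIV. \<not> has_flaw As \<and> (\<forall>i<M. length (As ! i) = c i)}. g (col_word As))"
proof -
  let ?A = "mat M M (\<lambda>(i, j). esym_int (int (c i) - int i + int j))"
  have t: "ev g (\<Prod>j<M. esym_int (dotted c p j)) =
      (\<Sum>As\<in>{As\<in>columns M UNIV. has_lengths M (dotted c p) As}. g (col_word As))" for p
  proof (cases "\<exists>j<M. dotted c p j < 0")
    case True
    then obtain j where j: "j < M" "dotted c p j < 0" by blast
    then have "(\<Prod>j<M. esym_int (dotted c p j)) = 0"
      by (intro prod_zero) (auto simp: esym_int_def intro!: bexI[of _ j])
    moreover have "\<not> has_lengths M (dotted c p) As" for As
      using j unfolding has_lengths_def by (metis not_less of_nat_0_le_iff)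
    ultimately show ?thesis by simp
  next
    case False
    let ?l = "map (\<lambda>j. nat (dotted c p j)) [0..<M]"
    have "(\<Prod>j<M. esym_int (dotted c p j)) = (\<Prod>j<M. esym (nat (dotted c p j)))"
      by (rule prod.cong) (use False in \<open>auto simp: esym_int_def\<close>)
    also have "\<dots> = prod_list (map esym ?l)"
      by (simp add: prod.list_conv_set_nth atLeast0LessThan)
    finally have "ev g (\<Prod>j<M. esym_int (dotted c p j)) = blocks_sum (map (Pair True) ?l) g"
      by (simp only: ev_prod_esym[OF g])
    also have "\<dots> = (\<Sum>As\<in>{As\<in>columns M UNIV. has_lengths M (dotted c p) As}. g (col_word As))"
    proof -
      have "has_lengths M (dotted c p) As \<longleftrightarrow> (\<forall>i<M. length (As ! i) = ?l ! i)" for As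
      proof -
        have "0 \<le> dotted c p i" if "i < M" for i using False that by (metis not_less)
        then show ?thesis unfolding has_lengths_def by (auto simp: eq_nat_nat_iff)
      qed
      then show ?thesis unfolding blocks_sum_columns by simp
    qed
    finally show ?thesis .
  qed
  have "ejt M c = (\<Sum>p | p permutes {0..<M}. signof p * (\<Prod>j<M. ?A $$ (p j, j)))"
    unfolding ejt_def by (rule det_col) simp
  also have "\<dots> = (\<Sum>p | p permutes {0..<M}. signof p * (\<Prod>j<M. esym_int (dotted c p j)))"
    by (intro sum.cong refl arg_cong2[of _ _ _ _ times] prod.cong)
      (auto simp: dotted_def permutes_in_image)
  finally have e: "ejt M c = (\<Sum>p | p permutes {0..<M}. signof p * (\<Prod>j<M. esym_int (dotted c p j)))" .
  have "ev g (signof p * q) = sign p * ev g q" for p :: "nat \<Rightarrow> nat" and q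
    by (auto simp: sign_def ev_uminus)
  then have "ev g (ejt M c) = (\<Sum>p | p permutes {0..<M}. sign p * ev g (\<Prod>j<M. esym_int (dotted c p j)))"
    unfolding e ev_sum by simp
  then show ?thesis using alternating_sum_columns[where M = M and c = c, OF g c] unfolding t by (simp only:)
qed

end

section \<open>The Pieri rule\<close>

lemma mat_delete_mat:
  assumes "i < Suc n" "j < Suc n"
  shows "mat_delete (mat (Suc n) (Suc n) f) i j =
    mat n n (\<lambda>(a, b). f (if a < i then a else Suc a, if b < j then b else Suc b))"
  unfolding mat_delete_def by (rule eq_matI) (use assms in auto)

text \<open>Laplace expansion along the first column: only the first \<open>Suc n\<close> rows
  contribute, and each of their minors is again block triangular with the same lower right
  block.\<close>

lemma det_block_lower_left_zero:
  fixes f :: "nat \<times> nat \<Rightarrow> 'b :: comm_ring_1"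
  assumes "\<And>i j. n \<le> i \<Longrightarrow> i < n + m \<Longrightarrow> j < n \<Longrightarrow> f (i, j) = 0"
  shows "det (mat (n + m) (n + m) f) = det (mat n n f) * det (mat m m (\<lambda>(i, j). f (n + i, n + j)))"
  using assms
proof (induction n arbitrary: f)
  case 0
  have "mat m m f = mat m m (\<lambda>(i, j). f (i, j))" by (rule eq_matI) auto
  then show ?case by (simp add: det_dim_zero[OF mat_carrier])
next
  case (Suc n)
  define g where "g i = (\<lambda>(a, b). f (if a < i then a else Suc a, Suc b))" for i
  let ?A = "mat (Suc (n + m)) (Suc (n + m)) f" and ?B = "mat (Suc n) (Suc n) f"
  let ?D = "det (mat m m (\<lambda>(i, j). f (Suc n + i, Suc n + j)))"
  have dA: "mat_delete ?A i 0 = mat (n + m) (n + m) (g i)" if "i < Suc n" for i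
    by (subst mat_delete_mat) (use that in \<open>auto simp: g_def intro!: eq_matI\<close>)
  have dB: "mat_delete ?B i 0 = mat n n (g i)" if "i < Suc n" for i
    by (subst mat_delete_mat) (use that in \<open>auto simp: g_def intro!: eq_matI\<close>)
  have IH: "det (mat (n + m) (n + m) (g i)) = det (mat n n (g i)) * ?D" if i: "i < Suc n" for i
  proof -
    have "det (mat (n + m) (n + m) (g i)) =
        det (mat n n (g i)) * det (mat m m (\<lambda>(a, b). g i (n + a, n + b)))"
      by (rule Suc.IH) (use i Suc.prems in \<open>auto simp: g_def\<close>)
    also have "mat m m (\<lambda>(a, b). g i (n + a, n + b)) = mat m m (\<lambda>(i, j). f (Suc n + i, Suc n + j))"
      by (rule eq_matI) (use i in \<open>auto simp: g_def\<close>)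
    finally show ?thesis .
  qed
  have "det ?A = (\<Sum>i<Suc (n + m). ?A $$ (i, 0) * cofactor ?A i 0)"
    by (rule laplace_expansion_column) auto
  also have "\<dots> = (\<Sum>i<Suc n. ?A $$ (i, 0) * cofactor ?A i 0)"
    by (rule sum.mono_neutral_right) (use Suc.prems in auto)
  also have "\<dots> = (\<Sum>i<Suc n. ?B $$ (i, 0) * cofactor ?B i 0 * ?D)"
    by (rule sum.cong[OF refl]) (simp add: cofactor_def dA dB IH mult.assoc del: sum.lessThan_Suc)
  also have "\<dots> = det ?B * ?D"
    by (subst laplace_expansion_column[of ?B "Suc n" 0]) (auto simp: sum_distrib_right simp del: sum.lessThan_Suc)
  finally show ?case by simp
qed

section \<open>Complete functions as determinants, and raising columns\<close>

lemma esym_int_simps [simp]: "z < 0 \<Longrightarrow> esym_int z = 0" "esym_int 0 = 1" "esym 0 = 1"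
  by (auto simp: esym_int_def esym_def)

definition hdet :: "nat \<Rightarrow> epoly" where
  "hdet k = det (mat k k (\<lambda>(i, j). esym_int (int j - int i + 1)))"

text \<open>For positive \<open>s\<close> and \<open>k\<close> this is \<open>ejt\<close> of the
  hook with first column \<open>s\<close> and \<open>k - 1\<close> further columns of height 1.
  Varying \<open>s\<close> closes the family under expansion along the first column.\<close>

definition hook_det :: "nat \<Rightarrow> nat \<Rightarrow> epoly" where
  "hook_det s k = det (mat k k (\<lambda>(i, j). if i = 0 then esym (s + j) else esym_int (int j - int i + 1)))"

lemma hook_det_Suc_Suc: "hook_det s (Suc (Suc k)) = esym s * hdet (Suc k) - hook_det (Suc s) (Suc k)"
proof -
  let ?A = "mat (Suc (Suc k)) (Suc (Suc k))
    (\<lambda>(i, j). if i = 0 then esym (s + j) else esym_int (int j - int i + 1))"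
  have "hook_det s (Suc (Suc k)) = (\<Sum>i<Suc (Suc k). ?A $$ (i, 0) * cofactor ?A i 0)"
    unfolding hook_det_def by (rule laplace_expansion_column) auto
  \<comment> \<open>Below row 1 the first column vanishes, and its entry in row 1 is
    \<open>e_0 = 1\<close>.\<close>
  also have "\<dots> = (\<Sum>i\<in>{0, 1}. ?A $$ (i, 0) * cofactor ?A i 0)"
    by (rule sum.mono_neutral_right) auto
  also have "\<dots> = esym s * det (mat_delete ?A 0 0) - det (mat_delete ?A 1 0)"
    by (simp add: cofactor_def)
  also have "mat_delete ?A 0 0 = mat (Suc k) (Suc k) (\<lambda>(i, j). esym_int (int j - int i + 1))"
    by (subst mat_delete_mat) (auto intro!: eq_matI arg_cong[of _ _ esym_int])
  also have "mat_delete ?A 1 0 = mat (Suc k) (Suc k)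
      (\<lambda>(i, j). if i = 0 then esym (Suc s + j) else esym_int (int j - int i + 1))"
    by (subst mat_delete_mat) (auto intro!: eq_matI arg_cong[of _ _ esym_int])
  finally show ?thesis unfolding hdet_def hook_det_def .
qed

lemma hook_det_expand: "hook_det s (Suc n) = (\<Sum>i\<le>n. (-1) ^ i * esym (s + i) * hdet (n - i))"
proof (induction n arbitrary: s)
  case 0
  show ?case by (simp add: hook_det_def hdet_def det_single det_dim_zero[OF mat_carrier])
next
  case (Suc n)
  show ?case
    unfolding hook_det_Suc_Suc Suc.IH sum.atMost_Suc_shift by (simp add: sum_negf)
qed

lemma hsym_eq_hdet: "hsym k = hdet k"
proof (induction k rule: hsym.induct)
  case 1
  show ?case by (simp add: hdet_def det_dim_zero[OF mat_carrier])
next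
  case (2 n)
  have "hdet (Suc n) = hook_det 1 (Suc n)"
    unfolding hdet_def hook_det_def
    by (intro arg_cong[of _ _ det] eq_matI) (auto simp: esym_int_def nat_add_distrib)
  then show ?case using 2 by (simp add: hook_det_expand)
qed

text \<open>Rows \<open>i\<close> and \<open>Suc i\<close> coincide. This discards the non-shapes in
  the Pieri rule.\<close>

lemma ejt_eq_0:
  assumes "Suc i < M" "c (Suc i) = Suc (c i)"
  shows "ejt M c = 0"
  unfolding ejt_def
  by (rule det_identical_rows[of _ M i "Suc i"]) (use assms in \<open>auto intro!: eq_vecI\<close>)

text \<open>Empty columns contribute a unitriangular lower right block with zeros to its
  left.\<close>

lemma ejt_truncate:
  assumes c: "\<And>i. N \<le> i \<Longrightarrow> c i = 0" and M: "M = N + k"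
  shows "ejt M c = ejt N c"
proof -
  let ?f = "\<lambda>(i, j). esym_int (int (c i) - int i + int j)"
  let ?U = "mat k k (\<lambda>(i, j). ?f (N + i, N + j))"
  have "det ?U = prod_list (diag_mat ?U)"
    by (rule det_upper_triangular) (use c in auto)
  also have "diag_mat ?U = map (\<lambda>_. 1) [0..<k]"
    unfolding diag_mat_def by (rule map_cong) (use c in auto)
  finally have "det ?U = 1" by (simp add: map_replicate_const)
  moreover have "det (mat (N + k) (N + k) ?f) = det (mat N N ?f) * det ?U"
    by (rule det_block_lower_left_zero) (use c in auto)
  ultimately show ?thesis unfolding ejt_def M by simp
qed

lemma upper_closed_subset:
  assumes "\<delta> \<subseteq> {0..<M}" "card \<delta> = k" "\<And>j. j \<in> \<delta> \<Longrightarrow> Suc j < M \<Longrightarrow> Suc j \<in> \<delta>"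
  shows "\<delta> = {M - k..<M}"
proof (cases "\<delta> = {}")
  case True
  then show ?thesis using assms(2) by simp
next
  case False
  have fin: "finite \<delta>" using assms(1) finite_subset by blast
  let ?a = "Min \<delta>"
  have a: "?a \<in> \<delta>" using fin False by (rule Min_in)
  have "j \<in> \<delta>" if "?a \<le> j" "j < M" for j
    using that
  proof (induction j)
    case 0
    then show ?case using a by simp
  next
    case (Suc j)
    then show ?case using a assms(3)[of j] by (cases "?a = Suc j") auto
  qed
  moreover have "?a \<le> j \<and> j < M" if "j \<in> \<delta>" for j
    using that fin assms(1) by auto
  ultimately have "\<delta> = {?a..<M}" by auto
  then show ?thesis using assms(2) a assms(1) by (metis atLeastLessThan_iff card_atLeastLessThan diff_diff_cancel less_imp_le subset_iff)
qed

text \<open>Raising a set of rows by one and raising a set of columns by one give the same total. In the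
  second sum two columns coincide unless the raised columns are the last ones.\<close>

lemma pieri:
  assumes c: "\<And>i. m \<le> i \<Longrightarrow> c i = 0" and mk: "m + k \<le> M"
  shows "(\<Sum>\<epsilon>\<in>{\<epsilon>. \<epsilon> \<subseteq> {0..<M} \<and> card \<epsilon> = k}. ejt M (\<lambda>i. c i + of_bool (i \<in> \<epsilon>))) = ejt M c * hsym k"
proof -
  let ?S = "{\<epsilon>. \<epsilon> \<subseteq> {0..<M} \<and> card \<epsilon> = k}"
  let ?P = "{p. p permutes {0..<M}}"
  define F where "F i j b = esym_int (int (c i) + of_bool b - int i + int j)" for i j b
  have row: "ejt M (\<lambda>i. c i + of_bool (i \<in> \<epsilon>)) =
      (\<Sum>p\<in>?P. signof p * (\<Prod>i = 0..<M. F i (p i) (i \<in> \<epsilon>)))" for \<epsilon>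
    unfolding ejt_def F_def
    by (subst det_def'[of _ M]) (auto intro!: sum.cong prod.cong arg_cong2[of _ _ _ _ times] simp: permutes_in_image)
  have col: "det (mat M M (\<lambda>(i, j). F i j (j \<in> \<delta>))) =
      (\<Sum>p\<in>?P. signof p * (\<Prod>i = 0..<M. F i (p i) (p i \<in> \<delta>)))" for \<delta>
    by (subst det_def'[of _ M]) (auto intro!: sum.cong prod.cong arg_cong2[of _ _ _ _ times] simp: permutes_in_image)
  have reindex: "(\<Sum>\<epsilon>\<in>?S. \<Prod>i = 0..<M. F i (p i) (i \<in> \<epsilon>)) = (\<Sum>\<delta>\<in>?S. \<Prod>i = 0..<M. F i (p i) (p i \<in> \<delta>))"
    if p: "p permutes {0..<M}" for p
  proof (rule sum.reindex_bij_witness[of _ "\<lambda>\<delta>. Hilbert_Choice.inv p ` \<delta>" "\<lambda>\<epsilon>. p ` \<epsilon>"])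
    have inj: "inj p" "inj (Hilbert_Choice.inv p)" using permutes_inj[OF p] permutes_inj[OF permutes_inv[OF p]] by auto
    have im: "p ` {0..<M} = {0..<M}" "Hilbert_Choice.inv p ` {0..<M} = {0..<M}"
      using permutes_image[OF p] permutes_image[OF permutes_inv[OF p]] by auto
    fix \<epsilon> assume e: "\<epsilon> \<in> ?S"
    show "Hilbert_Choice.inv p ` p ` \<epsilon> = \<epsilon>" "p ` Hilbert_Choice.inv p ` \<epsilon> = \<epsilon>"
      using permutes_inverses[OF p] by (auto simp: image_image)
    show "p ` \<epsilon> \<in> ?S" "Hilbert_Choice.inv p ` \<epsilon> \<in> ?S"
    proof -
      have "p ` \<epsilon> \<subseteq> p ` {0..<M}" "Hilbert_Choice.inv p ` \<epsilon> \<subseteq> Hilbert_Choice.inv p ` {0..<M}"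
        using e by blast+
      moreover have "card (p ` \<epsilon>) = card \<epsilon>" "card (Hilbert_Choice.inv p ` \<epsilon>) = card \<epsilon>"
        using inj by (auto intro!: card_image inj_on_subset[OF _ subset_UNIV])
      ultimately show "p ` \<epsilon> \<in> ?S" "Hilbert_Choice.inv p ` \<epsilon> \<in> ?S"
        using e unfolding im by auto
    qed
    show "(\<Prod>i = 0..<M. F i (p i) (p i \<in> p ` \<epsilon>)) = (\<Prod>i = 0..<M. F i (p i) (i \<in> \<epsilon>))"
      using inj by (simp add: inj_image_mem_iff)
  qed
  have "(\<Sum>\<epsilon>\<in>?S. ejt M (\<lambda>i. c i + of_bool (i \<in> \<epsilon>))) =
      (\<Sum>p\<in>?P. signof p * (\<Sum>\<epsilon>\<in>?S. \<Prod>i = 0..<M. F i (p i) (i \<in> \<epsilon>)))"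
    unfolding row sum_distrib_left by (rule sum.swap)
  also have "\<dots> = (\<Sum>p\<in>?P. signof p * (\<Sum>\<delta>\<in>?S. \<Prod>i = 0..<M. F i (p i) (p i \<in> \<delta>)))"
    by (rule sum.cong[OF refl]) (simp add: reindex)
  also have "\<dots> = (\<Sum>\<delta>\<in>?S. det (mat M M (\<lambda>(i, j). F i j (j \<in> \<delta>))))"
    unfolding col sum_distrib_left by (rule sum.swap)
  also have "\<dots> = (\<Sum>\<delta>\<in>{{M - k..<M}}. det (mat M M (\<lambda>(i, j). F i j (j \<in> \<delta>))))"
  proof (rule sum.mono_neutral_right)
    show "{{M - k..<M}} \<subseteq> ?S" using mk by auto
    show "\<forall>\<delta>\<in>?S - {{M - k..<M}}. det (mat M M (\<lambda>(i, j). F i j (j \<in> \<delta>))) = 0"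
    proof
      fix \<delta> assume d: "\<delta> \<in> ?S - {{M - k..<M}}"
      then obtain j where j: "j \<in> \<delta>" "Suc j < M" "Suc j \<notin> \<delta>"
        using upper_closed_subset[of \<delta> M k] by auto
      show "det (mat M M (\<lambda>(i, j). F i j (j \<in> \<delta>))) = 0"
        by (rule det_identical_columns[of _ M j "Suc j"]) (use j in \<open>auto simp: F_def intro!: eq_vecI arg_cong[of _ _ esym_int]\<close>)
    qed
  qed simp
  also have "\<dots> = det (mat M M (\<lambda>(i, j). F i j (M - k \<le> j)))"
    by (auto intro!: arg_cong[of _ _ det] eq_matI)
  \<comment> \<open>By \<open>mk\<close> the last \<open>k\<close> rows have \<open>c i = 0\<close>.
    Their entries before column \<open>M - k\<close> have negative index, and the corner is the
    determinant for \<open>h_k\<close>.\<close>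
  also have "\<dots> = det (mat (M - k) (M - k) (\<lambda>(i, j). F i j (M - k \<le> j))) *
      det (mat k k (\<lambda>(i, j). F (M - k + i) (M - k + j) True))"
  proof -
    define N where "N = M - k"
    have N: "M = N + k" "m \<le> N" using mk by (auto simp: N_def)
    have "det (mat (N + k) (N + k) (\<lambda>(i, j). F i j (N \<le> j))) =
      det (mat N N (\<lambda>(i, j). F i j (N \<le> j))) *
      det (mat k k (\<lambda>(i, j). (\<lambda>(i, j). F i j (N \<le> j)) (N + i, N + j)))"
      by (rule det_block_lower_left_zero) (use N c in \<open>auto simp: F_def\<close>)
    then show ?thesis unfolding N_def[symmetric] N(1)[symmetric] by simp
  qed
  also have "mat (M - k) (M - k) (\<lambda>(i, j). F i j (M - k \<le> j)) =
      mat (M - k) (M - k) (\<lambda>(i, j). esym_int (int (c i) - int i + int j))"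
    by (rule eq_matI) (auto simp: F_def)
  also have "mat k k (\<lambda>(i, j). F (M - k + i) (M - k + j) True) =
      mat k k (\<lambda>(i, j). esym_int (int j - int i + 1))"
    by (rule eq_matI) (use c mk in \<open>auto simp: F_def algebra_simps\<close>)
  also have "det (mat (M - k) (M - k) (\<lambda>(i, j). esym_int (int (c i) - int i + int j))) = ejt M c"
    using ejt_truncate[of "M - k" c M k] c mk unfolding ejt_def by simp
  also have "det (mat k k (\<lambda>(i, j). esym_int (int j - int i + 1))) = hsym k"
    unfolding hsym_eq_hdet hdet_def ..
  finally show ?thesis .
qed

section \<open>Semistandard fillings\<close>

text \<open>Shapes are given by their column heights.\<close>

definition cells :: "(nat \<Rightarrow> nat) \<Rightarrow> (nat \<times> nat) set" where
  "cells c = {(r, j). r < c j}"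

definition shapes :: "nat \<Rightarrow> nat \<Rightarrow> (nat \<Rightarrow> nat) set" where
  "shapes M a = {c. (\<forall>i. c (Suc i) \<le> c i) \<and> (\<forall>i\<ge>M. c i = 0) \<and> (\<Sum>i<M. c i) = a}"

definition fillings :: "(nat \<Rightarrow> nat) \<Rightarrow> (nat \<Rightarrow> nat) \<Rightarrow> (nat \<times> nat \<Rightarrow> nat) set" where
  "fillings c \<alpha> = {T \<in> extensional (cells c).
     (\<forall>r j. (r, Suc j) \<in> cells c \<longrightarrow> T (r, j) \<le> T (r, Suc j)) \<and>
     (\<forall>r j. (Suc r, j) \<in> cells c \<longrightarrow> T (r, j) < T (Suc r, j)) \<and>
     (\<forall>k. card {x \<in> cells c. T x = k} = \<alpha> k)}"

definition below :: "nat \<Rightarrow> (nat \<Rightarrow> nat) \<Rightarrow> nat \<Rightarrow> nat" where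
  "below B \<alpha> k = (if k < B then \<alpha> k else 0)"

text \<open>A horizontal strip in terms of column heights: at most one new cell in each
  column.\<close>

definition strip :: "(nat \<Rightarrow> nat) \<Rightarrow> (nat \<Rightarrow> nat) \<Rightarrow> bool" where
  "strip c d \<longleftrightarrow> (\<forall>i. c i \<le> d i \<and> d i \<le> Suc (c i))"

lemma cells_Sigma:
  assumes "\<And>i. M \<le> i \<Longrightarrow> c i = 0"
  shows "cells c = (\<lambda>(j, r). (r, j)) ` (SIGMA j:{..<M}. {..<c j})"
proof (intro equalityI subsetI)
  fix x assume x: "x \<in> cells c"
  obtain r j where rj: "x = (r, j)" by (cases x)
  have "r < c j" using x rj by (simp add: cells_def)
  moreover have "j < M" using calculation assms[of j] by (cases "M \<le> j") auto
  ultimately show "x \<in> (\<lambda>(j, r). (r, j)) ` (SIGMA j:{..<M}. {..<c j})"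
    unfolding rj by (intro image_eqI[of _ _ "(j, r)"]) auto
qed (auto simp: cells_def)

lemma finite_cells: "c \<in> shapes M a \<Longrightarrow> finite (cells c)"
  by (subst cells_Sigma[of M]) (auto simp: shapes_def)

lemma card_cells: "c \<in> shapes M a \<Longrightarrow> card (cells c) = a"
  by (subst cells_Sigma[of M]) (auto simp: shapes_def card_image inj_on_def)

lemma shape_antimono:
  assumes "c \<in> shapes M a" "i \<le> j"
  shows "c j \<le> c i"
  using assms(2)
proof (induction rule: dec_induct)
  case (step n)
  have "c (Suc n) \<le> c n" using assms(1) by (simp add: shapes_def)
  then show ?case using step.IH by simp
qed simp

lemma shape_zero:
  assumes "c \<in> shapes M a" "a \<le> i"
  shows "c i = 0"
proof (rule ccontr)
  assume n: "c i \<noteq> 0"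
  then have "1 \<le> c j" if "j \<le> i" for j
    using shape_antimono[OF assms(1) that] by simp
  then have "(\<Sum>j<Suc i. 1) \<le> (\<Sum>j<Suc i. c j)" by (intro sum_mono) auto
  moreover have "i < M" using n assms(1) by (cases "M \<le> i") (auto simp: shapes_def)
  then have "(\<Sum>j<Suc i. c j) \<le> (\<Sum>j<M. c j)" by (intro sum_mono2) auto
  ultimately show False using assms by (simp add: shapes_def)
qed

lemma finite_shapes: "finite (shapes M a)"
proof (rule finite_subset)
  show "shapes M a \<subseteq> (\<lambda>l i. if i < M then l ! i else 0) ` {l. set l \<subseteq> {..a} \<and> length l = M}"
  proof
    fix c assume c: "c \<in> shapes M a"
    have "c i \<le> a" if "i < M" for i
      using c that member_le_sum[of i "{..<M}" c] by (auto simp: shapes_def)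
    moreover have "c = (\<lambda>i. if i < M then map c [0..<M] ! i else 0)"
      using c by (auto simp: shapes_def fun_eq_iff)
    ultimately show "c \<in> (\<lambda>l i. if i < M then l ! i else 0) ` {l. set l \<subseteq> {..a} \<and> length l = M}"
      by (intro image_eqI[of _ _ "map c [0..<M]"]) auto
  qed
qed (intro finite_imageI finite_lists_length_eq, simp)

lemma filling_less:
  assumes "finite (cells c)" "T \<in> fillings c (below B \<alpha>)" "x \<in> cells c"
  shows "T x < B"
proof (rule ccontr)
  assume "\<not> T x < B"
  then have "card {y \<in> cells c. T y = T x} = 0" using assms(2) by (simp add: fillings_def below_def)
  then have "{y \<in> cells c. T y = T x} = {}" using assms(1) by simp
  then show False using assms(3) by blast
qed

lemma finite_fillings:
  assumes "finite (cells c)"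
  shows "finite (fillings c (below B \<alpha>))"
proof (rule finite_subset)
  show "fillings c (below B \<alpha>) \<subseteq> PiE (cells c) (\<lambda>_. {..<B})"
  proof
    fix T assume T: "T \<in> fillings c (below B \<alpha>)"
    then have "T \<in> extensional (cells c)" by (simp add: fillings_def)
    then show "T \<in> PiE (cells c) (\<lambda>_. {..<B})"
      using filling_less[OF assms T] unfolding PiE_iff by blast
  qed
qed (use assms in \<open>auto intro: finite_PiE\<close>)

lemma filling_size:
  assumes "finite (cells c)" "T \<in> fillings c (below B \<alpha>)"
  shows "card (cells c) = (\<Sum>k<B. \<alpha> k)"
proof -
  have "card (cells c) = (\<Sum>k<B. card {x \<in> cells c. T x = k})"
  proof -
    have "T ` cells c \<subseteq> {..<B}" using filling_less[OF assms] by blast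
    from sum.group[OF assms(1) _ this, of "\<lambda>_. 1 :: nat"] show ?thesis by simp
  qed
  then show ?thesis using assms(2) by (simp add: fillings_def below_def)
qed

text \<open>Removing the largest entries of a semistandard filling leaves a smaller shape, and the
  removed cells form a horizontal strip.\<close>

lemma card_fillings_Suc:
  assumes d: "d \<in> shapes M (\<Sum>k<Suc B. \<alpha> k)"
  shows "card (fillings d (below (Suc B) \<alpha>)) =
    (\<Sum>c\<in>{c \<in> shapes M (\<Sum>k<B. \<alpha> k). strip c d}. card (fillings c (below B \<alpha>)))"
proof -
  let ?C = "{c \<in> shapes M (\<Sum>k<B. \<alpha> k). strip c d}"
  let ?F = "fillings d (below (Suc B) \<alpha>)"
  \<comment> \<open>\<open>sub T\<close> is the shape of the entries below \<open>B\<close>;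
    \<open>ext c T\<close> is the inverse construction, filling the strip with
    \<open>B\<close>.\<close>
  define sub where "sub T j = card {r. r < d j \<and> T (r, j) < B}" for T :: "nat \<times> nat \<Rightarrow> nat" and j
  define ext where "ext c T x = (if x \<in> cells c then T x else if x \<in> cells d then B else undefined)"
    for c and T :: "nat \<times> nat \<Rightarrow> nat" and x
  have find: "finite (cells d)" by (rule finite_cells[OF d])
  have main1: "sub T \<in> ?C \<and> restrict T (cells (sub T)) \<in> fillings (sub T) (below B \<alpha>) \<and>
      ext (sub T) (restrict T (cells (sub T))) = T" if T: "T \<in> ?F" for T
  proof -
    have row: "T (r, j) \<le> T (r, Suc j)" if "(r, Suc j) \<in> cells d" for r j
      using T that by (auto simp: fillings_def)
    have col: "T (r, j) < T (Suc r, j)" if "(Suc r, j) \<in> cells d" for r j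
      using T that by (auto simp: fillings_def)
    have cont: "card {x \<in> cells d. T x = k} = below (Suc B) \<alpha> k" for k
      using T by (auto simp: fillings_def)
    have le: "T x \<le> B" if "x \<in> cells d" for x
      using filling_less[OF find T that] by simp
    have colmono: "T (r, j) < T (r', j)" if "r < r'" "r' < d j" for r r' j
      using that
    proof (induction r')
      case (Suc r')
      have s: "T (r', j) < T (Suc r', j)" using col Suc.prems by (simp add: cells_def)
      show ?case
      proof (cases "r = r'")
        case False
        then have "T (r, j) < T (r', j)" using Suc by simp
        then show ?thesis using s by simp
      qed (use s in simp)
    qed simp
    have seg: "{r. r < d j \<and> T (r, j) < B} = {..<sub T j}" for j
    proof -
      define A where "A = {r. r < d j \<and> T (r, j) < B}"
      have down: "r \<in> A" if "r < r'" "r' \<in> A" for r r'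
        using that colmono[of r r' j] by (simp add: A_def)
      have fin: "finite A" by (simp add: A_def)
      have "A = {..<card A}"
      proof (cases "A = {}")
        case False
        then have m: "Max A \<in> A" using fin by (intro Max_in)
        have "r \<in> A \<longleftrightarrow> r \<le> Max A" for r
          using m down[of r "Max A"] Max_ge[OF fin, of r] by (metis le_neq_implies_less)
        then have "A = {..Max A}" by auto
        then show ?thesis by (metis card_lessThan lessThan_Suc_atMost)
      qed simp
      then show ?thesis by (simp add: sub_def A_def)
    qed
    have incells: "x \<in> cells (sub T) \<longleftrightarrow> x \<in> cells d \<and> T x < B" for x
    proof -
      obtain r j where x: "x = (r, j)" by (cases x)
      have "r < sub T j \<longleftrightarrow> r < d j \<and> T (r, j) < B" using seg[of j] by auto
      then show ?thesis by (simp add: x cells_def)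
    qed
    have st: "sub T j \<le> d j \<and> d j \<le> Suc (sub T j)" for j
    proof
      show "sub T j \<le> d j"
        using card_mono[of "{..<d j}" "{r. r < d j \<and> T (r, j) < B}"] by (auto simp: sub_def)
      show "d j \<le> Suc (sub T j)"
      proof (rule ccontr)
        assume "\<not> d j \<le> Suc (sub T j)"
        then have "T (sub T j, j) < T (Suc (sub T j), j)" "T (Suc (sub T j), j) \<le> B"
          using col[of "sub T j" j] le[of "(Suc (sub T j), j)"] by (auto simp: cells_def)
        then have "(sub T j, j) \<in> cells (sub T)"
          using \<open>\<not> d j \<le> Suc (sub T j)\<close> unfolding incells by (auto simp: cells_def)
        then show False by (simp add: cells_def)
      qed
    qed
    have anti: "sub T (Suc j) \<le> sub T j" for j
    proof (rule ccontr)
      assume "\<not> sub T (Suc j) \<le> sub T j"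
      then have "(sub T j, Suc j) \<in> cells (sub T)" by (simp add: cells_def)
      then have "(sub T j, Suc j) \<in> cells d" "T (sub T j, Suc j) < B" unfolding incells by auto
      moreover have "(sub T j, j) \<in> cells d"
        using calculation(1) d by (auto simp: cells_def shapes_def intro: less_le_trans)
      ultimately have "(sub T j, j) \<in> cells (sub T)"
        unfolding incells using row[of "sub T j" j] by auto
      then show False by (simp add: cells_def)
    qed
    have f: "restrict T (cells (sub T)) \<in> fillings (sub T) (below B \<alpha>)"
      unfolding fillings_def mem_Collect_eq
    proof (intro conjI allI impI)
      show "restrict T (cells (sub T)) \<in> extensional (cells (sub T))" by simp
      show "restrict T (cells (sub T)) (r, j) \<le> restrict T (cells (sub T)) (r, Suc j)"
        if "(r, Suc j) \<in> cells (sub T)" for r j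
      proof -
        have "(r, j) \<in> cells (sub T)" using that anti[of j] by (simp add: cells_def)
        then show ?thesis using that row[of r j] incells by simp
      qed
      show "restrict T (cells (sub T)) (r, j) < restrict T (cells (sub T)) (Suc r, j)"
        if "(Suc r, j) \<in> cells (sub T)" for r j
      proof -
        have "(r, j) \<in> cells (sub T)" using that by (simp add: cells_def)
        then show ?thesis using that col[of r j] incells by simp
      qed
      show "card {x \<in> cells (sub T). restrict T (cells (sub T)) x = k} = below B \<alpha> k" for k
      proof -
        have "{x \<in> cells (sub T). restrict T (cells (sub T)) x = k} =
            (if k < B then {x \<in> cells d. T x = k} else {})"
          using incells by auto
        then show ?thesis using cont[of k] by (simp add: below_def)
      qed
    qed
    have "sub T \<in> shapes M (\<Sum>i<M. sub T i)"
      using anti st d by (auto simp: shapes_def) (metis le_zero_eq)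
    moreover from this have "(\<Sum>i<M. sub T i) = (\<Sum>k<B. \<alpha> k)"
      using filling_size[OF finite_cells f] card_cells by metis
    ultimately have "sub T \<in> ?C" using st by (simp add: strip_def)
    moreover have "ext (sub T) (restrict T (cells (sub T))) = T"
    proof
      fix x
      have "T \<in> extensional (cells d)" using T by (simp add: fillings_def)
      then have "T x = undefined" if "x \<notin> cells d" using that by (rule extensional_arb)
      moreover have "T x = B" if "x \<in> cells d" "\<not> T x < B" using le[OF that(1)] that(2) by simp
      ultimately show "ext (sub T) (restrict T (cells (sub T))) x = T x"
        using incells[of x] by (auto simp: ext_def)
    qed
    ultimately show ?thesis using f by blast
  qed
  have main2: "ext c T \<in> ?F \<and> sub (ext c T) = c \<and> restrict (ext c T) (cells c) = T"
    if c: "c \<in> ?C" and T: "T \<in> fillings c (below B \<alpha>)" for c T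
  proof -
    have csh: "c \<in> shapes M (\<Sum>k<B. \<alpha> k)" and st: "\<And>i. c i \<le> d i" "\<And>i. d i \<le> Suc (c i)"
      using c by (auto simp: strip_def)
    have finc: "finite (cells c)" by (rule finite_cells[OF csh])
    have lt: "T x < B" if "x \<in> cells c" for x by (rule filling_less[OF finc T that])
    have sub: "cells c \<subseteq> cells d" using st(1) by (auto simp: cells_def intro: less_le_trans)
    have leB: "ext c T x \<le> B" if "x \<in> cells d" for x using lt[of x] that by (auto simp: ext_def)
    have "ext c T \<in> ?F"
      unfolding fillings_def mem_Collect_eq
    proof (intro conjI allI impI)
      show "ext c T \<in> extensional (cells d)"
        unfolding extensional_def ext_def using sub by (simp add: subset_iff)
      show "ext c T (r, j) \<le> ext c T (r, Suc j)" if rj: "(r, Suc j) \<in> cells d" for r j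
      proof (cases "(r, Suc j) \<in> cells c")
        case True
        then have "(r, j) \<in> cells c" using csh by (auto simp: cells_def shapes_def intro: less_le_trans)
        then show ?thesis using True T by (auto simp: ext_def fillings_def)
      next
        case False
        have "(r, j) \<in> cells d" using rj d by (auto simp: cells_def shapes_def intro: less_le_trans)
        then show ?thesis using leB[of "(r, j)"] False rj by (simp add: ext_def[of c T "(r, Suc j)"])
      qed
      show "ext c T (r, j) < ext c T (Suc r, j)" if rj: "(Suc r, j) \<in> cells d" for r j
      proof (cases "(Suc r, j) \<in> cells c")
        case True
        then have "(r, j) \<in> cells c" by (auto simp: cells_def)
        then show ?thesis using True T by (auto simp: ext_def fillings_def)
      next
        case False
        have "(r, j) \<in> cells c" using rj False st(2)[of j] by (auto simp: cells_def)
        then show ?thesis using lt[of "(r, j)"] False rj by (simp add: ext_def)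
      qed
      show "card {x \<in> cells d. ext c T x = k} = below (Suc B) \<alpha> k" for k
      proof -
        consider "k < B" | "k = B" | "B < k" by linarith
        then show ?thesis
        proof cases
          case 1
          then have "{x \<in> cells d. ext c T x = k} = {x \<in> cells c. T x = k}"
            using sub by (auto simp: ext_def)
          then show ?thesis using 1 T by (auto simp: fillings_def below_def)
        next
          case 2
          then have "{x \<in> cells d. ext c T x = k} = cells d - cells c"
            using lt by (fastforce simp: ext_def)
          then have "card {x \<in> cells d. ext c T x = k} = card (cells d) - card (cells c)"
            using card_Diff_subset[OF finc sub] by simp
          then show ?thesis using card_cells[OF d] card_cells[OF csh] 2 by (simp add: below_def)
        next
          case 3
          then have "{x \<in> cells d. ext c T x = k} = {}" using leB by fastforce
          then have "card {x \<in> cells d. ext c T x = k} = 0" by (simp only: card.empty)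
          then show ?thesis using 3 by (simp add: below_def)
        qed
      qed
    qed
    moreover have "sub (ext c T) = c"
    proof
      fix j
      have "{r. r < d j \<and> ext c T (r, j) < B} = {..<c j}"
        using lt st(1)[of j] by (auto simp: ext_def cells_def split: if_splits)
      then show "sub (ext c T) j = c j" by (simp add: sub_def)
    qed
    moreover have "restrict (ext c T) (cells c) = T"
    proof (rule extensionalityI)
      show "T \<in> extensional (cells c)" using T by (simp add: fillings_def)
    qed (auto simp: ext_def)
    ultimately show ?thesis by blast
  qed
  have "bij_betw (\<lambda>(c, T). ext c T) (SIGMA c:?C. fillings c (below B \<alpha>)) ?F"
    by (rule bij_betw_byWitness[of _ "\<lambda>T. (sub T, restrict T (cells (sub T)))"])
      (use main1 main2 in auto)
  then have "card ?F = card (SIGMA c:?C. fillings c (below B \<alpha>))"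
    by (simp add: bij_betw_same_card)
  also have "\<dots> = (\<Sum>c\<in>?C. card (fillings c (below B \<alpha>)))"
  proof (rule card_SigmaI)
    show "finite ?C" by (rule finite_subset[OF _ finite_shapes[of M "\<Sum>k<B. \<alpha> k"]]) auto
    show "\<forall>c\<in>?C. finite (fillings c (below B \<alpha>))" using finite_cells finite_fillings by blast
  qed
  finally show ?thesis .
qed

text \<open>If raising the columns in \<epsilon> destroys monotonicity, then two equal heights are
  raised only at the second, and the determinant is zero. The remaining sets correspond to
  horizontal strips.\<close>

lemma pieri_shapes:
  assumes c: "c \<in> shapes M a" and ak: "a + k \<le> M"
  shows "ejt M c * hsym k = (\<Sum>d\<in>{d \<in> shapes M (a + k). strip c d}. ejt M d)"
proof -
  let ?S = "{\<epsilon>. \<epsilon> \<subseteq> {0..<M} \<and> card \<epsilon> = k}"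
  let ?d = "\<lambda>\<epsilon> i. c i + of_bool (i \<in> \<epsilon>)"
  let ?S' = "{\<epsilon> \<in> ?S. \<forall>i. ?d \<epsilon> (Suc i) \<le> ?d \<epsilon> i}"
  have fin: "finite ?S" by (rule finite_subset[of _ "Pow {0..<M}"]) auto
  have cz: "c i = 0" if "M \<le> i" for i using c that by (auto simp: shapes_def)
  have "ejt M c * hsym k = (\<Sum>\<epsilon>\<in>?S. ejt M (?d \<epsilon>))"
    \<comment> \<open>A shape of size \<open>a\<close> has at most \<open>a\<close> nonempty
      columns.\<close>
    by (rule pieri[OF _ ak, symmetric]) (rule shape_zero[OF c])
  also have "\<dots> = (\<Sum>\<epsilon>\<in>?S'. ejt M (?d \<epsilon>))"
  proof (rule sum.mono_neutral_right[OF fin])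
    show "\<forall>\<epsilon>\<in>?S - ?S'. ejt M (?d \<epsilon>) = 0"
    proof
      fix \<epsilon> assume e: "\<epsilon> \<in> ?S - ?S'"
      then obtain i where i: "\<not> ?d \<epsilon> (Suc i) \<le> ?d \<epsilon> i" by auto
      moreover have "c (Suc i) \<le> c i" using c by (auto simp: shapes_def)
      ultimately have "i \<notin> \<epsilon>" "Suc i \<in> \<epsilon>" "c (Suc i) = c i" by (auto simp: of_bool_def split: if_splits)
      then show "ejt M (?d \<epsilon>) = 0" using e by (intro ejt_eq_0[of i]) auto
    qed
  qed auto
  also have "\<dots> = (\<Sum>d\<in>{d \<in> shapes M (a + k). strip c d}. ejt M d)"
  proof (rule sum.reindex_bij_witness[of _ "\<lambda>d. {i. d i \<noteq> c i}" ?d])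
    fix \<epsilon> assume e: "\<epsilon> \<in> ?S'"
    show "{i. ?d \<epsilon> i \<noteq> c i} = \<epsilon>" by auto
    have "(\<Sum>i<M. of_bool (i \<in> \<epsilon>)) = card ({..<M} \<inter> \<epsilon>)" by (simp add: sum_of_bool_eq)
    also have "{..<M} \<inter> \<epsilon> = \<epsilon>" using e by auto
    finally have "(\<Sum>i<M. of_bool (i \<in> \<epsilon>)) = k" using e by simp
    then have "(\<Sum>i<M. ?d \<epsilon> i) = a + k" using c by (simp add: sum.distrib shapes_def)
    moreover have "?d \<epsilon> i = 0" if "M \<le> i" for i using e cz that by auto
    ultimately show "?d \<epsilon> \<in> {d \<in> shapes M (a + k). strip c d}"
      using e by (auto simp: shapes_def strip_def)
  next
    fix d assume d: "d \<in> {d \<in> shapes M (a + k). strip c d}"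
    then have st: "d i = c i \<or> d i = Suc (c i)" for i
      by (auto simp: strip_def) (metis le_Suc_eq le_antisym)
    then show de: "?d {i. d i \<noteq> c i} = d" by (fastforce simp: fun_eq_iff)
    have sub: "{i. d i \<noteq> c i} \<subseteq> {0..<M}"
    proof
      fix i assume "i \<in> {i. d i \<noteq> c i}"
      moreover have "d i = 0" if "M \<le> i" using d that by (simp add: shapes_def)
      ultimately show "i \<in> {0..<M}" using cz[of i] by (cases "M \<le> i") auto
    qed
    have "a + k = (\<Sum>i<M. ?d {i. d i \<noteq> c i} i)" unfolding de using d by (simp add: shapes_def)
    also have "\<dots> = a + card ({..<M} \<inter> {i. d i \<noteq> c i})"
      using c by (simp add: sum.distrib shapes_def sum_of_bool_eq)
    also have "{..<M} \<inter> {i. d i \<noteq> c i} = {i. d i \<noteq> c i}" using sub by auto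
    finally have "card {i. d i \<noteq> c i} = k" by simp
    moreover have "?d {i. d i \<noteq> c i} (Suc i) \<le> ?d {i. d i \<noteq> c i} i" for i
    proof -
      have "?d {i. d i \<noteq> c i} (Suc i) = d (Suc i)" by (rule fun_cong[OF de])
      moreover have "?d {i. d i \<noteq> c i} i = d i" by (rule fun_cong[OF de])
      moreover have "d (Suc i) \<le> d i" using d by (simp add: shapes_def)
      ultimately show ?thesis by (simp only:)
    qed
    ultimately show "{i. d i \<noteq> c i} \<in> ?S'"
      using sub by blast
  qed simp
  finally show ?thesis .
qed

text \<open>Adding the letter \<open>B\<close> multiplies by one more complete function. After
  exchanging the sums over shapes joined by a strip, the coefficients obey the recursion
  \<open>card_fillings_Suc\<close>.\<close>

lemma prod_hsym:
  assumes "(\<Sum>k<B. \<alpha> k) \<le> M"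
  shows "(\<Prod>k<B. hsym (\<alpha> k)) =
    (\<Sum>c\<in>shapes M (\<Sum>k<B. \<alpha> k). of_nat (card (fillings c (below B \<alpha>))) * ejt M c)"
  using assms
proof (induction B)
  case 0
  have "c = (\<lambda>_. 0)" if "c \<in> shapes M 0" for c using shape_zero[OF that] by auto
  then have sh: "shapes M 0 = {\<lambda>_. 0}" by (auto simp: shapes_def)
  have "fillings (\<lambda>_. 0) (below 0 \<alpha>) = {\<lambda>_. undefined}"
    by (auto simp: fillings_def cells_def below_def)
  moreover have "ejt M (\<lambda>_. 0) = 1"
    using ejt_truncate[of 0 "\<lambda>_. 0" M M] by (simp add: ejt_def det_dim_zero[OF mat_carrier])
  ultimately show ?case by (simp add: sh)
next
  case (Suc B)
  let ?a = "\<Sum>k<B. \<alpha> k"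
  let ?f = "\<lambda>c. of_nat (card (fillings c (below B \<alpha>))) :: epoly"
  have ak: "?a + \<alpha> B \<le> M" using Suc.prems by simp
  have "(\<Prod>k<Suc B. hsym (\<alpha> k)) = (\<Sum>c\<in>shapes M ?a. ?f c * (ejt M c * hsym (\<alpha> B)))"
    using Suc by (simp add: sum_distrib_right mult.assoc)
  also have "\<dots> = (\<Sum>c\<in>shapes M ?a. \<Sum>d\<in>{d \<in> shapes M (?a + \<alpha> B). strip c d}. ?f c * ejt M d)"
    by (rule sum.cong[OF refl]) (simp add: pieri_shapes[OF _ ak] sum_distrib_left)
  also have "\<dots> = (\<Sum>d\<in>shapes M (?a + \<alpha> B). \<Sum>c\<in>{c \<in> shapes M ?a. strip c d}. ?f c * ejt M d)"
    by (rule sum.swap_restrict) (auto simp: finite_shapes)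
  also have "\<dots> = (\<Sum>d\<in>shapes M (\<Sum>k<Suc B. \<alpha> k). of_nat (card (fillings d (below (Suc B) \<alpha>))) * ejt M d)"
    by (rule sum.cong) (auto simp: card_fillings_Suc sum_distrib_right)
  finally show ?case .
qed

section \<open>Partitions, quasisymmetric functions and tableaux\<close>

lemma mem_young_iff:
  assumes "is_partition la"
  shows "(r, j) \<in> young la \<longleftrightarrow> r < col_height la j"
proof -
  have "r < length (filter (\<lambda>x. j < x) la) \<longleftrightarrow> r < length la \<and> j < la ! r" if "sorted (rev la)" for la :: "nat list" and r
    using that
  proof (induction la arbitrary: r)
    case (Cons a la)
    have s: "sorted (rev la)" "\<forall>x\<in>set la. x \<le> a" using Cons.prems by (auto simp: sorted_append)
    show ?case
    proof (cases "j < a")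
      case True
      then show ?thesis using Cons.IH[OF s(1)] by (cases r) auto
    next
      case False
      then have "filter (\<lambda>x. j < x) la = []" using s(2) by (auto simp: filter_empty_conv)
      moreover have "\<not> j < (a # la) ! r" if "r < Suc (length la)"
        using False s(2) that by (cases r) (auto simp: not_less intro: order_trans[OF bspec[OF s(2)]])
      ultimately show ?thesis using False by auto
    qed
  qed simp
  then show ?thesis using assms by (simp add: young_def col_height_def is_partition_def)
qed

lemma young_eq_cells: "is_partition la \<Longrightarrow> young la = cells (col_height la)"
  using mem_young_iff by (auto simp: cells_def)

lemma sum_col_height:
  assumes "\<forall>x\<in>set la. x \<le> M"
  shows "(\<Sum>j<M. col_height la j) = sum_list la"
  using assms
proof (induction la)
  case (Cons a la)
  have "(\<Sum>j<M. of_bool (j < a)) = card ({..<M} \<inter> {j. j < a})" by (simp add: sum_of_bool_eq)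
  also have "{..<M} \<inter> {j. j < a} = {..<a}" using Cons.prems by auto
  finally have "(\<Sum>j<M. of_bool (j < a)) = a" by simp
  moreover have "col_height (a # la) j = of_bool (j < a) + col_height la j" for j
    by (simp add: col_height_def)
  ultimately show ?case using Cons by (simp add: sum.distrib)
qed (simp add: col_height_def)

text \<open>Conjugation of partitions. The row lengths are recovered as \<open>f r\<close>, the
  number of columns with more than \<open>r\<close> cells, and there are \<open>c 0\<close>
  rows.\<close>

lemma bij_betw_col_height: "bij_betw col_height {la. is_partition la \<and> sum_list la = n} (shapes n n)"
proof (rule bij_betw_imageI)
  show "inj_on col_height {la. is_partition la \<and> sum_list la = n}"
  proof (rule inj_onI)
    fix la lb :: "nat list"
    assume "la \<in> {la. is_partition la \<and> sum_list la = n}" "lb \<in> {la. is_partition la \<and> sum_list la = n}"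
      and eq: "col_height la = col_height lb"
    then have la: "is_partition la" and lb: "is_partition lb" by auto
    have y: "young la = young lb" using young_eq_cells la lb eq by simp
    have pos: "length l = card {r. (r, 0) \<in> young l}" if "is_partition l" for l
    proof -
      have "{r. (r, 0) \<in> young l} = {..<length l}"
        using that by (auto simp: young_def is_partition_def) (metis gr0I nth_mem)
      then show ?thesis by simp
    qed
    have ent: "l ! r = card {j. (r, j) \<in> young l}" if "r < length l" for l r
    proof -
      have "{j. (r, j) \<in> young l} = {..<l ! r}" using that by (auto simp: young_def)
      then show ?thesis by simp
    qed
    have "length la = length lb" using pos la lb y by simp
    then show "la = lb" using ent y by (intro nth_equalityI) auto
  qed
  show "col_height ` {la. is_partition la \<and> sum_list la = n} = shapes n n"
  proof (intro equalityI subsetI)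
    fix c assume "c \<in> col_height ` {la. is_partition la \<and> sum_list la = n}"
    then obtain la where la: "c = col_height la" "is_partition la" "sum_list la = n" by auto
    have b: "\<forall>x\<in>set la. x \<le> n" using la(3) member_le_sum_list by blast
    have "col_height la i = 0" if "n \<le> i" for i
      using b that by (auto simp: col_height_def filter_empty_conv)
    moreover have "col_height la (Suc i) \<le> col_height la i" for i
      unfolding col_height_def by (induction la) auto
    ultimately show "c \<in> shapes n n" using sum_col_height[OF b] la by (simp add: shapes_def)
  next
    fix c assume c: "c \<in> shapes n n"
    define f where "f r = card {j. r < c j}" for r
    have sub: "{j. r < c j} \<subseteq> {..<n}" for r
    proof
      fix j assume "j \<in> {j. r < c j}"
      then show "j \<in> {..<n}" using c by (cases "n \<le> j") (auto simp: shapes_def)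
    qed
    have fin: "finite {j. r < c j}" for r using finite_subset[OF sub] by simp
    have seg: "{j. r < c j} = {..<f r}" for r
    proof (cases "{j. r < c j} = {}")
      case True
      then show ?thesis unfolding f_def by (metis card.empty lessThan_0)
    next
      case False
      let ?m = "Max {j. r < c j}"
      have "?m \<in> {j. r < c j}" using Max_in[OF fin False] .
      then have "j \<le> ?m \<longleftrightarrow> r < c j" for j
        using shape_antimono[OF c, of j ?m] Max_ge[OF fin, of j r] by auto
      then have "{j. r < c j} = {..?m}" by auto
      then show ?thesis unfolding f_def by (metis card_lessThan lessThan_Suc_atMost)
    qed
    have iff: "j < f r \<longleftrightarrow> r < c j" for j r using seg[of r] by blast
    define la where "la = map f [0..<c 0]"
    have fanti: "f r' \<le> f r" if "r \<le> r'" for r r'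
      unfolding f_def by (rule card_mono[OF fin]) (use that in auto)
    have part: "is_partition la"
      unfolding is_partition_def
    proof
      show "sorted (rev la)"
        unfolding la_def sorted_wrt_rev by (auto simp: sorted_wrt_iff_nth_less intro: fanti)
      show "0 \<notin> set la"
      proof
        assume "0 \<in> set la"
        then obtain r where "r < c 0" "f r = 0" by (auto simp: la_def)
        then show False using iff[of 0 r] by simp
      qed
    qed
    have ch: "col_height la = c"
    proof
      fix j
      have "r < col_height la j \<longleftrightarrow> r < c j" for r
      proof -
        have "r < col_height la j \<longleftrightarrow> r < c 0 \<and> j < f r"
          using mem_young_iff[OF part, of r j] by (auto simp: young_def la_def)
        then show ?thesis using iff[of j r] shape_antimono[OF c, of 0 j] by auto
      qed
      then show "col_height la j = c j" by (metis linorder_neqE_nat less_irrefl)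
    qed
    have "x \<le> n" if x: "x \<in> set la" for x
    proof -
      obtain r where r: "x = f r" using x by (auto simp: la_def)
      show ?thesis using card_mono[OF _ sub[of r]] by (simp add: r f_def)
    qed
    then have "sum_list la = n" using sum_col_height[of la n] ch c by (simp add: shapes_def)
    then show "c \<in> col_height ` {la. is_partition la \<and> sum_list la = n}"
      using part ch by (intro image_eqI[of _ _ la]) auto
  qed
qed

lemma schur_eq_fillings:
  "is_partition la \<Longrightarrow> schur la \<alpha> = int (card (fillings (col_height la) \<alpha>))"
  unfolding schur_def ssyt_def fillings_def by (simp add: young_eq_cells conj_assoc)

section \<open>Coefficients of quasisymmetric functions as counts of compatible words\<close>

fun content_word :: "nat \<Rightarrow> nat list \<Rightarrow> nat list" where
  "content_word m [] = []"
| "content_word m (k # ks) = replicate k m @ content_word (Suc m) ks"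

lemma length_content_word [simp]: "length (content_word m ks) = sum_list ks"
  by (induction ks arbitrary: m) auto

lemma content_word_ge: "x \<in> set (content_word m ks) \<Longrightarrow> m \<le> x"
  by (induction ks arbitrary: m) (auto, metis Suc_leD)

lemma sorted_content_word: "sorted (content_word m ks)"
proof (induction ks arbitrary: m)
  case (Cons k ks)
  then show ?case by (auto simp: sorted_append dest!: content_word_ge)
qed simp

lemma count_content_word:
  "count_list (content_word m ks) x = (if m \<le> x \<and> x < m + length ks then ks ! (x - m) else 0)"
proof (induction ks arbitrary: m)
  case (Cons k ks)
  have "count_list (replicate k m) x = (if x = m then k else 0)" by (induction k) auto
  then show ?case using Cons.IH[of "Suc m"] by (auto simp: nth_Cons' )
qed simp

lemma sorted_eqI_count:
  assumes "sorted s" "sorted t" "\<And>k. count_list s k = count_list t k"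
  shows "s = (t :: nat list)"
proof -
  have "mset s = mset t" by (rule multiset_eqI) (simp add: count_mset assms(3))
  then show ?thesis using assms(1,2) by (metis properties_for_sort)
qed

text \<open>The descent condition of \<open>gessel\<close>, stated on adjacent pairs so that it can
  be split along a concatenation.\<close>

definition compat :: "'a::order list \<Rightarrow> nat list \<Rightarrow> bool" where
  "compat w s \<longleftrightarrow> successively (\<lambda>(a, x) (b, y). b < a \<longrightarrow> x < y) (zip w s)"

lemma compat_Des:
  assumes "length s = length w"
  shows "compat w s \<longleftrightarrow> (\<forall>j\<in>Des w. s ! (j - 1) < s ! j)"
proof
  assume r: "compat w s"
  show "\<forall>j\<in>Des w. s ! (j - 1) < s ! j"
  proof
    fix j assume j: "j \<in> Des w"
    then obtain i where "j = Suc i" by (cases j) (auto simp: Des_def)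
    then show "s ! (j - 1) < s ! j"
      using j r assms unfolding compat_def successively_conv_nth by (auto simp: Des_def)
  qed
next
  assume d: "\<forall>j\<in>Des w. s ! (j - 1) < s ! j"
  have "s ! i < s ! Suc i" if "Suc i < length w" "w ! Suc i < w ! i" for i
  proof -
    have "Suc i \<in> Des w" using that by (simp add: Des_def)
    then show ?thesis using d by fastforce
  qed
  then show "compat w s"
    unfolding compat_def successively_conv_nth using assms by simp
qed

definition supp :: "(nat \<Rightarrow> nat) \<Rightarrow> nat set" where
  "supp \<alpha> = {k. \<alpha> k \<noteq> 0}"

text \<open>Coefficient functions take arbitrary exponent vectors, also of infinite support or of
  the wrong degree; off this predicate both sides of the theorem vanish.\<close>

definition weight :: "(nat \<Rightarrow> nat) \<Rightarrow> nat \<Rightarrow> bool" where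
  "weight \<alpha> n \<longleftrightarrow> finite (supp \<alpha>) \<and> (\<Sum>k\<in>supp \<alpha>. \<alpha> k) = n"

lemma weight_bound:
  assumes "weight \<alpha> n"
  obtains B where "\<And>k. B \<le> k \<Longrightarrow> \<alpha> k = 0" "(\<Sum>k<B. \<alpha> k) = n"
    "(\<Prod>k<B. hsym (\<alpha> k)) = (\<Prod>k\<in>supp \<alpha>. hsym (\<alpha> k))"
proof -
  obtain B where B: "supp \<alpha> \<subseteq> {..<B}"
    using assms finite_nat_iff_bounded unfolding weight_def by blast
  show ?thesis
  proof (rule that[of B])
    show "\<alpha> k = 0" if "B \<le> k" for k using B that by (auto simp: supp_def)
    have "(\<Sum>k<B. \<alpha> k) = (\<Sum>k\<in>supp \<alpha>. \<alpha> k)"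
      by (rule sum.mono_neutral_right) (use B in \<open>auto simp: supp_def\<close>)
    then show "(\<Sum>k<B. \<alpha> k) = n" using assms by (simp add: weight_def)
    show "(\<Prod>k<B. hsym (\<alpha> k)) = (\<Prod>k\<in>supp \<alpha>. hsym (\<alpha> k))"
      by (rule prod.mono_neutral_right) (use B in \<open>auto simp: supp_def\<close>)
  qed
qed

lemma weightI:
  assumes "\<And>k. B \<le> k \<Longrightarrow> \<alpha> k = 0" "(\<Sum>k<B. \<alpha> k) = n"
  shows "weight \<alpha> n"
proof -
  have B: "supp \<alpha> \<subseteq> {..<B}"
  proof
    fix k assume "k \<in> supp \<alpha>"
    then show "k \<in> {..<B}" using assms(1)[of k] by (cases "B \<le> k") (auto simp: supp_def)
  qed
  have "(\<Sum>k<B. \<alpha> k) = (\<Sum>k\<in>supp \<alpha>. \<alpha> k)"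
    by (rule sum.mono_neutral_right) (use B in \<open>auto simp: supp_def\<close>)
  then show ?thesis using assms(2) finite_subset[OF B] by (simp add: weight_def)
qed

text \<open>There is exactly one sorted sequence with content \<alpha>, so the coefficient is 0 or
  1.\<close>

lemma gessel_weight:
  assumes "length w = n" "\<And>k. B \<le> k \<Longrightarrow> \<alpha> k = 0" "(\<Sum>k<B. \<alpha> k) = n"
  shows "gessel n (Des w) \<alpha> = of_bool (compat w (content_word 0 (map \<alpha> [0..<B])))"
proof -
  let ?s = "content_word 0 (map \<alpha> [0..<B])"
  have sl: "sum_list (map \<alpha> [0..<B]) = n"
    using assms(3) by (simp add: sum_list_distinct_conv_sum_set atLeast0LessThan)
  have cnt: "count_list ?s k = \<alpha> k" for k
    using assms(2)[of k] by (auto simp: count_content_word)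
  have "{s. length s = n \<and> sorted s \<and> (\<forall>j\<in>Des w. s ! (j - 1) < s ! j) \<and> (\<forall>k. count_list s k = \<alpha> k)}
      = (if compat w ?s then {?s} else {})"
    using sorted_eqI_count[OF _ sorted_content_word, of _ 0 "map \<alpha> [0..<B]"]
      compat_Des[of ?s w] sl assms(1) cnt sorted_content_word
    by auto
  then show ?thesis unfolding gessel_def by simp
qed

lemma gessel_no_weight:
  assumes "\<not> weight \<alpha> n"
  shows "gessel n D \<alpha> = 0"
proof -
  have "weight \<alpha> n" if s: "length s = n" "\<forall>k. count_list s k = \<alpha> k" for s
  proof -
    obtain B where B: "set s \<subseteq> {..<B}" using finite_nat_iff_bounded[of "set s"] by auto
    have "(\<Sum>k<B. \<alpha> k) = n"
      using sum_count_set[OF B] s by simp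
    moreover have "\<alpha> k = 0" if "B \<le> k" for k
    proof -
      have "k \<notin> set s" using B that by auto
      then show ?thesis using s(2) count_list_0_iff[of s k] by metis
    qed
    ultimately show ?thesis by (intro weightI)
  qed
  then have e: "{s. length s = n \<and> sorted s \<and> (\<forall>j\<in>D. s ! (j - 1) < s ! j) \<and> (\<forall>k. count_list s k = \<alpha> k)} = {}"
    using assms by auto
  show ?thesis unfolding gessel_def e by simp
qed

lemma fillings_no_weight:
  assumes "\<not> weight \<alpha> n" "c \<in> shapes M n"
  shows "fillings c \<alpha> = {}"
proof (rule ccontr)
  assume "fillings c \<alpha> \<noteq> {}"
  then obtain T where T: "T \<in> fillings c \<alpha>" by blast
  have fin: "finite (cells c)" by (rule finite_cells[OF assms(2)])
  obtain B where B: "T ` cells c \<subseteq> {..<B}" using finite_nat_iff_bounded[of "T ` cells c"] fin by auto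
  have z: "\<alpha> k = 0" if "B \<le> k" for k
  proof -
    have "{x \<in> cells c. T x = k} = {}" using B that by auto
    moreover have "card {x \<in> cells c. T x = k} = \<alpha> k" using T by (simp add: fillings_def)
    ultimately show ?thesis by (simp only: card.empty)
  qed
  then have "below B \<alpha> = \<alpha>" by (auto simp: below_def fun_eq_iff)
  then have "(\<Sum>k<B. \<alpha> k) = n"
    using filling_size[OF fin, of T B \<alpha>] T card_cells[OF assms(2)] by simp
  then show False using weightI[of B \<alpha> n] z assms(1) by blast
qed

lemma free31_order_less:
  assumes "finite (UNIV :: 'a::order set)" "three_one_free (UNIV :: 'a set)"
  shows "free31_order ((<) :: 'a \<Rightarrow> 'a \<Rightarrow> bool)"
proof
  fix a b c d :: 'a
  assume "a < b" "b < c"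
  then show "a < d \<or> d < a \<or> b < d \<or> d < b \<or> c < d \<or> d < c"
    using assms(2) unfolding three_one_free_def incomp_def by blast
qed (use assms(1) in auto)

locale free31_poset = free31_order "(<) :: 'a::order \<Rightarrow> 'a \<Rightarrow> bool"
begin

lemma knuth_triple_sym: "knuth_triple t t' \<Longrightarrow> knuth_triple t' t"
  unfolding knuth_triple_def by (simp add: insert_commute)

lemma keq_closed:
  assumes "keq w w'" "knuth_equiv_graph n V"
  shows "w \<in> V \<longleftrightarrow> w' \<in> V"
proof -
  have m: "u @ t @ v \<in> V \<longleftrightarrow> u @ t' @ v \<in> V" if "length t = 3" "length t' = 3" "knuth_triple t t'" for u v t t'
    using that assms(2) knuth_triple_sym[OF that(3)]
    unfolding knuth_equiv_graph_def knuth_move_def by blast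
  from assms(1) show ?thesis
  proof (induction rule: keq.induct)
    case (k1 a b c u v)
    then show ?case by (intro m) (auto simp: knuth_triple_def)
  next
    case (k2 b a c u v)
    then show ?case by (intro m) (auto simp: knuth_triple_def)
  next
    case (k3 a b c u v)
    then show ?case by (intro m) (auto simp: knuth_triple_def incomp_def)
  qed auto
qed

text \<open>Inside a constant run no descent is allowed, while at the junction the index rises
  strictly and anything is allowed.\<close>

lemma compat_append_replicate:
  assumes "length u = k"
  shows "compat (u @ w) (replicate k m @ content_word (Suc m) ks) \<longleftrightarrow>
    nodesc u \<and> compat w (content_word (Suc m) ks)"
proof -
  let ?P = "\<lambda>(a, x) (b, y). b < a \<longrightarrow> (x :: nat) < y"
  have z: "zip (u @ w) (replicate k m @ content_word (Suc m) ks) =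
      zip u (replicate k m) @ zip w (content_word (Suc m) ks)"
    using assms by simp
  have 1: "successively ?P (zip u (replicate k m)) \<longleftrightarrow> nodesc u"
    using assms unfolding successively_conv_nth by auto
  have 2: "?P (last xs) (hd ys)"
    if "xs = zip u (replicate k m)" "ys = zip w (content_word (Suc m) ks)" "xs \<noteq> []" "ys \<noteq> []" for xs ys
  proof -
    have "last xs \<in> set xs" "hd ys \<in> set ys" using that by auto
    then have "snd (last xs) = m" "Suc m \<le> snd (hd ys)"
      using that(1,2) content_word_ge[of _ "Suc m" ks]
      by (metis in_set_replicate in_set_zipE prod.collapse, metis in_set_zipE prod.collapse)
    then show ?thesis by (simp add: case_prod_unfold)
  qed
  show ?thesis
    unfolding compat_def z successively_append_iff 1 using 2[OF refl refl] by argo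
qed

lemma blocks_sum_False:
  "blocks_sum (map (Pair False) ks) g =
    (\<Sum>w\<in>{w. length w = sum_list ks \<and> compat w (content_word m ks)}. g w)"
proof (induction ks arbitrary: m g)
  case Nil
  have "{w :: 'a list. length w = 0 \<and> compat w []} = {[]}" by (auto simp: compat_def)
  then show ?case by simp
next
  case (Cons k ks)
  let ?W = "{w. length w = sum_list ks \<and> compat w (content_word (Suc m) ks)}"
  have "blocks_sum (map (Pair False) (k # ks)) g = (\<Sum>u\<in>block (False, k). \<Sum>w\<in>?W. g (u @ w))"
    using Cons.IH[of _ "Suc m"] by simp
  also have "\<dots> = (\<Sum>(u, w)\<in>block (False, k) \<times> ?W. g (u @ w))"
    by (simp add: sum.cartesian_product)
  also have "\<dots> = (\<Sum>w\<in>{w. length w = sum_list (k # ks) \<and> compat w (content_word m (k # ks))}. g w)"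
  proof (rule sum.reindex_bij_witness[of _ "\<lambda>w. (take k w, drop k w)" "\<lambda>(u, w). u @ w"])
    fix w :: "'a list"
    assume w: "w \<in> {w. length w = sum_list (k # ks) \<and> compat w (content_word m (k # ks))}"
    then have "compat (take k w @ drop k w) (replicate k m @ content_word (Suc m) ks)" by simp
    then show "(take k w, drop k w) \<in> block (False, k) \<times> ?W"
      using w compat_append_replicate[of "take k w" k "drop k w" m ks] by (auto simp: block_def)
  next
    fix p :: "'a list \<times> 'a list" assume p: "p \<in> block (False, k) \<times> ?W"
    then show "(case p of (u, w) \<Rightarrow> u @ w) \<in> {w. length w = sum_list (k # ks) \<and> compat w (content_word m (k # ks))}"
      using compat_append_replicate[of _ k _ m ks] by (auto simp: block_def)
  qed (auto simp: block_def)
  finally show ?case .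
qed

section \<open>The expansion for a fixed Knuth equivalence graph\<close>

context
  fixes n :: nat and V :: "'a list set"
  assumes V: "knuth_equiv_graph n V"
begin

lemma invariant_indicator: "invariant (\<lambda>w. of_bool (w \<in> V))"
  unfolding invariant_def using keq_closed[OF _ V] by auto

text \<open>The words compatible with the content of \<alpha> are the concatenations counted by a
  product of complete functions. Once evaluated in the commutative ring, the product no longer
  depends on the order of the exponents.\<close>

lemma F_Gamma_weight:
  assumes "weight \<alpha> n"
  shows "F_Gamma n V \<alpha> = ev (\<lambda>w. of_bool (w \<in> V)) (\<Prod>k\<in>supp \<alpha>. hsym (\<alpha> k))"
proof -
  obtain B where B: "\<And>k. B \<le> k \<Longrightarrow> \<alpha> k = 0" "(\<Sum>k<B. \<alpha> k) = n"
    "(\<Prod>k<B. hsym (\<alpha> k)) = (\<Prod>k\<in>supp \<alpha>. hsym (\<alpha> k))"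
    using weight_bound[OF assms] by blast
  let ?ks = "map \<alpha> [0..<B]"
  have len: "length w = n" if "w \<in> V" for w using V that by (auto simp: knuth_equiv_graph_def)
  have finV: "finite V" by (rule finite_subset[OF _ finite_words[of n]]) (use len in auto)
  have sl: "sum_list ?ks = n"
    using B(2) by (simp add: sum_list_distinct_conv_sum_set atLeast0LessThan)
  have "F_Gamma n V \<alpha> = (\<Sum>w\<in>V. of_bool (compat w (content_word 0 ?ks)))"
    unfolding F_Gamma_def by (rule sum.cong[OF refl]) (rule gessel_weight[OF len B(1,2)])
  also have "\<dots> = (\<Sum>w\<in>{w. length w = sum_list ?ks \<and> compat w (content_word 0 ?ks)}. of_bool (w \<in> V))"
  proof -
    have fW: "finite {w :: 'a list. length w = sum_list ?ks \<and> compat w (content_word 0 ?ks)}"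
      by (rule finite_subset[OF _ finite_words[of "sum_list ?ks"]]) auto
    have "V \<inter> {w. compat w (content_word 0 ?ks)} =
        {w. length w = sum_list ?ks \<and> compat w (content_word 0 ?ks)} \<inter> V"
      using len unfolding sl by auto
    then show ?thesis using finV fW by (simp add: sum_of_bool_eq)
  qed
  also have "\<dots> = blocks_sum (map (Pair False) ?ks) (\<lambda>w. of_bool (w \<in> V))"
    by (rule blocks_sum_False[symmetric])
  also have "\<dots> = ev (\<lambda>w. of_bool (w \<in> V)) (prod_list (map hsym ?ks))"
    using ev_prod_esym_hsym[OF invariant_indicator, of "[]" ?ks] by simp
  also have "prod_list (map hsym ?ks) = (\<Prod>k\<in>supp \<alpha>. hsym (\<alpha> k))"
    unfolding B(3)[symmetric] by (simp add: prod.list_conv_set_nth atLeast0LessThan)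
  finally show ?thesis .
qed

lemma F_Gamma_no_weight: "\<not> weight \<alpha> n \<Longrightarrow> F_Gamma n V \<alpha> = 0"
  unfolding F_Gamma_def by (simp add: gessel_no_weight)

text \<open>A tableau is an array without flaws. The array is padded to \<open>n\<close> columns,
  the size of the determinant; empty columns do not change the word.\<close>

lemma card_tableaux:
  assumes la: "is_partition la" and n: "sum_list la = n"
  shows "int (card {T. ptableau la T \<and> colword la T \<in> V}) =
    (\<Sum>As\<in>{As\<in>columns n UNIV. \<not> has_flaw As \<and> (\<forall>i<n. length (As ! i) = col_height la i)}.
      of_bool (col_word As \<in> V))"
proof -
  let ?c = "col_height la"
  let ?A = "{As\<in>columns n UNIV. \<not> has_flaw As \<and> (\<forall>i<n. length (As ! i) = ?c i)}"
  have csh: "?c \<in> shapes n n" using bij_betw_col_height[of n] la n unfolding bij_betw_def by blast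
  have cz: "?c j = 0" if "n \<le> j" for j using csh that by (simp add: shapes_def)
  have anti: "?c (Suc j) \<le> ?c j" for j using csh by (simp add: shapes_def)
  define arr where "arr T = map (\<lambda>j. map (\<lambda>r. T (r, j)) [0..<?c j]) [0..<n]" for T :: "nat \<times> nat \<Rightarrow> 'a"
  define fil where "fil As = restrict (\<lambda>(r, j). As ! j ! r) (young la)" for As :: "'a list list"
  have Y: "(r, j) \<in> young la \<longleftrightarrow> r < ?c j" for r j by (rule mem_young_iff[OF la])
  have Yn: "j < n" if "r < ?c j" for r j using cz[of j] that by (cases "n \<le> j") auto
  have word: "col_word (arr T) = colword la T" for T
  proof -
    have nc: "ncols la \<le> n"
      using n by (auto simp: ncols_def split: list.splits)
    have z: "?c j = 0" if "ncols la \<le> j" for j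
    proof (cases la)
      case (Cons a l)
      then have "\<forall>x\<in>set la. x \<le> a" using la by (auto simp: is_partition_def sorted_append)
      then have "filter (\<lambda>x. j < x) la = []"
        using that Cons by (auto simp: ncols_def filter_empty_conv not_less)
      then show ?thesis by (simp add: col_height_def)
    qed (simp add: col_height_def)
    let ?f = "\<lambda>j. rev (map (\<lambda>r. T (r, j)) [0..<?c j])"
    have "[0..<n] = [0..<ncols la] @ [ncols la..<n]"
      using nc by (metis le_add_diff_inverse upt_add_eq_append zero_le)
    moreover have "concat (map ?f [ncols la..<n]) = []" using z by auto
    ultimately have "concat (map ?f [0..<n]) = concat (map ?f [0..<ncols la])" by simp
    then show ?thesis by (simp add: col_word_def colword_def arr_def comp_def)
  qed
  have arr_in: "arr T \<in> ?A \<and> fil (arr T) = T" if T: "ptableau la T" for T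
  proof -
    have col: "T (r, j) < T (Suc r, j)" if "Suc r < ?c j" for r j using T that by (simp add: ptableau_def Y)
    have row: "\<not> T (r, Suc j) < T (r, j)" if "r < ?c (Suc j)" for r j using T that by (simp add: ptableau_def Y)
    have "sorted_wrt (<) (map (\<lambda>r. T (r, j)) [0..<?c j])" for j
    proof -
      have "T (r, j) < T (r', j)" if "r < r'" "r' < ?c j" for r r'
        using that
      proof (induction r')
        case (Suc r')
        then show ?case using col[of r' j] by (cases "r = r'") (auto intro: less_trans)
      qed simp
      then show ?thesis by (auto simp: sorted_wrt_iff_nth_less)
    qed
    then have "arr T \<in> columns n UNIV" by (auto simp: columns_def arr_def)
    moreover have "\<not> has_flaw (arr T)"
    proof
      assume "has_flaw (arr T)"
      then obtain s j where fa: "flaw_at (arr T) s j" by (auto simp: has_flaw_def)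
      then have b: "Suc j < n" "s < ?c (Suc j)" by (auto simp: flaw_at_def arr_def)
      then have "s < ?c j" using anti[of j] by simp
      then have "T (s, Suc j) < T (s, j)" using fa b by (auto simp: flaw_at_def arr_def)
      then show False using row[OF b(2)] by simp
    qed
    moreover have "fil (arr T) = T"
    proof (rule extensionalityI)
      show "T \<in> extensional (young la)" using T by (simp add: ptableau_def)
      show "fil (arr T) x = T x" if "x \<in> young la" for x
        using that Yn by (cases x) (auto simp: fil_def arr_def Y)
    qed (simp add: fil_def)
    ultimately show ?thesis by (simp add: arr_def)
  qed
  have fil_in: "ptableau la (fil As) \<and> arr (fil As) = As" if As: "As \<in> ?A" for As
  proof -
    have len: "length As = n" "length (As ! j) = ?c j" if "j < n" for j
      using As that by (auto simp: columns_def)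
    have lA: "length As = n" using As by (simp add: columns_def)
    have inc: "sorted_wrt (<) (As ! j)" if "j < n" for j using As that lA by (auto simp: columns_def)
    have f: "fil As (r, j) = As ! j ! r" if "r < ?c j" for r j using that by (simp add: fil_def Y)
    have "fil As (r, j) < fil As (Suc r, j)" if "Suc r < ?c j" for r j
      using that Yn[OF that] inc[of j] len[of j] sorted_wrt_nth_less[of "(<)" "As ! j" r "Suc r"] by (simp add: f)
    moreover have "\<not> fil As (r, Suc j) < fil As (r, j)" if r: "r < ?c (Suc j)" for r j
    proof -
      have j: "Suc j < n" using Yn[OF r] .
      have "\<not> flaw_at As r j" using As by (auto simp: has_flaw_def)
      then have "\<not> As ! Suc j ! r < As ! j ! r"
        using j r len[of "Suc j"] unfolding flaw_at_def by auto
      then show ?thesis using f[OF r] f[of r j] anti[of j] r by simp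
    qed
    moreover have "arr (fil As) = As"
      by (rule nth_equalityI) (auto simp: arr_def lA len f intro!: nth_equalityI)
    ultimately show ?thesis by (auto simp: ptableau_def Y fil_def)
  qed
  have "bij_betw arr {T. ptableau la T \<and> colword la T \<in> V} {As \<in> ?A. col_word As \<in> V}"
  proof (rule bij_betw_byWitness[of _ fil])
    show "\<forall>T\<in>{T. ptableau la T \<and> colword la T \<in> V}. fil (arr T) = T" using arr_in by blast
    show "\<forall>As\<in>{As \<in> ?A. col_word As \<in> V}. arr (fil As) = As" using fil_in by blast
    show "arr ` {T. ptableau la T \<and> colword la T \<in> V} \<subseteq> {As \<in> ?A. col_word As \<in> V}"
      using arr_in word by auto
    show "fil ` {As \<in> ?A. col_word As \<in> V} \<subseteq> {T. ptableau la T \<and> colword la T \<in> V}"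
    proof (rule image_subsetI)
      fix As assume A: "As \<in> {As \<in> ?A. col_word As \<in> V}"
      then have "ptableau la (fil As)" "arr (fil As) = As" using fil_in by blast+
      then show "fil As \<in> {T. ptableau la T \<and> colword la T \<in> V}"
        using A word[of "fil As"] by simp
    qed
  qed
  then have "card {T. ptableau la T \<and> colword la T \<in> V} = card {As \<in> ?A. col_word As \<in> V}"
    by (rule bij_betw_same_card)
  moreover have fin: "finite ?A"
    by (rule finite_subset[OF _ finite_columns_lengths[of n UNIV "\<lambda>i. int (?c i)"]])
      (auto simp: has_lengths_def)
  moreover have "{As \<in> ?A. col_word As \<in> V} = ?A \<inter> {As. col_word As \<in> V}" by blast
  ultimately show ?thesis by (simp only: sum_of_bool_eq)
qed

text \<open>Taking \<open>n\<close> columns loses nothing, as a partition of \<open>n\<close> has at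
  most \<open>n\<close> of them. \<open>prod_hsym\<close> expands the complete functions, and
  \<open>ev\<close> of each determinant is a number of tableaux.\<close>

lemma F_Gamma_schur:
  "F_Gamma n V \<alpha> = (\<Sum>la\<in>{la. is_partition la \<and> sum_list la = n}.
     int (card {T :: nat \<times> nat \<Rightarrow> 'a. ptableau la T \<and> colword la T \<in> V}) * schur la \<alpha>)"
proof -
  let ?g = "\<lambda>w. of_bool (w \<in> V) :: int"
  let ?L = "{la. is_partition la \<and> sum_list la = n}"
  have t: "int (card {T :: nat \<times> nat \<Rightarrow> 'a. ptableau la T \<and> colword la T \<in> V}) = ev ?g (ejt n (col_height la))"
    if la: "la \<in> ?L" for la
  proof -
    have "col_height la \<in> shapes n n" by (rule bij_betw_apply[OF bij_betw_col_height la])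
    then have "ev ?g (ejt n (col_height la)) =
      (\<Sum>As\<in>{As\<in>columns n UNIV. \<not> has_flaw As \<and> (\<forall>i<n. length (As ! i) = col_height la i)}. ?g (col_word As))"
      by (intro ev_ejt[OF invariant_indicator]) (simp add: shapes_def)
    then show ?thesis using card_tableaux[of la] la by simp
  qed
  have s: "schur la \<alpha> = int (card (fillings (col_height la) \<alpha>))" if "la \<in> ?L" for la
    using that by (simp add: schur_eq_fillings)
  have rhs: "(\<Sum>la\<in>?L. int (card {T :: nat \<times> nat \<Rightarrow> 'a. ptableau la T \<and> colword la T \<in> V}) * schur la \<alpha>) =
      (\<Sum>c\<in>shapes n n. int (card (fillings c \<alpha>)) * ev ?g (ejt n c))"
    unfolding sum.reindex_bij_betw[OF bij_betw_col_height[of n], symmetric]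
    by (rule sum.cong[OF refl]) (simp only: t s mult.commute)
  show ?thesis
  proof (cases "weight \<alpha> n")
    case True
    obtain B where B: "\<And>k. B \<le> k \<Longrightarrow> \<alpha> k = 0" "(\<Sum>k<B. \<alpha> k) = n"
      "(\<Prod>k<B. hsym (\<alpha> k)) = (\<Prod>k\<in>supp \<alpha>. hsym (\<alpha> k))"
      using weight_bound[OF True] by blast
    have b: "below B \<alpha> = \<alpha>" using B(1) by (auto simp: below_def fun_eq_iff)
    have ev_nat: "ev ?g (of_nat m * p) = int m * ev ?g p" for m p
      by (induction m) (auto simp: distrib_right ev_add)
    have "F_Gamma n V \<alpha> = ev ?g (\<Sum>c\<in>shapes n n. of_nat (card (fillings c \<alpha>)) * ejt n c)"
      unfolding F_Gamma_weight[OF True] B(3)[symmetric]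
      using prod_hsym[of \<alpha> B n] B(2) b by simp
    then show ?thesis unfolding rhs by (simp add: ev_sum ev_nat)
  next
    case False
    then show ?thesis unfolding rhs by (simp add: F_Gamma_no_weight fillings_no_weight[OF False])
  qed
qed

text \<open>A permutation of the variables only reindexes the product of commuting complete
  functions in \<open>F_Gamma_weight\<close>.\<close>

lemma symmetric_F_Gamma: "symmetric_fn (F_Gamma n V)"
  unfolding symmetric_fn_def
proof (intro allI impI)
  fix \<pi> :: "nat \<Rightarrow> nat" and \<alpha>
  assume \<pi>: "bij \<pi>"
  have b: "bij_betw \<pi> (supp (\<alpha> \<circ> \<pi>)) (supp \<alpha>)"
  proof (rule bij_betw_imageI)
    show "inj_on \<pi> (supp (\<alpha> \<circ> \<pi>))" using \<pi> by (meson bij_is_inj inj_on_subset subset_UNIV)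
    show "\<pi> ` supp (\<alpha> \<circ> \<pi>) = supp \<alpha>"
    proof (intro equalityI subsetI)
      fix k assume "k \<in> supp \<alpha>"
      moreover obtain l where "k = \<pi> l" using \<pi> by (meson bij_pointE)
      ultimately show "k \<in> \<pi> ` supp (\<alpha> \<circ> \<pi>)" by (auto simp: supp_def)
    qed (auto simp: supp_def)
  qed
  have w: "weight (\<alpha> \<circ> \<pi>) n \<longleftrightarrow> weight \<alpha> n"
    using bij_betw_finite[OF b] sum.reindex_bij_betw[OF b, of \<alpha>] by (simp add: weight_def)
  have "(\<Prod>k\<in>supp (\<alpha> \<circ> \<pi>). hsym ((\<alpha> \<circ> \<pi>) k)) = (\<Prod>k\<in>supp \<alpha>. hsym (\<alpha> k))"
    using prod.reindex_bij_betw[OF b, of "\<lambda>k. hsym (\<alpha> k)"] by simp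
  then show "F_Gamma n V (\<alpha> \<circ> \<pi>) = F_Gamma n V \<alpha>"
    using w by (cases "weight \<alpha> n") (simp_all add: F_Gamma_weight F_Gamma_no_weight)
qed

end

end

theorem mainTheorem3:
  fixes V :: "'a::order list set" and n :: nat
  assumes "finite (UNIV :: 'a set)"
    and "three_one_free (UNIV :: 'a set)"
    and "knuth_equiv_graph n V"
  shows "symmetric_fn (F_Gamma n V) \<and>
         (\<forall>\<alpha>. F_Gamma n V \<alpha> =
            (\<Sum>la\<in>{la. is_partition la \<and> sum_list la = n}.
               int (card {T :: nat \<times> nat \<Rightarrow> 'a. ptableau la T \<and> colword la T \<in> V}) * schur la \<alpha>))"
proof -
  interpret free31_poset
    using free31_order_less[OF assms(1,2)] by (rule free31_poset.intro)
  show ?thesis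
    using symmetric_F_Gamma[OF assms(3)] F_Gamma_schur[OF assms(3)] by blast
qed

end
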